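(* Let $n\ge 3$. Let $L$ be the free Lie algebra over $\mathbb{Z}$ on the set $\{y_{ij}: 2\le i\le n,\ 1\le j\le i\}$ and let $J$ be the ideal of $L$ generated by all elements of the form (1) $[y_{mi},y_{ri}]$, $2\le r<m\le n$, $1\le i\le r$; (2) $[y_{mi},y_{rj}]$, $2\le r<i\le m\le n$, $1\le j\le r$; (3) $[y_{mi},y_{rj}]-[y_{mi},y_{mj}]$, $2\le r<m\le n$, $1\le i\le r$, $1\le j\le r$, $j\ne i$. Then $L/J\cong \mathrm{gr}(I_n)$ as Lie algebras.
   Context: $F_n$ is the free group on $\{x_1,\ldots,x_n\}$. For $2\le m\le n$ and $1\le i\le m$ let $y_{mi}\in\mathrm{Aut}(F_n)$ be given by $y_{mi}(x_k)=x_i^{-1}x_kx_i$ for $k\le m$ and $y_{mi}(x_k)=x_k$ for $k>m$. $I_n$ is the subgroup of $\mathrm{Aut}(F_n)$ generated by all these automorphisms $y_{mi}$. (In the claim the same symbols denote free Lie generators.) For a group $G$, $\gamma_c(G)$ is the $c$-th term of the lower central series and $\mathrm{gr}(G)=\bigoplus_{c\ge1}\gamma_c(G)/\gamma_{c+1}(G)$ is the associated graded Lie algebra over $\mathbb{Z}$, with bracket induced by the group commutator $[a,b]=a^{-1}b^{-1}ab$. *)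

theory Defs
  imports "HOL-Algebra.Bij" "HOL-Algebra.Generated_Groups" "HOL-Algebra.Product_Groups"
    "HOL-Algebra.QuotRing"
begin

section \<open>Free groups\<close>

text \<open>The letter \<open>(x, True)\<close> stands for the generator \<open>x\<close> and \<open>(x, False)\<close> for its inverse;
  the elements of the free group are the reduced words.\<close>

fun inv_letter :: "'a \<times> bool \<Rightarrow> 'a \<times> bool" where
  "inv_letter (x, e) = (x, \<not> e)"

fun prepend :: "'a \<times> bool \<Rightarrow> ('a \<times> bool) list \<Rightarrow> ('a \<times> bool) list" where
  "prepend a [] = [a]"
| "prepend a (b # w) = (if b = inv_letter a then w else a # b # w)"

abbreviation reduced :: "('a \<times> bool) list \<Rightarrow> bool" where
  "reduced \<equiv> successively (\<lambda>a b. b \<noteq> inv_letter a)"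

definition free_group :: "'a set \<Rightarrow> ('a \<times> bool) list monoid" where
  "free_group X =
     \<lparr>carrier = {w. set w \<subseteq> X \<times> UNIV \<and> reduced w},
      mult = (\<lambda>u v. foldr prepend u v),
      one = []\<rparr>"

definition free_gen :: "'a \<Rightarrow> ('a \<times> bool) list" where
  "free_gen x = [(x, True)]"

text \<open>The homomorphism from the free group on \<open>X\<close> to \<open>G\<close> that sends each generator \<open>x\<close> to \<open>h x\<close>.\<close>

definition word_eval :: "('b, 'm) monoid_scheme \<Rightarrow> ('a \<Rightarrow> 'b) \<Rightarrow> ('a \<times> bool) list \<Rightarrow> 'b" where
  "word_eval G h w =
     foldr (\<lambda>(x, e) g. (if e then h x else inv\<^bsub>G\<^esub> (h x)) \<otimes>\<^bsub>G\<^esub> g) w \<one>\<^bsub>G\<^esub>"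

definition free_group_ext ::
    "'a set \<Rightarrow> ('b, 'm) monoid_scheme \<Rightarrow> ('a \<Rightarrow> 'b) \<Rightarrow> ('a \<times> bool) list \<Rightarrow> 'b" where
  "free_group_ext X G h = (\<lambda>w\<in>carrier (free_group X). word_eval G h w)"

lemma inv_letter_inv_letter [simp]: "inv_letter (inv_letter a) = a"
  by (cases a) simp

lemma fst_inv_letter [simp]: "fst (inv_letter a) = fst a"
  by (cases a) simp

lemma inv_letter_neq [simp]: "inv_letter a \<noteq> a" "a \<noteq> inv_letter a"
  by (cases a, simp)+

lemma set_prepend: "set (prepend a w) \<subseteq> insert a (set w)"
  by (cases w) auto

lemma reduced_prepend: "reduced w \<Longrightarrow> reduced (prepend a w)"
  by (cases w) (auto simp: successively_Cons)

lemma prepend_cancel: "reduced w \<Longrightarrow> prepend a (prepend (inv_letter a) w) = w"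
  by (cases w rule: remdups_adj.cases) (auto simp: successively_Cons)

lemma reduced_foldr_prepend: "reduced v \<Longrightarrow> reduced (foldr prepend u v)"
  by (induction u) (auto intro: reduced_prepend)

lemma set_foldr_prepend: "set (foldr prepend u v) \<subseteq> set u \<union> set v"
proof (induction u)
  case (Cons a u)
  then show ?case using set_prepend[of a "foldr prepend u v"] by auto
qed simp

lemma foldr_prepend_Nil: "reduced w \<Longrightarrow> foldr prepend w [] = w"
proof (induction w)
  case (Cons a w)
  then show ?case by (cases w) (auto simp: successively_Cons)
qed simp

lemma foldr_prepend_prepend:
  assumes "reduced w"
  shows "foldr prepend (prepend a v) w = prepend a (foldr prepend v w)"
proof (cases v)
  case (Cons b v')
  have "reduced (foldr prepend v' w)"
    using assms by (rule reduced_foldr_prepend)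
  then show ?thesis
    using Cons prepend_cancel[of "foldr prepend v' w" a] by auto
qed simp

lemma foldr_prepend_assoc:
  assumes "reduced w"
  shows "foldr prepend (foldr prepend u v) w = foldr prepend u (foldr prepend v w)"
  by (induction u) (simp_all add: foldr_prepend_prepend[OF assms])

lemma foldr_prepend_inverse:
  assumes "reduced v"
  shows "foldr prepend (map inv_letter (rev w)) (foldr prepend w v) = v"
  using assms
proof (induction w arbitrary: v)
  case (Cons a w)
  have "reduced (foldr prepend w v)"
    using Cons.prems by (rule reduced_foldr_prepend)
  then have "prepend (inv_letter a) (prepend a (foldr prepend w v)) = foldr prepend w v"
    using prepend_cancel[of _ "inv_letter a"] by simp
  then show ?case using Cons by simp
qed simp

lemma reduced_inverse:
  assumes "reduced w"
  shows "reduced (map inv_letter (rev w))"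
proof -
  have "reduced (rev w)"
    unfolding successively_rev using assms
    by (rule successively_mono) (metis inv_letter_inv_letter)
  then show ?thesis
    unfolding successively_map by (rule successively_mono) (metis inv_letter_inv_letter)
qed

theorem group_free_group: "group (free_group X)"
proof (rule groupI)
  fix u v assume "u \<in> carrier (free_group X)" "v \<in> carrier (free_group X)"
  then show "u \<otimes>\<^bsub>free_group X\<^esub> v \<in> carrier (free_group X)"
    using set_foldr_prepend[of u v] reduced_foldr_prepend[of v u]
    by (auto simp: free_group_def)
next
  fix w assume w: "w \<in> carrier (free_group X)"
  have "map inv_letter (rev w) \<in> carrier (free_group X)"
    using w reduced_inverse[of w] by (force simp: free_group_def)
  moreover have "map inv_letter (rev w) \<otimes>\<^bsub>free_group X\<^esub> w = \<one>\<^bsub>free_group X\<^esub>"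
    using w foldr_prepend_inverse[of "[]" w] by (simp add: free_group_def foldr_prepend_Nil)
  ultimately show "\<exists>v\<in>carrier (free_group X). v \<otimes>\<^bsub>free_group X\<^esub> w = \<one>\<^bsub>free_group X\<^esub>" ..
qed (auto simp: free_group_def foldr_prepend_assoc)

lemma free_gen_in_carrier: "x \<in> X \<Longrightarrow> free_gen x \<in> carrier (free_group X)"
  by (simp add: free_gen_def free_group_def)

context group
begin

lemma word_eval_closed:
  assumes "h \<in> X \<rightarrow> carrier G" "set w \<subseteq> X \<times> UNIV"
  shows "word_eval G h w \<in> carrier G"
  using assms by (induction w) (auto simp: word_eval_def Pi_iff)

lemma word_eval_prepend:
  assumes "h \<in> X \<rightarrow> carrier G" "set (a # w) \<subseteq> X \<times> UNIV"
  shows "word_eval G h (prepend a w) = word_eval G h [a] \<otimes> word_eval G h w"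
proof (cases w)
  case Nil
  then show ?thesis using word_eval_closed[OF assms(1), of "[a]"] assms(2)
    by (simp add: word_eval_def)
next
  case (Cons b w')
  obtain x e where a: "a = (x, e)" by (cases a)
  have "h x \<in> carrier G" using assms a by auto
  moreover have "word_eval G h w' \<in> carrier G"
    using word_eval_closed[OF assms(1)] assms(2) Cons by simp
  ultimately show ?thesis
    using Cons a word_eval_closed[OF assms(1), of w] assms(2)
    by (auto simp: word_eval_def m_assoc[symmetric])
qed

lemma word_eval_foldr_prepend:
  assumes "h \<in> X \<rightarrow> carrier G" "set u \<subseteq> X \<times> UNIV" "set v \<subseteq> X \<times> UNIV"
  shows "word_eval G h (foldr prepend u v) = word_eval G h u \<otimes> word_eval G h v"
  using assms(2)
proof (induction u)
  case Nil
  then show ?case using word_eval_closed[OF assms(1,3)] by (simp add: word_eval_def)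
next
  case (Cons a u)
  have *: "word_eval G h [a] \<in> carrier G" "word_eval G h u \<in> carrier G"
      "word_eval G h v \<in> carrier G"
    using word_eval_closed[OF assms(1)] Cons.prems assms(3) by auto
  have "set (a # foldr prepend u v) \<subseteq> X \<times> UNIV"
    using Cons.prems assms(3) set_foldr_prepend[of u v] by auto
  then have "word_eval G h (foldr prepend (a # u) v) =
      word_eval G h [a] \<otimes> (word_eval G h u \<otimes> word_eval G h v)"
    using word_eval_prepend[OF assms(1)] Cons by simp
  also have "\<dots> = word_eval G h [a] \<otimes> word_eval G h u \<otimes> word_eval G h v"
    using * by (simp add: m_assoc)
  also have "word_eval G h [a] \<otimes> word_eval G h u = word_eval G h (a # u)"
  proof (cases a)
    case (Pair x e)
    then have "h x \<in> carrier G" using Cons.prems assms(1) by auto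
    then show ?thesis using Pair *(2) by (simp add: word_eval_def m_assoc)
  qed
  finally show ?case .
qed

theorem free_group_ext_hom:
  assumes "h \<in> X \<rightarrow> carrier G"
  shows "free_group_ext X G h \<in> hom (free_group X) G"
proof (rule homI)
  fix u v assume uv: "u \<in> carrier (free_group X)" "v \<in> carrier (free_group X)"
  then have "u \<otimes>\<^bsub>free_group X\<^esub> v \<in> carrier (free_group X)"
    using group_free_group group.is_monoid monoid.m_closed by metis
  then show "free_group_ext X G h (u \<otimes>\<^bsub>free_group X\<^esub> v) =
      free_group_ext X G h u \<otimes> free_group_ext X G h v"
    using uv word_eval_foldr_prepend[OF assms] by (simp add: free_group_ext_def free_group_def)
qed (use word_eval_closed[OF assms] in \<open>auto simp: free_group_ext_def free_group_def\<close>)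

lemma free_group_ext_gen:
  assumes "h \<in> X \<rightarrow> carrier G" "x \<in> X"
  shows "free_group_ext X G h (free_gen x) = h x"
proof -
  have "h x \<in> carrier G" using assms by auto
  then show ?thesis using free_gen_in_carrier[OF assms(2)]
    by (simp add: free_group_ext_def word_eval_def free_gen_def)
qed

theorem free_group_ext_unique:
  assumes f: "f \<in> hom (free_group X) G" and w: "w \<in> carrier (free_group X)"
    and h: "\<And>x. x \<in> X \<Longrightarrow> f (free_gen x) = h x"
  shows "f w = free_group_ext X G h w"
proof -
  interpret F: group "free_group X" by (rule group_free_group)
  interpret f: group_hom "free_group X" G f
    using f by unfold_locales
  have "f w = word_eval G h w"
    using w
  proof (induction w)
    case Nil
    have "f [] = \<one>" using f.hom_one by (simp add: free_group_def)
    then show ?case by (simp add: word_eval_def)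
  next
    case (Cons a w)
    obtain x e where a: "a = (x, e)" by (cases a)
    have x: "x \<in> X" and w: "w \<in> carrier (free_group X)" and
      aw: "[a] \<in> carrier (free_group X)" "a # w = [a] \<otimes>\<^bsub>free_group X\<^esub> w"
      using Cons.prems a by (cases w; auto simp: free_group_def)+
    have fx: "f (free_gen x) = h x" "free_gen x \<in> carrier (free_group X)"
      using x h free_gen_in_carrier by auto
    have "[(x, False)] = inv\<^bsub>free_group X\<^esub> free_gen x"
      by (rule F.inv_equality[symmetric])
        (use x in \<open>auto simp: free_group_def free_gen_def\<close>)
    then have "f [a] = (if e then h x else inv (h x))"
      using fx a f.hom_inv[OF fx(2)] by (simp add: free_gen_def)
    moreover have "f (a # w) = f [a] \<otimes> f w"
      using f.hom_mult[OF aw(1) w] aw(2) by simp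
    ultimately show ?case
      using Cons.IH[OF w] a by (simp add: word_eval_def)
  qed
  then show ?thesis using w by (simp add: free_group_ext_def)
qed

end


section \<open>The group generated by the partial inner automorphisms\<close>

abbreviation F :: "nat \<Rightarrow> (nat \<times> bool) list monoid" where
  "F n \<equiv> free_group {1..n}"

definition y_aut :: "nat \<Rightarrow> nat \<Rightarrow> nat \<Rightarrow> (nat \<times> bool) list \<Rightarrow> (nat \<times> bool) list" where
  "y_aut n m i = free_group_ext {1..n} (F n)
     (\<lambda>k. if k \<le> m then inv\<^bsub>F n\<^esub> free_gen i \<otimes>\<^bsub>F n\<^esub> free_gen k \<otimes>\<^bsub>F n\<^esub> free_gen i
          else free_gen k)"

definition I_group :: "nat \<Rightarrow> ((nat \<times> bool) list \<Rightarrow> (nat \<times> bool) list) monoid" where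
  "I_group n = subgroup_generated (AutoGroup (F n))
     {y_aut n m i | m i. 2 \<le> m \<and> m \<le> n \<and> 1 \<le> i \<and> i \<le> m}"

lemma y_aut_gen:
  assumes "1 \<le> i" "i \<le> n" "1 \<le> k" "k \<le> n"
  shows "y_aut n m i (free_gen k) =
    (if k \<le> m then inv\<^bsub>F n\<^esub> free_gen i \<otimes>\<^bsub>F n\<^esub> free_gen k \<otimes>\<^bsub>F n\<^esub> free_gen i
     else free_gen k)"
proof -
  interpret group "F n" by (rule group_free_group)
  show ?thesis unfolding y_aut_def
    by (rule free_group_ext_gen) (use assms in \<open>auto simp: free_gen_in_carrier simp del: One_nat_def\<close>)
qed

theorem y_aut_in_AutoGroup:
  assumes "1 \<le> i" "i \<le> m" "m \<le> n"
  shows "y_aut n m i \<in> carrier (AutoGroup (F n))"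
proof -
  interpret group "F n" by (rule group_free_group)
  note One_nat_def [simp del]
  define x where "x = (free_gen :: nat \<Rightarrow> _)"
  have x [simp]: "x k \<in> carrier (F n)" if "k \<in> {1..n}" for k
    using that free_gen_in_carrier unfolding x_def by metis
  have xi: "x i \<in> carrier (F n)" and i: "i \<in> {1..n}"
    using assms x[of i] by simp_all
  define h where "h = (\<lambda>k. if k \<le> m then inv\<^bsub>F n\<^esub> x i \<otimes>\<^bsub>F n\<^esub> x k \<otimes>\<^bsub>F n\<^esub> x i else x k)"
  define h' where "h' = (\<lambda>k. if k \<le> m then x i \<otimes>\<^bsub>F n\<^esub> x k \<otimes>\<^bsub>F n\<^esub> inv\<^bsub>F n\<^esub> x i else x k)"
  have h: "h \<in> {1..n} \<rightarrow> carrier (F n)" "h' \<in> {1..n} \<rightarrow> carrier (F n)"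
    using xi by (auto simp: h_def h'_def)
  define f where "f = free_group_ext {1..n} (F n) h"
  define f' where "f' = free_group_ext {1..n} (F n) h'"
  have y: "y_aut n m i = f" by (simp only: y_aut_def f_def h_def x_def)
  have fh: "f \<in> hom (F n) (F n)" "f' \<in> hom (F n) (F n)"
    unfolding f_def f'_def by (intro free_group_ext_hom h)+
  interpret f: group_hom "F n" "F n" f using fh by unfold_locales
  interpret f': group_hom "F n" "F n" f' using fh by unfold_locales
  have gen: "f (x k) = h k" "f' (x k) = h' k" if "k \<in> {1..n}" for k
    unfolding f_def f'_def x_def by (intro free_group_ext_gen h that)+
  have hi: "h i = x i" "h' i = x i"
    using xi assms by (simp_all add: h_def h'_def m_assoc)
  have id: "w = free_group_ext {1..n} (F n) x w" if "w \<in> carrier (F n)" for w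
    using free_group_ext_unique[of "\<lambda>w. w" "{1..n}" w x] that by (simp add: x_def hom_def)
  have conj: "inv\<^bsub>F n\<^esub> a \<otimes>\<^bsub>F n\<^esub> (a \<otimes>\<^bsub>F n\<^esub> b \<otimes>\<^bsub>F n\<^esub> inv\<^bsub>F n\<^esub> a) \<otimes>\<^bsub>F n\<^esub> a = b"
    "a \<otimes>\<^bsub>F n\<^esub> (inv\<^bsub>F n\<^esub> a \<otimes>\<^bsub>F n\<^esub> b \<otimes>\<^bsub>F n\<^esub> a) \<otimes>\<^bsub>F n\<^esub> inv\<^bsub>F n\<^esub> a = b"
    if "a \<in> carrier (F n)" "b \<in> carrier (F n)" for a b
    using that by (simp_all add: m_assoc inv_solve_left)
      (simp_all add: m_assoc[symmetric])
  have "f' (f w) = w" if "w \<in> carrier (F n)" for w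
  proof -
    have "(f' \<circ> f) w = free_group_ext {1..n} (F n) x w"
    proof (rule free_group_ext_unique)
      show "f' \<circ> f \<in> hom (F n) (F n)" using fh by (metis Group.hom_compose)
      fix k :: nat assume k: "k \<in> {1..n}"
      show "(f' \<circ> f) (free_gen k) = x k"
      proof (cases "k \<le> m")
        case True
        then have "f' (h k) = inv\<^bsub>F n\<^esub> x i \<otimes>\<^bsub>F n\<^esub> h' k \<otimes>\<^bsub>F n\<^esub> x i"
          using k i xi gen hi by (simp add: h_def)
        also have "\<dots> = x k" using True conj[OF xi x[OF k]] by (simp add: h'_def)
        finally show ?thesis using gen[OF k] by (simp add: x_def)
      next
        case False
        then show ?thesis using gen[OF k] by (simp add: h_def h'_def x_def)
      qed
    qed (rule that)
    then show ?thesis using id[OF that] by simp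
  qed
  moreover have "f (f' w) = w" if "w \<in> carrier (F n)" for w
  proof -
    have "(f \<circ> f') w = free_group_ext {1..n} (F n) x w"
    proof (rule free_group_ext_unique)
      show "f \<circ> f' \<in> hom (F n) (F n)" using fh by (metis Group.hom_compose)
      fix k :: nat assume k: "k \<in> {1..n}"
      show "(f \<circ> f') (free_gen k) = x k"
      proof (cases "k \<le> m")
        case True
        then have "f (h' k) = x i \<otimes>\<^bsub>F n\<^esub> h k \<otimes>\<^bsub>F n\<^esub> inv\<^bsub>F n\<^esub> x i"
          using k i xi gen hi by (simp add: h'_def)
        also have "\<dots> = x k" using True conj[OF xi x[OF k]] by (simp add: h_def)
        finally show ?thesis using gen[OF k] by (simp add: x_def)
      next
        case False
        then show ?thesis using gen[OF k] by (simp add: h_def h'_def x_def)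
      qed
    qed (rule that)
    then show ?thesis using id[OF that] by simp
  qed
  ultimately have "bij_betw f (carrier (F n)) (carrier (F n))"
    by (intro bij_betwI[where g = f']) auto
  moreover have "f \<in> extensional (carrier (F n))"
    by (simp add: f_def free_group_ext_def)
  ultimately show ?thesis
    using fh y by (simp add: AutoGroup_def auto_def Bij_def)
qed


section \<open>Lie rings\<close>

text \<open>A Lie algebra over the integers is stored in a ring record: \<open>\<oplus>\<close> is addition and \<open>\<otimes>\<close> is the
  Lie bracket. The field \<open>one\<close> has no meaning. With this representation \<open>L Quot I\<close> is the
  quotient Lie ring.\<close>

locale lie_ring = abelian_group L for L (structure) +
  assumes bracket_closed: "\<lbrakk>x \<in> carrier L; y \<in> carrier L\<rbrakk> \<Longrightarrow> x \<otimes> y \<in> carrier L"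
    and bracket_add_left: "\<lbrakk>x \<in> carrier L; y \<in> carrier L; z \<in> carrier L\<rbrakk> \<Longrightarrow>
      (x \<oplus> y) \<otimes> z = x \<otimes> z \<oplus> y \<otimes> z"
    and bracket_add_right: "\<lbrakk>x \<in> carrier L; y \<in> carrier L; z \<in> carrier L\<rbrakk> \<Longrightarrow>
      x \<otimes> (y \<oplus> z) = x \<otimes> y \<oplus> x \<otimes> z"
    and bracket_self: "x \<in> carrier L \<Longrightarrow> x \<otimes> x = \<zero>"
    and jacobi: "\<lbrakk>x \<in> carrier L; y \<in> carrier L; z \<in> carrier L\<rbrakk> \<Longrightarrow>
      x \<otimes> (y \<otimes> z) \<oplus> y \<otimes> (z \<otimes> x) \<oplus> z \<otimes> (x \<otimes> y) = \<zero>"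

definition lie_hom :: "('a, 'm) ring_scheme \<Rightarrow> ('b, 'k) ring_scheme \<Rightarrow> ('a \<Rightarrow> 'b) set" where
  "lie_hom L M = {f \<in> hom (add_monoid L) (add_monoid M).
     \<forall>x\<in>carrier L. \<forall>y\<in>carrier L. f (x \<otimes>\<^bsub>L\<^esub> y) = f x \<otimes>\<^bsub>M\<^esub> f y}"

definition lie_isomorphic :: "('a, 'm) ring_scheme \<Rightarrow> ('b, 'k) ring_scheme \<Rightarrow> bool" where
  "lie_isomorphic L M \<longleftrightarrow> (\<exists>f\<in>lie_hom L M. bij_betw f (carrier L) (carrier M))"

definition lie_ideal :: "'a set \<Rightarrow> ('a, 'm) ring_scheme \<Rightarrow> bool" where
  "lie_ideal I L \<longleftrightarrow> additive_subgroup I L \<and>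
     (\<forall>x\<in>carrier L. \<forall>a\<in>I. x \<otimes>\<^bsub>L\<^esub> a \<in> I \<and> a \<otimes>\<^bsub>L\<^esub> x \<in> I)"

definition gen_lie_ideal :: "('a, 'm) ring_scheme \<Rightarrow> 'a set \<Rightarrow> 'a set" where
  "gen_lie_ideal L S = \<Inter> {I. lie_ideal I L \<and> S \<subseteq> I}"


section \<open>Free Lie rings\<close>

text \<open>The free Lie ring on \<open>X\<close> consists of the formal Lie expressions in \<open>X\<close> modulo the least
  congruence that forces the Lie ring axioms.\<close>

datatype 'a lie_term =
    Gen 'a
  | Zero
  | Neg "'a lie_term"
  | Add "'a lie_term" "'a lie_term"
  | Br "'a lie_term" "'a lie_term"

definition lie_terms :: "'a set \<Rightarrow> 'a lie_term set" where
  "lie_terms X = {t. set_lie_term t \<subseteq> X}"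

inductive_set lie_cong :: "'a set \<Rightarrow> ('a lie_term \<times> 'a lie_term) set" for X where
  refl: "s \<in> lie_terms X \<Longrightarrow> (s, s) \<in> lie_cong X"
| sym: "(s, t) \<in> lie_cong X \<Longrightarrow> (t, s) \<in> lie_cong X"
| trans: "(s, t) \<in> lie_cong X \<Longrightarrow> (t, u) \<in> lie_cong X \<Longrightarrow> (s, u) \<in> lie_cong X"
| cong_Neg: "(s, t) \<in> lie_cong X \<Longrightarrow> (Neg s, Neg t) \<in> lie_cong X"
| cong_Add: "(s, t) \<in> lie_cong X \<Longrightarrow> (s', t') \<in> lie_cong X \<Longrightarrow> (Add s s', Add t t') \<in> lie_cong X"
| cong_Br: "(s, t) \<in> lie_cong X \<Longrightarrow> (s', t') \<in> lie_cong X \<Longrightarrow> (Br s s', Br t t') \<in> lie_cong X"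
| add_assoc: "\<lbrakk>s \<in> lie_terms X; t \<in> lie_terms X; u \<in> lie_terms X\<rbrakk> \<Longrightarrow>
    (Add (Add s t) u, Add s (Add t u)) \<in> lie_cong X"
| add_comm: "\<lbrakk>s \<in> lie_terms X; t \<in> lie_terms X\<rbrakk> \<Longrightarrow> (Add s t, Add t s) \<in> lie_cong X"
| add_zero: "s \<in> lie_terms X \<Longrightarrow> (Add Zero s, s) \<in> lie_cong X"
| add_neg: "s \<in> lie_terms X \<Longrightarrow> (Add (Neg s) s, Zero) \<in> lie_cong X"
| br_add_left: "\<lbrakk>s \<in> lie_terms X; t \<in> lie_terms X; u \<in> lie_terms X\<rbrakk> \<Longrightarrow>
    (Br (Add s t) u, Add (Br s u) (Br t u)) \<in> lie_cong X"
| br_add_right: "\<lbrakk>s \<in> lie_terms X; t \<in> lie_terms X; u \<in> lie_terms X\<rbrakk> \<Longrightarrow>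
    (Br s (Add t u), Add (Br s t) (Br s u)) \<in> lie_cong X"
| br_self: "s \<in> lie_terms X \<Longrightarrow> (Br s s, Zero) \<in> lie_cong X"
| br_jacobi: "\<lbrakk>s \<in> lie_terms X; t \<in> lie_terms X; u \<in> lie_terms X\<rbrakk> \<Longrightarrow>
    (Add (Add (Br s (Br t u)) (Br t (Br u s))) (Br u (Br s t)), Zero) \<in> lie_cong X"

definition lie_class :: "'a set \<Rightarrow> 'a lie_term \<Rightarrow> 'a lie_term set" where
  "lie_class X t = lie_cong X `` {t}"

definition free_lie_ring :: "'a set \<Rightarrow> 'a lie_term set ring" where
  "free_lie_ring X =
     \<lparr>carrier = lie_terms X // lie_cong X,
      mult = (\<lambda>A B. \<Union>s\<in>A. \<Union>t\<in>B. lie_class X (Br s t)),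
      one = lie_class X Zero,
      zero = lie_class X Zero,
      add = (\<lambda>A B. \<Union>s\<in>A. \<Union>t\<in>B. lie_class X (Add s t))\<rparr>"

lemma lie_terms_simps [simp]:
  "Gen x \<in> lie_terms X \<longleftrightarrow> x \<in> X"
  "Zero \<in> lie_terms X"
  "Neg s \<in> lie_terms X \<longleftrightarrow> s \<in> lie_terms X"
  "Add s t \<in> lie_terms X \<longleftrightarrow> s \<in> lie_terms X \<and> t \<in> lie_terms X"
  "Br s t \<in> lie_terms X \<longleftrightarrow> s \<in> lie_terms X \<and> t \<in> lie_terms X"
  by (auto simp: lie_terms_def)

lemma lie_cong_in_terms:
  "(s, t) \<in> lie_cong X \<Longrightarrow> s \<in> lie_terms X \<and> t \<in> lie_terms X"
  by (induction rule: lie_cong.induct) auto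

lemma equiv_lie_cong: "equiv (lie_terms X) (lie_cong X)"
proof (rule equivI)
  show "lie_cong X \<subseteq> lie_terms X \<times> lie_terms X"
    using lie_cong_in_terms by auto
  show "refl_on (lie_terms X) (lie_cong X)"
    by (auto simp: refl_on_def intro: lie_cong.refl)
  show "sym (lie_cong X)" by (rule symI) (rule lie_cong.sym)
  show "trans (lie_cong X)" by (rule transI) (rule lie_cong.trans)
qed

lemma lie_class_eq_iff:
  "s \<in> lie_terms X \<Longrightarrow> t \<in> lie_terms X \<Longrightarrow>
    lie_class X s = lie_class X t \<longleftrightarrow> (s, t) \<in> lie_cong X"
  unfolding lie_class_def by (rule eq_equiv_class_iff[OF equiv_lie_cong])

lemma carrier_free_lie_ring: "carrier (free_lie_ring X) = lie_class X ` lie_terms X"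
  by (auto simp: free_lie_ring_def quotient_def lie_class_def)

lemma lie_class_UN:
  assumes "s \<in> lie_terms X" "t \<in> lie_terms X"
    and cong: "\<And>s t s' t'. (s, s') \<in> lie_cong X \<Longrightarrow> (t, t') \<in> lie_cong X \<Longrightarrow>
      (c s t, c s' t') \<in> lie_cong X"
  shows "(\<Union>s'\<in>lie_class X s. \<Union>t'\<in>lie_class X t. lie_class X (c s' t')) = lie_class X (c s t)"
proof -
  have "lie_class X (c s' t') = lie_class X (c s t)"
    if "s' \<in> lie_class X s" "t' \<in> lie_class X t" for s' t'
    using that cong[of s s' t t'] equiv_class_eq[OF equiv_lie_cong]
    unfolding lie_class_def by blast
  moreover have "s \<in> lie_class X s" "t \<in> lie_class X t"
    using assms by (auto simp: lie_class_def intro: lie_cong.refl)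
  ultimately show ?thesis by blast
qed

lemma add_free_lie_ring:
  "s \<in> lie_terms X \<Longrightarrow> t \<in> lie_terms X \<Longrightarrow>
    lie_class X s \<oplus>\<^bsub>free_lie_ring X\<^esub> lie_class X t = lie_class X (Add s t)"
  using lie_class_UN[of s X t Add] by (simp add: free_lie_ring_def lie_cong.cong_Add)

lemma mult_free_lie_ring:
  "s \<in> lie_terms X \<Longrightarrow> t \<in> lie_terms X \<Longrightarrow>
    lie_class X s \<otimes>\<^bsub>free_lie_ring X\<^esub> lie_class X t = lie_class X (Br s t)"
  using lie_class_UN[of s X t Br] by (simp add: free_lie_ring_def lie_cong.cong_Br)

lemma zero_free_lie_ring: "\<zero>\<^bsub>free_lie_ring X\<^esub> = lie_class X Zero"
  by (simp add: free_lie_ring_def)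

theorem lie_ring_free_lie_ring: "lie_ring (free_lie_ring X)"
proof -
  note [simp] = imageI add_free_lie_ring mult_free_lie_ring zero_free_lie_ring lie_class_eq_iff
  have "abelian_group (free_lie_ring X)"
  proof (rule abelian_groupI; (unfold carrier_free_lie_ring)?)
    fix a assume "a \<in> lie_class X ` lie_terms X"
    then obtain s where "s \<in> lie_terms X" "a = lie_class X s" by auto
    then show "\<exists>b\<in>lie_class X ` lie_terms X. b \<oplus>\<^bsub>free_lie_ring X\<^esub> a = \<zero>\<^bsub>free_lie_ring X\<^esub>"
      by (intro bexI[of _ "lie_class X (Neg s)"]) (auto intro: lie_cong.intros)
  qed ((elim imageE)?; simp add: lie_cong.intros(7-9))+
  then show ?thesis
    by (intro lie_ring.intro lie_ring_axioms.intro; (unfold carrier_free_lie_ring)?)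
      (assumption | elim imageE; simp add: lie_cong.intros(11-14))+
qed

fun lie_eval :: "('b, 'm) ring_scheme \<Rightarrow> ('a \<Rightarrow> 'b) \<Rightarrow> 'a lie_term \<Rightarrow> 'b" where
  "lie_eval M h (Gen x) = h x"
| "lie_eval M h Zero = \<zero>\<^bsub>M\<^esub>"
| "lie_eval M h (Neg s) = \<ominus>\<^bsub>M\<^esub> lie_eval M h s"
| "lie_eval M h (Add s t) = lie_eval M h s \<oplus>\<^bsub>M\<^esub> lie_eval M h t"
| "lie_eval M h (Br s t) = lie_eval M h s \<otimes>\<^bsub>M\<^esub> lie_eval M h t"

theorem free_lie_ring_universal:
  assumes "lie_ring M" and h: "h \<in> X \<rightarrow> carrier M"
  shows "\<exists>f\<in>lie_hom (free_lie_ring X) M. \<forall>x\<in>X. f (lie_class X (Gen x)) = h x"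
    and "\<lbrakk>f \<in> lie_hom (free_lie_ring X) M; g \<in> lie_hom (free_lie_ring X) M;
      \<forall>x\<in>X. f (lie_class X (Gen x)) = g (lie_class X (Gen x)); a \<in> carrier (free_lie_ring X)\<rbrakk>
      \<Longrightarrow> f a = g a"
proof -
  interpret M: lie_ring M by fact
  interpret L: lie_ring "free_lie_ring X" by (rule lie_ring_free_lie_ring)
  have closed: "lie_eval M h t \<in> carrier M" if "t \<in> lie_terms X" for t
    using that h by (induction t) (auto intro: M.bracket_closed)
  have resp: "lie_eval M h s = lie_eval M h t" if "(s, t) \<in> lie_cong X" for s t
    using that
  proof (induction rule: lie_cong.induct)
    case (add_comm s t)
    then show ?case using closed M.a_comm by simp
  qed (simp_all add: closed M.a_assoc M.l_neg M.bracket_add_left M.bracket_add_right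
      M.bracket_self M.jacobi)
  define f where "f = (\<lambda>A. lie_eval M h (SOME t. t \<in> A))"
  have f: "f (lie_class X t) = lie_eval M h t" if "t \<in> lie_terms X" for t
  proof -
    have "t \<in> lie_class X t" using that by (simp add: lie_class_def lie_cong.refl)
    then have "(SOME s. s \<in> lie_class X t) \<in> lie_class X t" by (rule someI)
    then show ?thesis using resp by (auto simp: f_def lie_class_def)
  qed
  have "f \<in> lie_hom (free_lie_ring X) M"
    by (auto simp: lie_hom_def hom_def carrier_free_lie_ring add_free_lie_ring
        mult_free_lie_ring f closed)
  then show "\<exists>f\<in>lie_hom (free_lie_ring X) M. \<forall>x\<in>X. f (lie_class X (Gen x)) = h x"
    by (rule bexI[rotated]) (simp add: f)
next
  interpret M: lie_ring M by fact
  interpret L: lie_ring "free_lie_ring X" by (rule lie_ring_free_lie_ring)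
  assume fg: "f \<in> lie_hom (free_lie_ring X) M" "g \<in> lie_hom (free_lie_ring X) M"
    and eq: "\<forall>x\<in>X. f (lie_class X (Gen x)) = g (lie_class X (Gen x))"
    and a: "a \<in> carrier (free_lie_ring X)"
  interpret f: abelian_group_hom "free_lie_ring X" M f
    by (intro abelian_group_homI L.abelian_group_axioms M.abelian_group_axioms
        group_hom.intro group_hom_axioms.intro L.a_group M.a_group)
      (use fg in \<open>simp add: lie_hom_def\<close>)
  interpret g: abelian_group_hom "free_lie_ring X" M g
    by (intro abelian_group_homI L.abelian_group_axioms M.abelian_group_axioms
        group_hom.intro group_hom_axioms.intro L.a_group M.a_group)
      (use fg in \<open>simp add: lie_hom_def\<close>)
  have neg: "lie_class X (Neg s) = \<ominus>\<^bsub>free_lie_ring X\<^esub> lie_class X s" if "s \<in> lie_terms X" for s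
    by (rule L.minus_equality[symmetric])
      (use that in \<open>auto simp: add_free_lie_ring zero_free_lie_ring carrier_free_lie_ring
        lie_class_eq_iff intro: lie_cong.add_neg\<close>)
  have "f (lie_class X t) = g (lie_class X t)" if "t \<in> lie_terms X" for t
    using that
  proof (induction t)
    case (Gen x)
    then show ?case using eq by simp
  next
    case Zero
    then show ?case using f.hom_zero g.hom_zero by (simp add: zero_free_lie_ring)
  next
    case (Neg s)
    then show ?case using neg[of s] by (simp add: carrier_free_lie_ring)
  next
    case (Add s t)
    then show ?case
      using f.hom_add[of "lie_class X s" "lie_class X t"]
        g.hom_add[of "lie_class X s" "lie_class X t"]
      by (simp add: carrier_free_lie_ring add_free_lie_ring)
  next
    case (Br s t)
    then show ?case
      using fg by (auto simp: lie_hom_def carrier_free_lie_ring mult_free_lie_ring[symmetric])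
  qed
  then show "f a = g a" using a by (auto simp: carrier_free_lie_ring)
qed


section \<open>The graded Lie ring of a group\<close>

definition group_commutator :: "('a, 'm) monoid_scheme \<Rightarrow> 'a \<Rightarrow> 'a \<Rightarrow> 'a" where
  "group_commutator G a b = inv\<^bsub>G\<^esub> a \<otimes>\<^bsub>G\<^esub> inv\<^bsub>G\<^esub> b \<otimes>\<^bsub>G\<^esub> a \<otimes>\<^bsub>G\<^esub> b"

text \<open>The series starts at index 1; the value at 0 is a dummy.\<close>

fun lower_central :: "('a, 'm) monoid_scheme \<Rightarrow> nat \<Rightarrow> 'a set" where
  "lower_central G 0 = carrier G"
| "lower_central G (Suc 0) = carrier G"
| "lower_central G (Suc (Suc c)) = generate G
     {group_commutator G a b | a b. a \<in> lower_central G (Suc c) \<and> b \<in> carrier G}"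

definition gr_component :: "('a, 'm) monoid_scheme \<Rightarrow> nat \<Rightarrow> 'a set monoid" where
  "gr_component G c = (G\<lparr>carrier := lower_central G c\<rparr>) Mod lower_central G (Suc c)"

text \<open>The bracket of the cosets of \<open>a\<close> in degree \<open>i\<close> and \<open>b\<close> in degree \<open>j\<close> is the coset of the
  commutator of \<open>a\<close> and \<open>b\<close> in degree \<open>i + j\<close>. This coset does not depend on the
  representatives, so the union below is a single coset.\<close>

definition gr_bracket ::
    "('a, 'm) monoid_scheme \<Rightarrow> nat \<Rightarrow> nat \<Rightarrow> 'a set \<Rightarrow> 'a set \<Rightarrow> 'a set" where
  "gr_bracket G i j A B =
     (\<Union>a\<in>A. \<Union>b\<in>B. lower_central G (Suc (i + j)) #>\<^bsub>G\<^esub> group_commutator G a b)"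

definition gr :: "('a, 'm) monoid_scheme \<Rightarrow> (nat \<Rightarrow> 'a set) ring" where
  "gr G =
     \<lparr>carrier = carrier (sum_group {1..} (gr_component G)),
      mult = (\<lambda>f g. \<lambda>c\<in>{1..}.
        finprod (gr_component G c) (\<lambda>i. gr_bracket G i (c - i) (f i) (g (c - i))) {1..<c}),
      one = \<one>\<^bsub>sum_group {1..} (gr_component G)\<^esub>,
      zero = \<one>\<^bsub>sum_group {1..} (gr_component G)\<^esub>,
      add = (\<otimes>\<^bsub>sum_group {1..} (gr_component G)\<^esub>)\<rparr>"


section \<open>The presentation\<close>

definition y_index :: "nat \<Rightarrow> (nat \<times> nat) set" where
  "y_index n = {(i, j). 2 \<le> i \<and> i \<le> n \<and> 1 \<le> j \<and> j \<le> i}"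

abbreviation L :: "nat \<Rightarrow> (nat \<times> nat) lie_term set ring" where
  "L n \<equiv> free_lie_ring (y_index n)"

definition y_gen :: "nat \<Rightarrow> nat \<Rightarrow> nat \<Rightarrow> (nat \<times> nat) lie_term set" where
  "y_gen n i j = lie_class (y_index n) (Gen (i, j))"

definition J_relators :: "nat \<Rightarrow> (nat \<times> nat) lie_term set set" where
  "J_relators n =
     {y_gen n m i \<otimes>\<^bsub>L n\<^esub> y_gen n r i | m r i.
        2 \<le> r \<and> r < m \<and> m \<le> n \<and> 1 \<le> i \<and> i \<le> r}
   \<union> {y_gen n m i \<otimes>\<^bsub>L n\<^esub> y_gen n r j | m r i j.
        2 \<le> r \<and> r < i \<and> i \<le> m \<and> m \<le> n \<and> 1 \<le> j \<and> j \<le> r}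
   \<union> {y_gen n m i \<otimes>\<^bsub>L n\<^esub> y_gen n r j \<ominus>\<^bsub>L n\<^esub> y_gen n m i \<otimes>\<^bsub>L n\<^esub> y_gen n m j | m r i j.
        2 \<le> r \<and> r < m \<and> m \<le> n \<and> 1 \<le> i \<and> i \<le> r \<and> 1 \<le> j \<and> j \<le> r \<and> j \<noteq> i}"

definition J :: "nat \<Rightarrow> (nat \<times> nat) lie_term set set" where
  "J n = gen_lie_ideal (L n) (J_relators n)"

end

theory Submission
  imports Defs "HOL-Library.List_Lexorder" "HOL-Algebra.Free_Abelian_Groups"
begin

text \<open>Sending \<open>y\<^bsub>mi\<^esub>\<close> to the class of the inverse automorphism gives a surjective Lie homomorphism
  from \<open>L\<close> onto the graded ring whose kernel contains \<open>J\<close>. Modulo \<open>J\<close> the Lie ring \<open>L\<close> is spanned,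
  block by block, by the Hall trees in \<open>y\<^bsub>m1\<^esub>, \<dots>, y\<^bsub>mm\<^esub>\<close> for \<open>2 \<le> m \<le> n\<close>, so it remains to see
  that their images are independent. An automorphism in the \<open>c\<close>-th lower central term moves each
  generator \<open>x\<^bsub>k\<^esub>\<close> only modulo the term of index \<open>c + 1\<close> of the free group, and the leading part of
  this displacement in the Magnus expansion is additive. For the image of a Hall tree \<open>t\<close> of block
  \<open>m\<close> it is \<open>[P\<^bsub>t\<^esub>, X\<^bsub>k\<^esub>]\<close> if \<open>k \<le> m\<close> and \<open>0\<close> otherwise, where \<open>P\<^bsub>t\<^esub>\<close> is the Lie polynomial of \<open>t\<close>. Only
  powers of \<open>X\<^bsub>k\<^esub>\<close> commute with \<open>X\<^bsub>k\<^esub>\<close>, so the blocks separate, and within a block the \<open>P\<^bsub>t\<^esub>\<close> are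
  independent because the least word of \<open>P\<^bsub>t\<^esub>\<close> is the foliage of \<open>t\<close>.\<close>

section \<open>Noncommutative power series\<close>

text \<open>No structure theorem for \<open>I_group n\<close> and no count of ranks enters. Its
  lower central series is only bounded from above, by the automorphisms that shift every lower
  central term of the free group by \<open>c\<close> steps; independence of the images of the Hall
  trees then decides everything else. The obstacle is that a displacement sees the polynomials only
  through a commutator with a letter, and that the displacement of \<open>x_k\<close> mixes all
  blocks \<open>m >= k\<close>. For a vanishing combination of trees it yields that the sum of the
  polynomials of these blocks involves the letter \<open>X_k\<close> alone. The sums for
  \<open>k\<close> and \<open>k + 1\<close> differ by the polynomials of block \<open>k\<close>,
  which live in the letters up to \<open>k\<close>, so the blocks can be peeled off one after
  another. The peeling can start because the blocks begin at 2, conjugation of \<open>x_1\<close> by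
  itself being trivial: the sums for \<open>k = 1\<close> and \<open>k = 2\<close> coincide, so they
  cannot involve any letter, and they have no constant term.\<close>

fun conv :: "('a list \<Rightarrow> int) \<Rightarrow> ('a list \<Rightarrow> int) \<Rightarrow> 'a list \<Rightarrow> int" where
  "conv f g [] = f [] * g []"
| "conv f g (x # w) = f [] * g (x # w) + conv (\<lambda>v. f (x # v)) g w"

lemma conv_add_left: "conv (\<lambda>v. f v + f' v) g w = conv f g w + conv f' g w"
  by (induction w arbitrary: f f') (auto simp: algebra_simps)

lemma conv_add_right: "conv f (\<lambda>v. g v + g' v) w = conv f g w + conv f g' w"
  by (induction w arbitrary: f) (auto simp: algebra_simps)

lemma conv_scale_left: "conv (\<lambda>v. c * f v) g w = c * conv f g w"
  by (induction w arbitrary: f) (auto simp: algebra_simps)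

text \<open>\<open>conv f g w\<close> sums \<open>f u * g v\<close> over all cuts
  \<open>w = u @ v\<close>, by deciding at the first letter whether \<open>u\<close> is empty. The
  recursive call replaces \<open>f\<close> by its shift along that letter, so the induction on
  \<open>w\<close> has to leave \<open>f\<close> general.\<close>

lemma conv_assoc: "conv (conv f g) h w = conv f (conv g h) w"
proof (induction w arbitrary: f)
  case (Cons x w)
  have "conv (\<lambda>v. conv f g (x # v)) h w =
      f [] * conv (\<lambda>v. g (x # v)) h w + conv (conv (\<lambda>v. f (x # v)) g) h w"
    by (simp add: conv_add_left conv_scale_left)
  then show ?case using Cons by (simp add: algebra_simps)
qed simp

lemma conv_zero_left [simp]: "conv (\<lambda>_. 0) g w = 0"
  by (induction w) auto

lemma conv_one_left: "conv (\<lambda>v. if v = [] then 1 else 0) g w = g w"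
  by (cases w) auto

lemma conv_one_right: "conv f (\<lambda>v. if v = [] then 1 else 0) w = f w"
  by (induction w arbitrary: f) auto

lemma conv_nonzeroE:
  assumes "conv f g w \<noteq> 0"
  obtains u v where "w = u @ v" "f u \<noteq> 0" "g v \<noteq> 0"
  using assms
proof (induction w arbitrary: f thesis)
  case Nil
  then show ?case by (auto intro: Nil(1)[of "[]" "[]"])
next
  case (Cons x w)
  show ?case
  proof (cases "f [] * g (x # w) = 0")
    case True
    then have "conv (\<lambda>v. f (x # v)) g w \<noteq> 0" using Cons.prems(2) by (auto simp del: mult_eq_0_iff)
    then obtain u v where "w = u @ v" "f (x # u) \<noteq> 0" "g v \<noteq> 0"
      using Cons.IH[of "\<lambda>v. f (x # v)"] by auto
    then show ?thesis using Cons.prems(1)[of "x # u" v] by simp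
  next
    case False
    then show ?thesis using Cons.prems(1)[of "[]" "x # w"] by auto
  qed
qed

text \<open>The bounds leave a single cut: a prefix shorter than \<open>c\<close> kills the first
  factor, and a longer one leaves a suffix shorter than \<open>d\<close>, which kills the
  second.\<close>

lemma conv_low_left:
  assumes "\<And>v. length v < d \<Longrightarrow> g v = 0" "length w = c + d" "\<And>v. length v < c \<Longrightarrow> f v = 0"
  shows "conv f g w = f (take c w) * g (drop c w)"
  using assms(2,3)
proof (induction w arbitrary: f c)
  case (Cons x w)
  show ?case
  proof (cases c)
    case 0
    have "conv (\<lambda>v. f (x # v)) g w = 0"
    proof (rule ccontr)
      assume "conv (\<lambda>v. f (x # v)) g w \<noteq> 0"
      then obtain u v where "w = u @ v" "g v \<noteq> 0" by (rule conv_nonzeroE)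
      then show False using assms(1)[of v] Cons.prems(1) 0 by auto
    qed
    then show ?thesis using 0 by simp
  next
    case (Suc c')
    then have "f [] = 0" using Cons.prems(2)[of "[]"] by simp
    then show ?thesis
      using Suc Cons.IH[of c' "\<lambda>v. f (x # v)"] Cons.prems by simp
  qed
qed simp

text \<open>The support may be infinite, since only the finitely many cuts of a word enter a
  coefficient of a product. A separate type makes the series an instance of \<open>ring_1\<close>,
  so that identities between them are settled by \<open>algebra_simps\<close>.\<close>

typedef 'a ncs = "UNIV :: ('a list \<Rightarrow> int) set"
  morphisms coeff Ncs ..

lemma ncs_eqI: "(\<And>w. coeff f w = coeff g w) \<Longrightarrow> f = g"
  by (metis coeff_inject ext)

instantiation ncs :: (type) ring_1
begin

definition "0 = Ncs (\<lambda>_. 0)"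
definition "1 = Ncs (\<lambda>w. if w = [] then 1 else 0)"
definition "f + g = Ncs (\<lambda>w. coeff f w + coeff g w)"
definition "f - g = Ncs (\<lambda>w. coeff f w - coeff g w)"
definition "- f = Ncs (\<lambda>w. - coeff f w)"
definition "f * g = Ncs (conv (coeff f) (coeff g))"

lemma coeff_simps:
  "coeff (0 :: 'a ncs) w = 0"
  "coeff (1 :: 'a ncs) w = (if w = [] then 1 else 0)"
  "coeff (f + g) w = coeff f w + coeff (g :: 'a ncs) w"
  "coeff (f - g) w = coeff f w - coeff (g :: 'a ncs) w"
  "coeff (- g) w = - coeff (g :: 'a ncs) w"
  "coeff (f * g) = conv (coeff f) (coeff (g :: 'a ncs))"
  by (simp_all add: zero_ncs_def one_ncs_def plus_ncs_def minus_ncs_def uminus_ncs_def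
      times_ncs_def Ncs_inverse)

instance
proof
  \<comment> \<open>\<open>conv\<close> takes whole coefficient functions, so the pointwise rules
    are needed as equations of functions.\<close>
  have fold: "coeff (f + g) = (\<lambda>w. coeff f w + coeff g w)"
    "coeff (1 :: 'a ncs) = (\<lambda>w. if w = [] then 1 else 0)"
    "coeff (0 :: 'a ncs) = (\<lambda>w. 0)" for f g :: "'a ncs"
    by (auto simp: coeff_simps)
  fix f g h :: "'a ncs"
  show "f * g * h = f * (g * h)" by (rule ncs_eqI) (simp add: coeff_simps conv_assoc)
  show "(f + g) * h = f * h + g * h"
    by (rule ncs_eqI) (simp add: coeff_simps(3-) fold conv_add_left)
  show "f * (g + h) = f * g + f * h"
    by (rule ncs_eqI) (simp add: coeff_simps(3-) fold conv_add_right)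
  show "1 * f = f" by (rule ncs_eqI) (simp add: coeff_simps(6) fold conv_one_left)
  show "f * 1 = f" by (rule ncs_eqI) (simp add: coeff_simps(6) fold conv_one_right)
  show "(0 :: 'a ncs) \<noteq> 1"
    by (metis coeff_simps(1,2) zero_neq_one)
qed (auto intro!: ncs_eqI simp: coeff_simps)

end

definition ncs_var :: "'a \<Rightarrow> 'a ncs" where
  "ncs_var x = Ncs (\<lambda>w. if w = [x] then 1 else 0)"

lemma coeff_var: "coeff (ncs_var x) w = (if w = [x] then 1 else 0)"
  by (simp add: ncs_var_def Ncs_inverse)

lemma coeff_var_mult:
  "coeff (ncs_var x * f) w = (case w of [] \<Rightarrow> 0 | y # v \<Rightarrow> if y = x then coeff f v else 0)"
proof (cases w)
  case (Cons y v)
  have "conv (\<lambda>v. coeff (ncs_var x) (y # v)) (coeff f) v = (if y = x then coeff f v else 0)"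
    using conv_one_left[of "coeff f" v] by (auto simp: coeff_var)
  then show ?thesis using Cons by (simp add: coeff_simps(6)) (simp add: coeff_var)
qed (simp add: coeff_simps coeff_var)

lemma coeff_mult_var:
  "coeff (f * ncs_var x) w = (if w \<noteq> [] \<and> last w = x then coeff f (butlast w) else 0)"
proof -
  have "conv g (coeff (ncs_var x)) w = (if w \<noteq> [] \<and> last w = x then g (butlast w) else 0)" for g
    by (induction w arbitrary: g) (auto simp: coeff_var)
  then show ?thesis by (simp add: coeff_simps(6))
qed

text \<open>The hypothesis says that the series \<open>r\<close> commutes with the letter
  \<open>k\<close>. At a word ending in \<open>k\<close> it carries a leading \<open>k\<close> round
  to the end without changing the coefficient, and it gives 0 if the word begins with another
  letter. A word with a foreign letter is rotated until that letter stands in front.\<close>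

lemma cyclic_support:
  fixes r :: "'a list \<Rightarrow> int"
  assumes comm: "\<And>w. (if w \<noteq> [] \<and> last w = k then r (butlast w) else 0) =
      (case w of [] \<Rightarrow> 0 | y # v \<Rightarrow> if y = k then r v else 0)"
    and "r w \<noteq> 0"
  shows "set w \<subseteq> {k}"
proof (rule ccontr)
  assume "\<not> set w \<subseteq> {k}"
  then obtain u y v where w: "w = u @ y # v" "y \<noteq> k" "\<forall>z\<in>set u. z = k"
    using split_list_first_prop[of w "\<lambda>z. z \<noteq> k"] by auto
  have "r (u @ y # v) = 0" if "\<forall>z\<in>set u. z = k"
    using that
  proof (induction u arbitrary: v)
    case Nil
    then show ?case using comm[of "y # v @ [k]"] w(2) by (auto simp: butlast_append)
  next
    case (Cons z u)
    then show ?case using comm[of "z # u @ y # v @ [k]"] Cons.IH[of "v @ [k]"]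
      by (auto simp: butlast_append)
  qed
  then show False using w assms(2) by simp
qed

section \<open>The filtration of the series by order\<close>

definition ord_ge :: "nat \<Rightarrow> 'a ncs \<Rightarrow> bool" where
  "ord_ge c f \<longleftrightarrow> (\<forall>w. length w < c \<longrightarrow> coeff f w = 0)"

lemma ord_ge_0 [simp]: "ord_ge 0 f" "ord_ge c 0"
  by (auto simp: ord_ge_def coeff_simps)

lemma ord_ge_add: "ord_ge c f \<Longrightarrow> ord_ge c g \<Longrightarrow> ord_ge c (f + g)"
  by (auto simp: ord_ge_def coeff_simps)

lemma ord_ge_diff: "ord_ge c f \<Longrightarrow> ord_ge c g \<Longrightarrow> ord_ge c (f - g)"
  by (auto simp: ord_ge_def coeff_simps)

lemma ord_ge_uminus: "ord_ge c f \<Longrightarrow> ord_ge c (- f)"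
  by (auto simp: ord_ge_def coeff_simps)

lemma ord_ge_mono: "ord_ge c f \<Longrightarrow> d \<le> c \<Longrightarrow> ord_ge d f"
  by (auto simp: ord_ge_def)

text \<open>The free bound \<open>e\<close> spares a separate weakening step in each use.\<close>

lemma ord_ge_mult:
  assumes "ord_ge c f" "ord_ge d g" "e \<le> c + d"
  shows "ord_ge e (f * g)"
  unfolding ord_ge_def
proof (intro allI impI, rule ccontr)
  fix w :: "'a list" assume "length w < e" "coeff (f * g) w \<noteq> 0"
  then obtain u v where "w = u @ v" "coeff f u \<noteq> 0" "coeff g v \<noteq> 0"
    by (auto simp: coeff_simps elim: conv_nonzeroE)
  moreover then have "c \<le> length u" "d \<le> length v"
    using assms by (auto simp: ord_ge_def not_less[symmetric])
  ultimately show False using \<open>length w < e\<close> assms(3) by simp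
qed

lemma ord_ge_var: "ord_ge (Suc 0) (ncs_var x)"
  by (simp add: ord_ge_def coeff_var)

section \<open>Hall trees\<close>

fun foliage :: "'a lie_term \<Rightarrow> 'a list" where
  "foliage (Gen x) = [x]"
| "foliage Zero = []"
| "foliage (Neg s) = foliage s"
| "foliage (Add s t) = foliage s @ foliage t"
| "foliage (Br s t) = foliage s @ foliage t"

text \<open>The Hall set for the dictionary order on foliages, in which a proper prefix precedes.
  The last condition makes the splitting of a word canonical: the right subtree carries the least
  proper suffix. Trees are terms of the free Lie ring, so that \<open>lie_eval\<close> evaluates
  them in any Lie ring.\<close>

inductive hall :: "'a::linorder set \<Rightarrow> 'a lie_term \<Rightarrow> bool" for X where
  Gen: "x \<in> X \<Longrightarrow> hall X (Gen x)"
| Br: "\<lbrakk>hall X s; hall X t; foliage s < foliage t; \<forall>p q. s = Br p q \<longrightarrow> foliage t \<le> foliage q\<rbrakk>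
    \<Longrightarrow> hall X (Br s t)"

inductive_cases hall_BrE: "hall X (Br s t)"

lemma hall_lie_terms: "hall X t \<Longrightarrow> t \<in> lie_terms X"
  by (induction rule: hall.induct) auto

lemma set_foliage: "hall X t \<Longrightarrow> set (foliage t) \<subseteq> X"
  by (induction rule: hall.induct) auto

lemma foliage_neq_Nil [simp]: "hall X t \<Longrightarrow> foliage t \<noteq> []"
  by (induction rule: hall.induct) auto

lemma append_less_append_iff [simp]: "x @ u < x @ v \<longleftrightarrow> u < (v :: 'a::linorder list)"
  by (induction x) auto

lemma le_append [simp]: "u \<le> u @ (v :: 'a::linorder list)"
  by (induction u) auto

lemma append_less_cases:
  fixes u v :: "'a::linorder list"
  assumes "u < v"
  obtains v' where "v = u @ v'" "v' \<noteq> []" | "\<And>a. u @ a < v"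
  using assms
proof (induction u arbitrary: v thesis)
  case Nil
  then show ?case by auto
next
  case (Cons x u)
  show ?case
  proof (cases v)
    case Nil
    then show ?thesis using Cons.prems by simp
  next
    case v: (Cons y v2)
    show ?thesis
    proof (cases "x < y")
      case True
      then show ?thesis using Cons.prems(2) v by simp
    next
      case False
      then have *: "x = y" "u < v2" using Cons.prems(3) v by auto
      show ?thesis by (rule Cons.IH[OF _ _ *(2)]) (use * v Cons.prems in auto)
    qed
  qed
qed

lemma append_mono_same_length:
  fixes u v :: "'a::linorder list"
  assumes "length a = length u" "a \<le> u" "b \<le> v"
  shows "a @ b \<le> u @ v"
  using assms by (induction a u rule: list_induct2) auto

text \<open>The foliages of Hall trees are Lyndon words, and the two subtrees give the standard factorization.\<close>

lemma hall_suffix: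
  assumes "hall X t" "foliage t = y @ x" "y \<noteq> []" "x \<noteq> []"
  shows "foliage t < x" "t = Br p q \<Longrightarrow> foliage q \<le> x"
proof -
  have "(\<forall>y x. foliage t = y @ x \<longrightarrow> y \<noteq> [] \<longrightarrow> x \<noteq> [] \<longrightarrow>
      foliage t < x \<and> (\<forall>p q. t = Br p q \<longrightarrow> foliage q \<le> x))"
    using assms(1)
  proof (induction rule: hall.induct)
    case (Gen x)
    then show ?case by (auto simp: Cons_eq_append_conv)
  next
    case (Br s r)
    let ?u = "foliage s" and ?v = "foliage r"
    have ne: "?u \<noteq> []" "?v \<noteq> []" using Br by auto
    \<comment> \<open>Appending to the smaller word can spoil the inequality only if
      \<open>?u\<close> is a prefix of \<open>?v\<close>. Then the rest \<open>v'\<close> is a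
      proper suffix of \<open>?v\<close>, hence larger than \<open>?v\<close> by induction, and
      prefixing \<open>?u\<close> gives the claim.\<close>
    have uv: "?u @ ?v < ?v"
      using Br(3)
    proof (cases rule: append_less_cases)
      case (1 v')
      then have "?v < v'" using Br.IH(2) ne by metis
      then show ?thesis using 1 by (metis append_less_append_iff)
    qed simp
    \<comment> \<open>\<open>?v\<close> is the least proper suffix. A suffix that starts inside
      \<open>?v\<close> is settled by induction. One that starts with a nonempty proper suffix
      \<open>z\<close> of \<open>?u\<close> is at least \<open>z\<close>; for
      \<open>s = Br p q\<close> induction gives \<open>foliage q \<le> z\<close>, and the Hall
      condition gives \<open>?v \<le> foliage q\<close>.\<close>
    have suf: "?v \<le> x" if eq: "?u @ ?v = y @ x" "y \<noteq> []" "x \<noteq> []" for y x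
      using eq(1)[unfolded append_eq_append_conv2]
    proof (elim exE disjE conjE)
      fix z assume z: "?u @ z = y" "?v = z @ x"
      then show ?thesis using Br.IH(2) eq by (cases "z = []") (auto intro: less_imp_le)
    next
      fix z assume z: "?u = y @ z" "z @ ?v = x"
      show ?thesis
      proof (cases "z = []")
        case False
        show ?thesis
        proof (cases s)
          case (Br p q)
          then have "foliage q \<le> z" using Br.IH(1) z eq False by blast
          then have "?v \<le> z" using Br Br.hyps(4) by (metis order_trans)
          then show ?thesis using z by (metis le_append order_trans)
        qed (use Br(1) z eq False in \<open>auto simp: Cons_eq_append_conv elim: hall.cases\<close>)
      qed (use z in simp)
    qed
    then show ?case using uv by fastforce
  qed
  then show "foliage t < x" "t = Br p q \<Longrightarrow> foliage q \<le> x" using assms by blast+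
qed

lemma hall_Br_less_right: "hall X (Br s t) \<Longrightarrow> foliage s @ foliage t < foliage t"
  using hall_suffix(1)[of X "Br s t" "foliage s" "foliage t"] by (auto elim: hall_BrE)

text \<open>The word determines the foliage of the right subtree as its least proper suffix, hence
  also that of the left subtree, and induction applies to both.\<close>

lemma foliage_inj:
  assumes "hall X s" "hall X t" "foliage s = foliage t"
  shows "s = t"
  using assms
proof (induction arbitrary: t rule: hall.induct)
  case (Gen x)
  from Gen(2) show ?case
  proof cases
    case (Br s' t')
    then show ?thesis using Gen foliage_neq_Nil by (auto simp: Cons_eq_append_conv)
  qed (use Gen in auto)
next
  case (Br s r)
  from Br.prems(1) show ?case
  proof cases
    case (Gen x)
    then show ?thesis using Br by (auto simp: append_eq_Cons_conv)
  next
    case (Br s' r')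
    have "hall X (Br s r)" by (rule hall.Br) fact+
    then have "foliage r \<le> foliage r'"
      using hall_suffix(2)[of X "Br s r" "foliage s'" "foliage r'"] Br Br.prems by auto
    moreover have "foliage r' \<le> foliage r"
      using hall_suffix(2)[of X "Br s' r'" "foliage s" "foliage r"] Br Br.prems Br.hyps by auto
    ultimately have "foliage r = foliage r'" by simp
    then show ?thesis using Br Br.prems Br.IH by auto
  qed
qed

text \<open>The evaluation of terms in the commutator Lie ring of the series, defined directly
  because \<open>lie_eval\<close> expects a ring record and not a type class.\<close>

fun lie_poly :: "'a lie_term \<Rightarrow> 'a ncs" where
  "lie_poly (Gen x) = ncs_var x"
| "lie_poly Zero = 0"
| "lie_poly (Neg s) = - lie_poly s"
| "lie_poly (Add s t) = lie_poly s + lie_poly t"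
| "lie_poly (Br s t) = lie_poly s * lie_poly t - lie_poly t * lie_poly s"

text \<open>Homogeneity makes the factors of a product comparable with the two halves of
  \<open>foliage s @ foliage r\<close>. Words from the reversed product are handled by the Lyndon
  property: \<open>foliage s @ foliage r\<close> lies below \<open>foliage r\<close>, hence below
  \<open>foliage r @ foliage s\<close>.\<close>

lemma lie_poly_support:
  assumes "hall X t" "coeff (lie_poly t) w \<noteq> 0"
  shows "length w = length (foliage t)" "foliage t \<le> w" "set w \<subseteq> X"
proof -
  have "\<forall>w. coeff (lie_poly t) w \<noteq> 0 \<longrightarrow> length w = length (foliage t) \<and> foliage t \<le> w \<and> set w \<subseteq> X"
    using assms(1)
  proof (induction rule: hall.induct)
    case (Gen x)
    then show ?case by (auto simp: coeff_var)
  next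
    case (Br s r)
    have "hall X (Br s r)" by (rule hall.Br) fact+
    then have less: "foliage s @ foliage r < foliage r" by (rule hall_Br_less_right)
    show ?case
    proof (intro allI impI)
      fix w assume "coeff (lie_poly (Br s r)) w \<noteq> 0"
      then consider "coeff (lie_poly s * lie_poly r) w \<noteq> 0" | "coeff (lie_poly r * lie_poly s) w \<noteq> 0"
        by (fastforce simp: coeff_simps(4))
      then show "length w = length (foliage (Br s r)) \<and> foliage (Br s r) \<le> w \<and> set w \<subseteq> X"
      proof cases
        case 1
        then obtain u v where "w = u @ v" "coeff (lie_poly s) u \<noteq> 0" "coeff (lie_poly r) v \<noteq> 0"
          by (auto simp: coeff_simps(6) elim: conv_nonzeroE)
        then show ?thesis using Br.IH by (auto intro!: append_mono_same_length)
      next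
        case 2
        then obtain v u where w: "w = v @ u" and uv: "coeff (lie_poly s) u \<noteq> 0" "coeff (lie_poly r) v \<noteq> 0"
          by (auto simp: coeff_simps(6) elim: conv_nonzeroE)
        have "foliage s @ foliage r \<le> foliage r @ foliage s"
          using less le_append[of "foliage r" "foliage s"] by (metis less_imp_le order_trans)
        also have "\<dots> \<le> w" unfolding w using Br.IH uv by (intro append_mono_same_length) auto
        finally show ?thesis using w uv Br.IH by auto
      qed
    qed
  qed
  then show "length w = length (foliage t)" "foliage t \<le> w" "set w \<subseteq> X"
    using assms(2) by auto
qed

lemma ord_ge_lie_poly: "hall X t \<Longrightarrow> ord_ge (length (foliage t)) (lie_poly t)"
  using lie_poly_support(1) by (fastforce simp: ord_ge_def)

text \<open>Degrees leave one cut for \<open>lie_poly s * lie_poly r\<close>, and there both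
  coefficients are leading. A word of the reversed product begins with a word at least
  \<open>foliage r\<close>, which exceeds the whole foliage.\<close>

lemma lie_poly_leading: "hall X t \<Longrightarrow> coeff (lie_poly t) (foliage t) = 1"
proof (induction rule: hall.induct)
  case (Gen x)
  then show ?case by (simp add: coeff_var)
next
  case (Br s r)
  have "hall X (Br s r)" by (rule hall.Br) fact+
  then have less: "foliage s @ foliage r < foliage r" by (rule hall_Br_less_right)
  have "conv (coeff (lie_poly s)) (coeff (lie_poly r)) (foliage s @ foliage r) =
      coeff (lie_poly s) (take (length (foliage s)) (foliage s @ foliage r)) *
      coeff (lie_poly r) (drop (length (foliage s)) (foliage s @ foliage r))"
    using ord_ge_lie_poly[OF Br(1)] ord_ge_lie_poly[OF Br(2)]
    by (intro conv_low_left[of "length (foliage r)"]) (auto simp: ord_ge_def)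
  then have 1: "coeff (lie_poly s * lie_poly r) (foliage s @ foliage r) = 1"
    using Br.IH by (simp add: coeff_simps(6))
  have "coeff (lie_poly r * lie_poly s) (foliage s @ foliage r) = 0"
  proof (rule ccontr)
    assume "coeff (lie_poly r * lie_poly s) (foliage s @ foliage r) \<noteq> 0"
    then obtain v u where w: "foliage s @ foliage r = v @ u"
      and uv: "coeff (lie_poly s) u \<noteq> 0" "coeff (lie_poly r) v \<noteq> 0"
      by (auto simp: coeff_simps(6) elim: conv_nonzeroE)
    have "foliage r \<le> v" using lie_poly_support(2)[OF Br(2) uv(2)] .
    also have "v \<le> v @ u" by simp
    finally show False using less w by simp
  qed
  then show ?case using 1 by (simp add: coeff_simps(4))
qed

text \<open>The family is triangular. At the least foliage \<open>m\<close> that occurs with nonzero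
  coefficient, another tree can contribute only if its own foliage is at most \<open>m\<close>;
  minimality and \<open>foliage_inj\<close> then make it the same tree.\<close>

lemma lie_poly_independent:
  assumes "finite T" "\<And>t. t \<in> T \<Longrightarrow> hall X t"
    and zero: "\<And>w. (\<Sum>t\<in>T. c t * coeff (lie_poly t) w) = 0" and "t \<in> T"
  shows "c t = 0"
proof (rule ccontr)
  assume "c t \<noteq> 0"
  define A where "A = {t \<in> T. c t \<noteq> 0}"
  have A: "finite A" "A \<noteq> {}" using assms \<open>c t \<noteq> 0\<close> by (auto simp: A_def)
  define m where "m = Min (foliage ` A)"
  have "m \<in> foliage ` A" unfolding m_def using A by (intro Min_in) auto
  then obtain s where s: "s \<in> A" "m = foliage s" by auto
  have "c r * coeff (lie_poly r) m = 0" if "r \<in> T" "r \<noteq> s" for r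
  proof (rule ccontr)
    assume *: "c r * coeff (lie_poly r) m \<noteq> 0"
    then have "r \<in> A" using that by (simp add: A_def)
    then have "m \<le> foliage r" unfolding m_def using A by simp
    moreover have "foliage r \<le> m" using lie_poly_support(2)[of X r m] assms(2) that * by auto
    ultimately have "r = s" using foliage_inj[of X r s] s assms(2) that by (auto simp: A_def)
    then show False using that by simp
  qed
  then have "(\<Sum>t\<in>T. c t * coeff (lie_poly t) m) = c s * coeff (lie_poly s) m"
    using s by (subst sum.remove[of T s]) (auto simp: A_def assms(1) simp del: mult_eq_0_iff intro!: sum.neutral)
  then show False using zero[of m] s lie_poly_leading[of X s] assms(2) by (auto simp: A_def)
qed

section \<open>Spans of Hall trees in Lie rings\<close>

context lie_ring
begin

lemma bracket_zero [simp]: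
  assumes "x \<in> carrier L" shows "x \<otimes> \<zero> = \<zero>" "\<zero> \<otimes> x = \<zero>"
proof -
  have "x \<otimes> \<zero> \<oplus> x \<otimes> \<zero> = x \<otimes> \<zero>" "\<zero> \<otimes> x \<oplus> \<zero> \<otimes> x = \<zero> \<otimes> x"
    using bracket_add_right[of x \<zero> \<zero>] bracket_add_left[of \<zero> \<zero> x] assms by simp_all
  then show "x \<otimes> \<zero> = \<zero>" "\<zero> \<otimes> x = \<zero>"
    using bracket_closed[of x \<zero>] bracket_closed[of \<zero> x] assms
    by (simp_all add: add.l_cancel_one)
qed

lemma bracket_minus_left: "\<lbrakk>x \<in> carrier L; y \<in> carrier L\<rbrakk> \<Longrightarrow> (\<ominus> x) \<otimes> y = \<ominus> (x \<otimes> y)"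
  using bracket_add_left[of "\<ominus> x" x y] bracket_closed by (simp add: l_neg minus_equality)

lemma bracket_minus_right: "\<lbrakk>x \<in> carrier L; y \<in> carrier L\<rbrakk> \<Longrightarrow> x \<otimes> (\<ominus> y) = \<ominus> (x \<otimes> y)"
  using bracket_add_right[of x "\<ominus> y" y] bracket_closed by (simp add: l_neg minus_equality)

lemma bracket_antisym:
  assumes "x \<in> carrier L" "y \<in> carrier L"
  shows "x \<otimes> y = \<ominus> (y \<otimes> x)"
proof -
  have "\<zero> = (x \<oplus> y) \<otimes> (x \<oplus> y)" using assms bracket_self by simp
  also have "\<dots> = x \<otimes> y \<oplus> y \<otimes> x"
    using assms bracket_closed bracket_add_left[of x y "x \<oplus> y"]
    by (simp add: bracket_add_right bracket_self[of x] bracket_self[of y])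
  finally show ?thesis using assms bracket_closed by (metis minus_equality)
qed

text \<open>The Jacobi identity read as a derivation rule for bracketing with \<open>z\<close> from
  the right, the form in which brackets of trees are rewritten.\<close>

lemma bracket_Leibniz:
  assumes "x \<in> carrier L" "y \<in> carrier L" "z \<in> carrier L"
  shows "(x \<otimes> y) \<otimes> z = (x \<otimes> z) \<otimes> y \<oplus> x \<otimes> (y \<otimes> z)"
proof -
  have "(x \<otimes> y) \<otimes> z = \<ominus> (z \<otimes> (x \<otimes> y))" using assms bracket_closed by (intro bracket_antisym)
  also have "\<dots> = x \<otimes> (y \<otimes> z) \<oplus> y \<otimes> (z \<otimes> x)"
    using jacobi[OF assms] assms bracket_closed by (intro minus_equality) auto
  also have "y \<otimes> (z \<otimes> x) = (x \<otimes> z) \<otimes> y"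
    using bracket_antisym[of y "z \<otimes> x"] bracket_antisym[of x z] assms bracket_closed
    by (simp add: bracket_minus_left)
  finally show ?thesis using assms bracket_closed by (simp add: a_comm)
qed

definition lspan :: "'a set \<Rightarrow> 'a set" where
  "lspan A = generate (add_monoid L) A"

lemma subgroup_lspan: "A \<subseteq> carrier L \<Longrightarrow> subgroup (lspan A) (add_monoid L)"
  unfolding lspan_def by (rule add.generate_is_subgroup) simp

lemma lspan_closed: "A \<subseteq> carrier L \<Longrightarrow> x \<in> lspan A \<Longrightarrow> x \<in> carrier L"
  using subgroup.subset[OF subgroup_lspan] by auto

lemma lspan_incl: "x \<in> A \<Longrightarrow> x \<in> lspan A"
  unfolding lspan_def by (rule generate.incl)

lemma lspan_zero: "\<zero> \<in> lspan A"
  unfolding lspan_def using generate.one[of "add_monoid L" A] by simp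

lemma lspan_add: "x \<in> lspan A \<Longrightarrow> y \<in> lspan A \<Longrightarrow> x \<oplus> y \<in> lspan A"
  unfolding lspan_def using generate.eng[of x "add_monoid L" A y] by simp

lemma lspan_minus: "A \<subseteq> carrier L \<Longrightarrow> x \<in> lspan A \<Longrightarrow> \<ominus> x \<in> lspan A"
  using subgroup.m_inv_closed[OF subgroup_lspan, of A x] by (simp add: a_inv_def)

lemma lspan_mono: "A \<subseteq> B \<Longrightarrow> lspan A \<subseteq> lspan B"
  unfolding lspan_def by (rule add.mono_generate)

lemma lspan_bracket:
  assumes x: "x \<in> lspan A" and y: "y \<in> lspan B"
    and sub: "A \<subseteq> carrier L" "B \<subseteq> carrier L" "C \<subseteq> carrier L"
    and AB: "\<And>a b. a \<in> A \<Longrightarrow> b \<in> B \<Longrightarrow> a \<otimes> b \<in> lspan C"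
  shows "x \<otimes> y \<in> lspan C"
proof -
  have 1: "x \<otimes> b \<in> lspan C" if b: "b \<in> B" for b
    using x unfolding lspan_def[of A]
  proof (induction rule: generate.induct)
    case one
    then show ?case using b sub by (auto simp: lspan_zero)
  next
    case (incl h)
    then show ?case using AB b by simp
  next
    case (inv h)
    then have "h \<in> carrier L" "b \<in> carrier L" using b sub by auto
    then show ?case using AB[of h b] inv b sub
      by (auto simp: a_inv_def[symmetric] bracket_minus_left lspan_minus)
  next
    case (eng h1 h2)
    then have "h1 \<in> carrier L" "h2 \<in> carrier L" "b \<in> carrier L"
      using lspan_closed[OF sub(1)] b sub(2) unfolding lspan_def by auto
    then show ?case using eng by (simp add: bracket_add_left lspan_add)
  qed
  have xc: "x \<in> carrier L" using x lspan_closed sub by blast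
  show ?thesis using y unfolding lspan_def[of B]
  proof (induction rule: generate.induct)
    case one
    then show ?case using xc by (auto simp: lspan_zero)
  next
    case (incl h)
    then show ?case using 1 by simp
  next
    case (inv h)
    then have "h \<in> carrier L" using sub by auto
    then show ?case using 1[of h] inv xc sub
      by (auto simp: a_inv_def[symmetric] bracket_minus_right lspan_minus)
  next
    case (eng h1 h2)
    then have "h1 \<in> carrier L" "h2 \<in> carrier L"
      using lspan_closed[OF sub(2)] unfolding lspan_def by auto
    then show ?case using eng xc by (simp add: bracket_add_right lspan_add)
  qed
qed

lemma lie_eval_closed:
  assumes "h \<in> X \<rightarrow> carrier L" "t \<in> lie_terms X"
  shows "lie_eval L h t \<in> carrier L"
  using assms(2,1) by (induction t) (auto intro: bracket_closed)

text \<open>The rewriting of a bracket of two Hall trees terminates because every step keeps the degree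
  and lowers the larger of the two foliages.\<close>

lemma hall_bracket_lspan:
  assumes X: "finite X" and h: "h \<in> X \<rightarrow> carrier L" and st: "hall X s" "hall X t"
  shows "lie_eval L h s \<otimes> lie_eval L h t \<in> lspan {lie_eval L h (Br p q) | p q.
    hall X (Br p q) \<and> length (foliage (Br p q)) = length (foliage s) + length (foliage t) \<and>
    foliage q \<le> max (foliage s) (foliage t)}"
proof -
  let ?e = "lie_eval L h"
  define H where "H = (\<lambda>d b. {?e (Br p q) | p q. hall X (Br p q) \<and>
    length (foliage (Br p q)) = d \<and> foliage q \<le> b})"
  \<comment> \<open>Dictionary order is not well founded, but below \<open>b\<close> there are only
    finitely many words of length at most \<open>d\<close> in the finite alphabet. Their number is
    the measure of the inner induction.\<close>
  define N where "N = (\<lambda>d b. {w. set w \<subseteq> X \<and> length w \<le> d \<and> w < b})"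
  have finN: "finite (N d b)" for d b
    by (rule finite_subset[OF _ finite_lists_length_le[OF X, of d]]) (auto simp: N_def)
  have ec: "?e t \<in> carrier L" if "hall X t" for t
    using that hall_lie_terms lie_eval_closed[OF h] by blast
  have HC: "H d b \<subseteq> carrier L" for d b
    using ec unfolding H_def by blast
  have Hmono: "lspan (H d b) \<subseteq> lspan (H d b')" if "b \<le> b'" for d b b'
    using that by (intro lspan_mono) (force simp: H_def)
  have main: "?e s \<otimes> ?e t \<in> lspan (H d (max (foliage s) (foliage t)))"
    if "hall X s" "hall X t" "d = length (foliage s) + length (foliage t)"
      "k = card (N d (max (foliage s) (foliage t)))" for s t d k
    using that
  proof (induction d arbitrary: s t k rule: less_induct)
    case (less d)
    note IHd = less.IH
    show ?case using less.prems
    proof (induction k arbitrary: s t rule: less_induct)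
      case (less k)
      have IHk: "?e s' \<otimes> ?e t' \<in> lspan (H d b)"
        if *: "hall X s'" "hall X t'" "length (foliage s') + length (foliage t') = d"
          "foliage s' < b" "foliage t' < b"
          "hall X r" "foliage r = b" "length b \<le> d" "k = card (N d b)" for s' t' b r
      proof -
        let ?m = "max (foliage s') (foliage t')"
        have m: "?m < b" "set ?m \<subseteq> X" "length ?m \<le> d"
          using * set_foliage[of X s'] set_foliage[of X t'] by (auto simp: max_def)
        then have "?m \<in> N d b" by (simp add: N_def)
        moreover have "?m \<notin> N d ?m" "N d ?m \<subseteq> N d b"
          using less_trans[OF _ m(1)] by (auto simp: N_def simp del: max_less_iff_conj less_max_iff_disj)
        ultimately have "N d ?m \<subset> N d b" by blast
        then have c: "card (N d ?m) < k" using * by (simp add: psubset_card_mono finN)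
        note IH' = less.IH[OF c *(1,2) *(3)[symmetric] HOL.refl]
        show ?thesis by (rule subsetD[OF Hmono[OF less_imp_le[OF m(1)]] IH'])
      qed
      \<comment> \<open>The second foliage is the larger one here; the opposite case follows by
        antisymmetry. If \<open>Br s t\<close> is not Hall, then \<open>s = Br p q\<close> with
        \<open>foliage q < foliage t\<close>, and the Leibniz rule moves \<open>t\<close>
        inside.\<close>
      have core: "?e s \<otimes> ?e t \<in> lspan (H d (foliage t))"
        if *: "hall X s" "hall X t" "d = length (foliage s) + length (foliage t)"
          "k = card (N d (foliage t))" "foliage s < foliage t" for s t
      proof (cases "hall X (Br s t)")
        case True
        then have "?e (Br s t) \<in> H d (foliage t)" using * unfolding H_def
          by (intro CollectI exI[of _ s] exI[of _ t]) auto
        then show ?thesis using lspan_incl by simp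
      next
        case False
        then obtain p q where s: "s = Br p q" and q: "foliage q < foliage t"
          using * by (meson hall.Br not_le)
        have pq: "hall X p" "hall X q" "foliage p < foliage q"
          using *(1) s by (auto elim: hall_BrE)
        have len: "length (foliage s) = length (foliage p) + length (foliage q)"
          "0 < length (foliage p)" "0 < length (foliage q)" using s pq by auto
        note c = ec[OF pq(1)] ec[OF pq(2)] ec[OF *(2)]
        \<comment> \<open>A Hall tree \<open>Br a b\<close> has its foliage below that of
          \<open>b\<close>, so the trees that come from the inner brackets lie strictly below
          \<open>foliage t\<close>, as do \<open>p\<close> and \<open>q\<close>. Hence the outer
          brackets fall under the inner induction, while the inner brackets have smaller
          degree.\<close>
        have step: "foliage a @ foliage b < foliage t" if "hall X (Br a b)" "foliage b \<le> foliage t" for a b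
          using hall_Br_less_right[OF that(1)] that(2) by (metis order.strict_trans2)
        have eq: "?e s \<otimes> ?e t = (?e p \<otimes> ?e t) \<otimes> ?e q \<oplus> ?e p \<otimes> (?e q \<otimes> ?e t)"
          using bracket_Leibniz[OF c] s by simp
        have "?e p \<otimes> ?e t \<in> lspan (H (length (foliage p) + length (foliage t)) (max (foliage p) (foliage t)))"
          using IHd[of "length (foliage p) + length (foliage t)" p t] pq * len by simp
        also have "max (foliage p) (foliage t) = foliage t" using pq q by (auto simp: max_def)
        finally have 1: "?e p \<otimes> ?e t \<in> lspan (H (length (foliage p) + length (foliage t)) (foliage t))" .
        have "(?e p \<otimes> ?e t) \<otimes> ?e q \<in> lspan (H d (foliage t))"
        proof (rule lspan_bracket[OF 1 lspan_incl[of _ "{?e q}"]])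
          fix x y assume "x \<in> H (length (foliage p) + length (foliage t)) (foliage t)" "y \<in> {?e q}"
          then obtain a b where ab: "x = ?e (Br a b)" "hall X (Br a b)" "foliage b \<le> foliage t"
            "length (foliage (Br a b)) = length (foliage p) + length (foliage t)" "y = ?e q"
            unfolding H_def by auto
          have "?e (Br a b) \<otimes> ?e q \<in> lspan (H d (foliage t))"
            by (rule IHk[of _ _ _ t]) (use ab pq q * len step[of a b] in auto)
          then show "x \<otimes> y \<in> lspan (H d (foliage t))" using ab by simp
        qed (use HC c in auto)
        moreover
        have "?e q \<otimes> ?e t \<in> lspan (H (length (foliage q) + length (foliage t)) (max (foliage q) (foliage t)))"
          using IHd[of "length (foliage q) + length (foliage t)" q t] pq * len by simp
        then have 2: "?e q \<otimes> ?e t \<in> lspan (H (length (foliage q) + length (foliage t)) (foliage t))"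
          using q by (simp add: max_def split: if_splits)
        have "?e p \<otimes> (?e q \<otimes> ?e t) \<in> lspan (H d (foliage t))"
        proof (rule lspan_bracket[OF lspan_incl[of _ "{?e p}"] 2])
          fix x y assume "y \<in> H (length (foliage q) + length (foliage t)) (foliage t)" "x \<in> {?e p}"
          then obtain a b where ab: "y = ?e (Br a b)" "hall X (Br a b)" "foliage b \<le> foliage t"
            "length (foliage (Br a b)) = length (foliage q) + length (foliage t)" "x = ?e p"
            unfolding H_def by auto
          have "?e p \<otimes> ?e (Br a b) \<in> lspan (H d (foliage t))"
            by (rule IHk[of _ _ _ t]) (use ab pq q * len step[of a b] in auto)
          then show "x \<otimes> y \<in> lspan (H d (foliage t))" using ab by simp
        qed (use HC c in auto)
        ultimately show ?thesis unfolding eq by (rule lspan_add)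
      qed
      consider "foliage s < foliage t" | "foliage t < foliage s" | "foliage s = foliage t"
        by force
      then show ?case
      proof cases
        case 1
        then have "max (foliage s) (foliage t) = foliage t" by simp
        then show ?thesis using core[of s t] less.prems 1 by simp
      next
        case 2
        then have max: "max (foliage s) (foliage t) = foliage s" by simp
        then have "?e t \<otimes> ?e s \<in> lspan (H d (foliage s))"
          using core[of t s] less.prems 2 by (simp add: add.commute)
        then show ?thesis
          using bracket_antisym[of "?e s" "?e t"] lspan_minus[OF HC] ec less.prems max
          by simp
      next
        case 3
        then have "s = t" using foliage_inj less.prems by blast
        then show ?thesis using bracket_self[of "?e s"] ec less.prems lspan_zero by simp
      qed
    qed
  qed
  show ?thesis using main[OF st HOL.refl HOL.refl] unfolding H_def .
qed

corollary hall_lspan_bracket: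
  assumes X: "finite X" and h: "h \<in> X \<rightarrow> carrier L"
    and "x \<in> lspan (lie_eval L h ` {t. hall X t})" "y \<in> lspan (lie_eval L h ` {t. hall X t})"
  shows "x \<otimes> y \<in> lspan (lie_eval L h ` {t. hall X t})"
proof (rule lspan_bracket[OF assms(3,4)])
  show sub: "lie_eval L h ` {t. hall X t} \<subseteq> carrier L"
    using lie_eval_closed[OF h] hall_lie_terms by auto
  then show "lie_eval L h ` {t. hall X t} \<subseteq> carrier L" .
  then show "lie_eval L h ` {t. hall X t} \<subseteq> carrier L" .
  fix a b assume "a \<in> lie_eval L h ` {t. hall X t}" "b \<in> lie_eval L h ` {t. hall X t}"
  then obtain s t where st: "hall X s" "hall X t" "a = lie_eval L h s" "b = lie_eval L h t" by auto
  show "a \<otimes> b \<in> lspan (lie_eval L h ` {t. hall X t})"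
    unfolding st(3,4) by (rule subsetD[OF lspan_mono hall_bracket_lspan[OF X h st(1,2)]]) blast
qed

end

section \<open>Blocks of Hall trees modulo an ideal\<close>

lemma lie_idealD:
  assumes "lie_ideal I M" "a \<in> I" "x \<in> carrier M"
  shows "x \<otimes>\<^bsub>M\<^esub> a \<in> I" "a \<otimes>\<^bsub>M\<^esub> x \<in> I"
  using assms by (auto simp: lie_ideal_def)

text \<open>The hypothesis \<open>rel\<close> is the form in which the relators enter: modulo the ideal \<open>I\<close> each block
  \<open>r\<close> normalizes the blocks \<open>m > r\<close>.\<close>

locale block_lie_ring = lie_ring L for L :: "('a, 'm) ring_scheme" (structure) +
  fixes I :: "'a set" and n :: nat and y :: "nat \<Rightarrow> nat \<Rightarrow> 'a"
  assumes I: "lie_ideal I L"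
    and y_closed: "\<And>m i. \<lbrakk>2 \<le> m; m \<le> n; 1 \<le> i; i \<le> m\<rbrakk> \<Longrightarrow> y m i \<in> carrier L"
    and rel: "\<And>m r i j. \<lbrakk>2 \<le> r; r < m; m \<le> n; 1 \<le> i; i \<le> m; 1 \<le> j; j \<le> r\<rbrakk> \<Longrightarrow>
      y m i \<otimes> y r j \<in> lspan (lie_eval L (y m) ` {t. hall {1..m} t} \<union> I)"
begin

definition H :: "nat \<Rightarrow> 'a set" where
  "H m = lie_eval L (y m) ` {t. hall {1..m} t}"

lemma I_sub: "I \<subseteq> carrier L"
  using I additive_subgroup.a_subset by (auto simp: lie_ideal_def)

lemma y_funcset: "2 \<le> m \<Longrightarrow> m \<le> n \<Longrightarrow> y m \<in> {1..m} \<rightarrow> carrier L"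
  using y_closed by auto

lemma H_sub: "2 \<le> m \<Longrightarrow> m \<le> n \<Longrightarrow> H m \<subseteq> carrier L"
  using lie_eval_closed[OF y_funcset] hall_lie_terms unfolding H_def by blast

lemma HI_sub: "2 \<le> m \<Longrightarrow> m \<le> n \<Longrightarrow> H m \<union> I \<subseteq> carrier L"
  using H_sub I_sub by blast

lemma y_in_H: "1 \<le> i \<Longrightarrow> i \<le> m \<Longrightarrow> y m i \<in> H m"
  unfolding H_def by (rule image_eqI[of _ _ "Gen i"]) (auto intro: hall.Gen)

lemma block_bracket:
  assumes m: "2 \<le> m" "m \<le> n" and "u \<in> lspan (H m \<union> I)" "v \<in> lspan (H m \<union> I)"
  shows "u \<otimes> v \<in> lspan (H m \<union> I)"
proof (rule lspan_bracket[OF assms(3,4)])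
  fix a b assume ab: "a \<in> H m \<union> I" "b \<in> H m \<union> I"
  show "a \<otimes> b \<in> lspan (H m \<union> I)"
  proof (cases "a \<in> I \<or> b \<in> I")
    case True
    then have "a \<otimes> b \<in> I" using lie_idealD[OF I] ab HI_sub[OF m] by blast
    then show ?thesis by (simp add: lspan_incl)
  next
    case False
    then have "a \<otimes> b \<in> lspan (H m)"
      using ab hall_lspan_bracket[OF _ y_funcset[OF m]] unfolding H_def by (simp add: lspan_incl)
    then show ?thesis using lspan_mono[of "H m" "H m \<union> I"] by auto
  qed
qed (use HI_sub m in auto)

text \<open>Bracketing with \<open>y r j\<close> is a derivation, \<open>rel\<close> controls it on
  the generators of block \<open>m\<close>, and this block is closed under brackets modulo
  \<open>I\<close>.\<close>

lemma block_bracket_gen: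
  assumes r: "2 \<le> r" "r < m" "m \<le> n" "1 \<le> j" "j \<le> r" and x: "x \<in> lspan (H m \<union> I)"
  shows "x \<otimes> y r j \<in> lspan (H m \<union> I)"
proof (rule lspan_bracket[OF x lspan_incl[of _ "{y r j}"]])
  have yr: "y r j \<in> carrier L" using r y_closed by simp
  then show "{y r j} \<subseteq> carrier L" by simp
  have m: "2 \<le> m" "m \<le> n" using r by simp_all
  have "lie_eval L (y m) t \<otimes> y r j \<in> lspan (H m \<union> I)" if "hall {1..m} t" for t
    using that
  proof (induction rule: hall.induct)
    case (Gen i)
    then show ?case using rel[of r m i j] r unfolding H_def by simp
  next
    case (Br s t)
    have H: "lie_eval L (y m) s \<in> H m" "lie_eval L (y m) t \<in> H m"
      using Br by (auto simp: H_def)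
    then have c: "lie_eval L (y m) s \<in> carrier L" "lie_eval L (y m) t \<in> carrier L"
      using H_sub[OF m] by auto
    then show ?case
      using bracket_Leibniz[OF c yr] Br.IH H
      by (auto intro!: lspan_add block_bracket m intro: lspan_incl)
  qed
  then show "a \<otimes> b \<in> lspan (H m \<union> I)" if "a \<in> H m \<union> I" "b \<in> {y r j}" for a b
    using that lie_idealD[OF I _ yr] by (auto simp: H_def intro: lspan_incl)
qed (use HI_sub r in auto)

text \<open>Bracketing with a bracket is a commutator of two operators:
  \<open>[x,[s,t]] = [[x,s],t] - [[x,t],s]\<close>. The element \<open>x\<close> stays general in
  the induction because \<open>[x,s]\<close> and \<open>[x,t]\<close> take its place.\<close>

lemma block_bracket_lower:
  assumes r: "2 \<le> r" "r < m" "m \<le> n" and t: "hall {1..r} t" and x: "x \<in> lspan (H m \<union> I)"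
  shows "x \<otimes> lie_eval L (y r) t \<in> lspan (H m \<union> I)"
  using t x
proof (induction arbitrary: x rule: hall.induct)
  case (Gen j)
  then show ?case using block_bracket_gen[of r m j] r by simp
next
  case (Br s t)
  let ?s = "lie_eval L (y r) s" and ?t = "lie_eval L (y r) t"
  have H: "?s \<in> carrier L" "?t \<in> carrier L"
    using Br H_sub[of r] r by (auto simp: H_def)
  have sub: "H m \<union> I \<subseteq> carrier L" using HI_sub r by auto
  have x: "x \<in> carrier L" using lspan_closed[OF sub Br.prems] .
  have "(x \<otimes> ?s) \<otimes> ?t \<in> lspan (H m \<union> I)" "(x \<otimes> ?t) \<otimes> ?s \<in> lspan (H m \<union> I)"
    using Br by auto
  moreover have "x \<otimes> (?s \<otimes> ?t) = \<ominus> ((x \<otimes> ?t) \<otimes> ?s) \<oplus> (x \<otimes> ?s) \<otimes> ?t"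
    using bracket_Leibniz[OF x H] x H bracket_closed
    by (simp add: a_assoc[symmetric] l_neg)
  ultimately show ?case using lspan_minus[OF sub] by (simp add: lspan_add)
qed

definition total :: "'a set" where
  "total = lspan ((\<Union>m\<in>{2..n}. H m) \<union> I)"

lemma total_sub: "(\<Union>m\<in>{2..n}. H m) \<union> I \<subseteq> carrier L"
proof -
  have "H m \<subseteq> carrier L" if "m \<in> {2..n}" for m using H_sub that by simp
  then show ?thesis using I_sub by blast
qed

lemma y_in_total: "\<lbrakk>2 \<le> m; m \<le> n; 1 \<le> i; i \<le> m\<rbrakk> \<Longrightarrow> y m i \<in> total"
  unfolding total_def using y_in_H[of i m] by (intro lspan_incl) auto

text \<open>Of two different blocks the one of larger index absorbs the bracket; antisymmetry brings
  it to the left.\<close>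

lemma total_bracket:
  assumes "u \<in> total" "v \<in> total"
  shows "u \<otimes> v \<in> total"
  unfolding total_def
proof (rule lspan_bracket[OF assms[unfolded total_def]])
  fix a b assume ab: "a \<in> (\<Union>m\<in>{2..n}. H m) \<union> I" "b \<in> (\<Union>m\<in>{2..n}. H m) \<union> I"
  have ac: "a \<in> carrier L" "b \<in> carrier L" using ab total_sub by auto
  have blk: "lspan (H m \<union> I) \<subseteq> lspan ((\<Union>m\<in>{2..n}. H m) \<union> I)" if "m \<in> {2..n}" for m
    using that by (intro lspan_mono) auto
  have lower: "a \<otimes> b \<in> lspan ((\<Union>m\<in>{2..n}. H m) \<union> I)"
    if "a \<in> H m" "b \<in> H r" "2 \<le> r" "r < m" "m \<le> n" for a b m r
    using that block_bracket_lower[of r m _ a] blk[of m]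
    by (auto simp: H_def[of r] intro: lspan_incl)
  consider "a \<in> I \<or> b \<in> I" | m r where "a \<in> H m" "b \<in> H r" "m \<in> {2..n}" "r \<in> {2..n}"
    using ab by auto
  then show "a \<otimes> b \<in> lspan ((\<Union>m\<in>{2..n}. H m) \<union> I)"
  proof cases
    case 1
    then show ?thesis using lie_idealD[OF I] ac by (auto intro: lspan_incl)
  next
    case 2
    consider "r < m" | "m < r" | "m = r" by linarith
    then show ?thesis
    proof cases
      case 2
      then have "b \<otimes> a \<in> lspan ((\<Union>m\<in>{2..n}. H m) \<union> I)"
        using lower[of b r a m] \<open>a \<in> H m\<close> \<open>b \<in> H r\<close> \<open>m \<in> _\<close> \<open>r \<in> _\<close> by simp
      then show ?thesis using bracket_antisym[OF ac] lspan_minus[OF total_sub] by simp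
    next
      case 3
      then show ?thesis
        using block_bracket[of m a b] 2 blk[of m] by (auto intro: lspan_incl)
    qed (use 2 lower[of a m b r] in simp)
  qed
qed (use total_sub in auto)

end

section \<open>The lower central series\<close>

context group
begin

abbreviation \<gamma> where "\<gamma> \<equiv> lower_central G"

lemma inv_mult_cancel:
  "\<lbrakk>x \<in> carrier G; y \<in> carrier G\<rbrakk> \<Longrightarrow> inv x \<otimes> (x \<otimes> y) = y"
  "\<lbrakk>x \<in> carrier G; y \<in> carrier G\<rbrakk> \<Longrightarrow> x \<otimes> (inv x \<otimes> y) = y"
  by (simp_all add: m_assoc[symmetric])

text \<open>Together with the standard rules for unit and inverse, these form the complete rewrite
  system for words in a group, so that commutator identities are settled by reduction to normal
  form.\<close>

lemmas group_word_simps = group_commutator_def m_assoc inv_mult_group inv_mult_cancel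

lemma group_commutator_closed [simp]:
  "\<lbrakk>a \<in> carrier G; b \<in> carrier G\<rbrakk> \<Longrightarrow> group_commutator G a b \<in> carrier G"
  by (simp add: group_commutator_def)

lemma inv_group_commutator:
  "\<lbrakk>a \<in> carrier G; b \<in> carrier G\<rbrakk> \<Longrightarrow> inv (group_commutator G a b) = group_commutator G b a"
  by (simp add: group_word_simps)

lemma group_commutator_mult_left:
  "\<lbrakk>a \<in> carrier G; a' \<in> carrier G; b \<in> carrier G\<rbrakk> \<Longrightarrow>
    group_commutator G (a \<otimes> a') b = inv a' \<otimes> group_commutator G a b \<otimes> a' \<otimes> group_commutator G a' b"
  by (simp add: group_word_simps)

lemma group_commutator_mult_right:
  "\<lbrakk>a \<in> carrier G; b \<in> carrier G; b' \<in> carrier G\<rbrakk> \<Longrightarrow>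
    group_commutator G a (b \<otimes> b') = group_commutator G a b' \<otimes> (inv b' \<otimes> group_commutator G a b \<otimes> b')"
  by (simp add: group_word_simps)

lemma group_commutator_inv_right:
  "\<lbrakk>a \<in> carrier G; b \<in> carrier G\<rbrakk> \<Longrightarrow>
    group_commutator G a (inv b) = b \<otimes> inv (group_commutator G a b) \<otimes> inv b"
  by (simp add: group_word_simps)

lemma group_commutator_one [simp]:
  "a \<in> carrier G \<Longrightarrow> group_commutator G a \<one> = \<one>"
  "a \<in> carrier G \<Longrightarrow> group_commutator G \<one> a = \<one>"
  "a \<in> carrier G \<Longrightarrow> group_commutator G a a = \<one>"
  by (simp_all add: group_word_simps)

text \<open>Serves twice: to place the commutator of two lower central terms, and for the Jacobi
  identity of the graded ring.\<close>

lemma Hall_Witt: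
  assumes "x \<in> carrier G" "y \<in> carrier G" "z \<in> carrier G"
  shows "inv y \<otimes> group_commutator G (group_commutator G x (inv y)) z \<otimes> y \<otimes>
    (inv z \<otimes> group_commutator G (group_commutator G y (inv z)) x \<otimes> z) \<otimes>
    (inv x \<otimes> group_commutator G (group_commutator G z (inv x)) y \<otimes> x) = \<one>"
  using assms by (simp add: group_word_simps)

lemma conj_group_commutator:
  "\<lbrakk>a \<in> carrier G; b \<in> carrier G; g \<in> carrier G\<rbrakk> \<Longrightarrow>
    g \<otimes> group_commutator G a b \<otimes> inv g =
    group_commutator G (g \<otimes> a \<otimes> inv g) (g \<otimes> b \<otimes> inv g)"
  by (simp add: group_word_simps)

lemma normal_lower_central: "\<gamma> c \<lhd> G"
proof (induction c)
  case 0
  then show ?case by (auto intro!: normal_invI subgroup_self)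
next
  case (Suc c)
  show ?case
  proof (cases c)
    case 0
    then show ?thesis by (auto intro!: normal_invI subgroup_self)
  next
    case c: (Suc d)
    interpret N: normal "\<gamma> (Suc d)" G using Suc c by simp
    show ?thesis
      unfolding c lower_central.simps
    proof (rule normal_generateI)
      fix h g assume g: "g \<in> carrier G" and
        "h \<in> {group_commutator G a b |a b. a \<in> \<gamma> (Suc d) \<and> b \<in> carrier G}"
      then obtain a b where h: "h = group_commutator G a b" "a \<in> \<gamma> (Suc d)" "b \<in> carrier G"
        by blast
      then have "g \<otimes> h \<otimes> inv g = group_commutator G (g \<otimes> a \<otimes> inv g) (g \<otimes> b \<otimes> inv g)"
        using g N.mem_carrier by (simp add: conj_group_commutator)
      moreover have "g \<otimes> a \<otimes> inv g \<in> \<gamma> (Suc d)" "g \<otimes> b \<otimes> inv g \<in> carrier G"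
        using g h N.inv_op_closed2 by auto
      ultimately show "g \<otimes> h \<otimes> inv g \<in> {group_commutator G a b |a b. a \<in> \<gamma> (Suc d) \<and> b \<in> carrier G}"
        by blast
    qed (use N.mem_carrier in auto)
  qed
qed

lemma lower_central_subset: "\<gamma> c \<subseteq> carrier G"
  using normal_lower_central normal_imp_subgroup subgroup.subset by blast

lemma lower_central_carrier [simp]: "a \<in> \<gamma> c \<Longrightarrow> a \<in> carrier G"
  using lower_central_subset by blast

lemma lower_central_one: "\<one> \<in> \<gamma> c"
  by (rule subgroup.one_closed[OF normal_imp_subgroup[OF normal_lower_central]])

lemma lower_central_mult:
  "\<lbrakk>a \<in> \<gamma> c; b \<in> \<gamma> c\<rbrakk> \<Longrightarrow> a \<otimes> b \<in> \<gamma> c"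
  by (rule subgroup.m_closed[OF normal_imp_subgroup[OF normal_lower_central]])

lemma lower_central_inv: "a \<in> \<gamma> c \<Longrightarrow> inv a \<in> \<gamma> c"
  by (rule subgroup.m_inv_closed[OF normal_imp_subgroup[OF normal_lower_central]])

lemma lower_central_Suc_subset: "\<gamma> (Suc c) \<subseteq> \<gamma> c"
proof (cases c)
  case (Suc d)
  interpret N: normal "\<gamma> (Suc d)" G by (rule normal_lower_central)
  have "group_commutator G a b \<in> \<gamma> (Suc d)"
    if "a \<in> \<gamma> (Suc d)" "b \<in> carrier G" for a b
    using that N.m_closed[OF N.m_inv_closed N.inv_op_closed1[of b a]]
    by (simp add: group_word_simps)
  then show ?thesis unfolding Suc lower_central.simps(3)
    by (intro generate_subgroup_incl N.subgroup_axioms) auto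
qed simp

lemma lower_central_commutator_Suc:
  "\<lbrakk>a \<in> \<gamma> c; b \<in> carrier G; 1 \<le> c\<rbrakk> \<Longrightarrow> group_commutator G a b \<in> \<gamma> (Suc c)"
  by (cases c) (auto intro: generate.incl)

text \<open>The three subgroups argument, by induction on \<open>j\<close> for all \<open>i\<close>
  at once. On a generator \<open>[b,g]\<close> of the next term the Hall-Witt identity expresses the
  commutator by two others: one falls under the hypothesis for \<open>(i + 1, j)\<close>, the other
  arises from \<open>(i, j)\<close> by one further commutator.\<close>

lemma lower_central_commutator:
  assumes "1 \<le> i" "1 \<le> j" "a \<in> \<gamma> i" "b \<in> \<gamma> j"
  shows "group_commutator G a b \<in> \<gamma> (i + j)"
  using assms(2,1,3,4)
proof (induction j arbitrary: i a b rule: nat_induct_at_least)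
  case base
  then show ?case using lower_central_commutator_Suc by simp
next
  case (Suc j)
  define K where "K = \<gamma> (Suc (i + j))"
  interpret N: normal K G unfolding K_def by (rule normal_lower_central)
  obtain j' where j': "j = Suc j'" using Suc.hyps by (cases j) auto
  have a: "a \<in> carrier G" using Suc.prems by simp
  note inv = lower_central_inv
  have base: "group_commutator G a (group_commutator G b g) \<in> K"
    if b: "b \<in> \<gamma> j" and g: "g \<in> carrier G" for b g
  proof -
    \<comment> \<open>Hall-Witt contains the inverse of its second argument; starting from
      \<open>inv g\<close> makes \<open>[b,g]\<close> appear.\<close>
    define y where "y = inv g"
    have y: "y \<in> carrier G" "inv y = g" using g by (simp_all add: y_def)
    have bc: "b \<in> carrier G" using b by simp
    define A where "A = group_commutator G (group_commutator G b (inv y)) a"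
    define B where "B = inv a \<otimes> group_commutator G (group_commutator G y (inv a)) b \<otimes> a"
    define C where "C = inv b \<otimes> group_commutator G (group_commutator G a (inv b)) y \<otimes> b"
    have Ac: "A \<in> carrier G" using y g a bc by (simp add: A_def)
    have "group_commutator G y (inv a) \<in> \<gamma> (Suc i)"
      using inv[OF lower_central_commutator_Suc[OF inv[OF Suc.prems(2)] y(1) Suc.prems(1)]] y a
      by (simp add: inv_group_commutator)
    then have "group_commutator G (group_commutator G y (inv a)) b \<in> \<gamma> (Suc i + j)"
      using b by (intro Suc.IH) simp_all
    then have B: "B \<in> K" unfolding B_def using a N.inv_op_closed1 by (simp add: K_def)
    have "group_commutator G a (inv b) \<in> \<gamma> (i + j)"
      using Suc.prems inv[OF b] by (intro Suc.IH)
    then have "group_commutator G (group_commutator G a (inv b)) y \<in> K"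
      unfolding K_def using y Suc.prems by (intro lower_central_commutator_Suc) simp_all
    then have C: "C \<in> K" unfolding C_def using bc N.inv_op_closed1 by simp
    have BC: "B \<otimes> C \<in> K" "B \<in> carrier G" "C \<in> carrier G" using B C N.mem_carrier by auto
    have "inv y \<otimes> A \<otimes> y \<otimes> B \<otimes> C = \<one>"
      using Hall_Witt[OF bc y(1) a] unfolding A_def B_def C_def .
    then have "inv y \<otimes> A \<otimes> y = inv (B \<otimes> C)"
      using y(1) BC Ac by (intro inv_equality[symmetric]) (simp_all add: m_assoc)
    then have "inv y \<otimes> A \<otimes> y \<in> K" using N.m_inv_closed[OF BC(1)] by simp
    then have "y \<otimes> (inv y \<otimes> A \<otimes> y) \<otimes> inv y \<in> K"
      using y(1) N.inv_op_closed2 by blast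
    also have "y \<otimes> (inv y \<otimes> A \<otimes> y) \<otimes> inv y = A"
      using y(1) Ac by (simp add: m_assoc inv_mult_cancel)
    finally show ?thesis
      using N.m_inv_closed[of A] a bc y g by (simp add: inv_group_commutator A_def)
  qed
  have b: "b \<in> generate G {group_commutator G a b | a b. a \<in> \<gamma> j \<and> b \<in> carrier G}"
    using Suc.prems(3) unfolding j' lower_central.simps .
  have sub: "{group_commutator G a b | a b. a \<in> \<gamma> j \<and> b \<in> carrier G} \<subseteq> carrier G"
    by auto
  have "group_commutator G a b \<in> K" using b
  proof (induction rule: generate.induct)
    case one
    then show ?case using a by simp
  next
    case (incl h)
    then show ?case using base by auto
  next
    case (inv h)
    then have h: "h \<in> carrier G" and "group_commutator G a h \<in> K"
      using base sub by auto
    then show ?case using a N.inv_op_closed2[OF h N.m_inv_closed] by (simp add: group_commutator_inv_right)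
  next
    case (eng h k)
    then have "h \<in> carrier G" "k \<in> carrier G" using generate_in_carrier[OF sub] by auto
    then show ?case using a eng.IH N.inv_op_closed1 by (simp add: group_commutator_mult_right)
  qed
  then show ?case by (simp only: K_def add_Suc_right)
qed

end

section \<open>The graded Lie ring of a group\<close>

text \<open>The homogeneous element of degree \<open>c\<close>. Zero in degree \<open>d\<close> is
  the coset \<open>lower_central G (Suc d)\<close> itself, and the restriction to positive degrees
  matches the functions that make up \<open>sum_group\<close>.\<close>

definition gr_elem :: "('a, 'm) monoid_scheme \<Rightarrow> nat \<Rightarrow> 'a \<Rightarrow> nat \<Rightarrow> 'a set" where
  "gr_elem G c a = (\<lambda>d\<in>{1..}. if d = c then lower_central G (Suc c) #>\<^bsub>G\<^esub> a
     else lower_central G (Suc d))"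

context group
begin

abbreviation gr_add (infixl "\<oplus>\<^sub>g" 65) where "f \<oplus>\<^sub>g g \<equiv> f \<oplus>\<^bsub>gr G\<^esub> g"
abbreviation gr_bracket_op (infixl "\<otimes>\<^sub>g" 70) where "f \<otimes>\<^sub>g g \<equiv> f \<otimes>\<^bsub>gr G\<^esub> g"
abbreviation gr_minus ("\<ominus>\<^sub>g _" [81] 80) where "\<ominus>\<^sub>g f \<equiv> \<ominus>\<^bsub>gr G\<^esub> f"
abbreviation gr_zero ("\<zero>\<^sub>g") where "\<zero>\<^sub>g \<equiv> \<zero>\<^bsub>gr G\<^esub>"

lemma rcos_eq_iff:
  assumes "N \<lhd> G" "x \<in> carrier G" "y \<in> carrier G"
  shows "N #> x = N #> y \<longleftrightarrow> x \<otimes> inv y \<in> N"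
proof -
  interpret N: normal N G by fact
  have "x \<in> N #> y \<longleftrightarrow> x \<otimes> inv y \<in> N" using N.rcos_module[OF is_group] assms by blast
  moreover have "x \<in> N #> y \<longleftrightarrow> N #> x = N #> y"
    using repr_independence[OF _ assms(3) N.subgroup_axioms] rcos_self[OF assms(2) N.subgroup_axioms]
    by metis
  ultimately show ?thesis by blast
qed

lemma rcos_mult_left:
  assumes "N \<lhd> G" "u \<in> N" "x \<in> carrier G"
  shows "N #> (u \<otimes> x) = N #> x"
proof -
  interpret N: normal N G by fact
  show ?thesis using rcos_eq_iff[OF assms(1)] assms(2,3) N.mem_carrier by (simp add: m_assoc)
qed

lemma rcos_one: "N \<lhd> G \<Longrightarrow> u \<in> N \<Longrightarrow> N #> u = N"
  by (meson coset_join2 normal_imp_subgroup subgroup.mem_carrier)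

text \<open>Successive quotients of the lower central series are central: the quotient of
  \<open>inv g \<otimes> x \<otimes> g\<close> by \<open>x\<close> is a conjugate of
  \<open>[x,g]\<close>.\<close>

lemma rcos_lower_central_conj:
  assumes "1 \<le> c" "x \<in> \<gamma> c" "g \<in> carrier G"
  shows "\<gamma> (Suc c) #> (inv g \<otimes> x \<otimes> g) = \<gamma> (Suc c) #> x"
proof -
  interpret N: normal "\<gamma> (Suc c)" G by (rule normal_lower_central)
  have x: "x \<in> carrier G" using assms by simp
  have "x \<otimes> group_commutator G x g \<otimes> inv x \<in> \<gamma> (Suc c)"
    using x assms by (intro N.inv_op_closed2 lower_central_commutator_Suc)
  also have "x \<otimes> group_commutator G x g \<otimes> inv x = inv g \<otimes> x \<otimes> g \<otimes> inv x"
    using x assms(3) by (simp add: group_word_simps)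
  finally show ?thesis using x assms by (simp add: rcos_eq_iff normal_lower_central)
qed

lemma rcos_lower_central_commutator_left:
  assumes "1 \<le> i" "1 \<le> j" "a \<in> \<gamma> i" "a' \<in> \<gamma> i" "b \<in> \<gamma> j"
  shows "\<gamma> (Suc (i + j)) #> group_commutator G (a \<otimes> a') b =
    \<gamma> (Suc (i + j)) #> (group_commutator G a b \<otimes> group_commutator G a' b)"
proof -
  interpret N: normal "\<gamma> (Suc (i + j))" G by (rule normal_lower_central)
  have c: "a \<in> carrier G" "a' \<in> carrier G" "b \<in> carrier G" using assms by auto
  have "\<gamma> (Suc (i + j)) #> (inv a' \<otimes> group_commutator G a b \<otimes> a') =
      \<gamma> (Suc (i + j)) #> group_commutator G a b"
    using assms c by (intro rcos_lower_central_conj lower_central_commutator) auto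
  then show ?thesis
    using c by (simp add: group_commutator_mult_left N.rcos_sum[symmetric])
qed

lemma rcos_lower_central_commutator_right:
  assumes "1 \<le> i" "1 \<le> j" "a \<in> \<gamma> i" "b \<in> \<gamma> j" "b' \<in> \<gamma> j"
  shows "\<gamma> (Suc (i + j)) #> group_commutator G a (b \<otimes> b') =
    \<gamma> (Suc (i + j)) #> (group_commutator G a b' \<otimes> group_commutator G a b)"
proof -
  interpret N: normal "\<gamma> (Suc (i + j))" G by (rule normal_lower_central)
  have c: "a \<in> carrier G" "b' \<in> carrier G" "b \<in> carrier G" using assms by auto
  have "\<gamma> (Suc (i + j)) #> (inv b' \<otimes> group_commutator G a b \<otimes> b') =
      \<gamma> (Suc (i + j)) #> group_commutator G a b"
    using assms c by (intro rcos_lower_central_conj lower_central_commutator) auto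
  then show ?thesis
    using c by (simp add: group_commutator_mult_right N.rcos_sum[symmetric])
qed

text \<open>The bracket is a union over representatives, so the point is independence of them.
  Replacing \<open>a\<close> by \<open>u \<otimes> a\<close> with \<open>u\<close> in the next term
  multiplies the commutator, modulo \<open>?K\<close>, by one that lies in \<open>?K\<close>;
  likewise for \<open>b\<close>.\<close>

lemma gr_bracket_rcos:
  assumes "1 \<le> i" "1 \<le> j" "a \<in> \<gamma> i" "b \<in> \<gamma> j"
  shows "gr_bracket G i j (\<gamma> (Suc i) #> a) (\<gamma> (Suc j) #> b) =
    \<gamma> (Suc (i + j)) #> group_commutator G a b"
proof -
  let ?K = "\<gamma> (Suc (i + j))"
  interpret N: normal ?K G by (rule normal_lower_central)
  have c: "a \<in> carrier G" "b \<in> carrier G" using assms by auto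
  have "?K #> group_commutator G a' b' = ?K #> group_commutator G a b"
    if a': "a' \<in> \<gamma> (Suc i) #> a" and b': "b' \<in> \<gamma> (Suc j) #> b" for a' b'
  proof -
    obtain u where u: "u \<in> \<gamma> (Suc i)" "a' = u \<otimes> a" using a' by (auto simp: r_coset_def)
    obtain v where v: "v \<in> \<gamma> (Suc j)" "b' = v \<otimes> b" using b' by (auto simp: r_coset_def)
    have ui: "u \<in> \<gamma> i" "v \<in> \<gamma> j"
      using u v lower_central_Suc_subset by auto
    interpret Nj: subgroup "\<gamma> j" G
      by (rule normal_imp_subgroup[OF normal_lower_central])
    have bj: "b' \<in> \<gamma> j" using ui v assms by simp
    have uc: "u \<in> carrier G" "v \<in> carrier G" "b' \<in> carrier G" using ui bj by auto
    have "?K #> group_commutator G a' b' = ?K #> (group_commutator G u b' \<otimes> group_commutator G a b')"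
      unfolding u(2) using assms ui bj by (intro rcos_lower_central_commutator_left)
    also have "\<dots> = ?K #> group_commutator G a b'"
    proof (rule rcos_mult_left[OF normal_lower_central])
      show "group_commutator G u b' \<in> ?K"
        using lower_central_commutator[of "Suc i" j u b'] assms u(1) bj by simp
    qed (use c uc in simp)
    also have "\<dots> = ?K #> (group_commutator G a b \<otimes> group_commutator G a v)"
      unfolding v(2) using assms ui by (intro rcos_lower_central_commutator_right)
    also have "\<dots> = (?K #> group_commutator G a b) <#> (?K #> group_commutator G a v)"
      using c uc by (simp add: N.rcos_sum)
    also have "?K #> group_commutator G a v = ?K #> \<one>"
    proof -
      have "group_commutator G a v \<in> ?K"
        using lower_central_commutator[of i "Suc j" a v] assms v(1) by simp
      then show ?thesis
        using rcos_one[OF normal_lower_central] N.one_closed by metis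
    qed
    finally show ?thesis using c by (simp add: N.rcos_sum)
  qed
  moreover have "a \<in> \<gamma> (Suc i) #> a" "b \<in> \<gamma> (Suc j) #> b"
    using c by (simp_all add: rcos_self normal_imp_subgroup normal_lower_central)
  ultimately show ?thesis unfolding gr_bracket_def by blast
qed

lemma normal_lower_central_Suc:
  "\<gamma> (Suc c) \<lhd> G\<lparr>carrier := \<gamma> c\<rparr>"
  by (intro normal_restrict_supergroup normal_lower_central normal_imp_subgroup lower_central_Suc_subset)

lemma gr_component_simps:
  "carrier (gr_component G c) = (\<lambda>a. \<gamma> (Suc c) #> a) ` \<gamma> c"
  "\<one>\<^bsub>gr_component G c\<^esub> = \<gamma> (Suc c)"
  "A \<otimes>\<^bsub>gr_component G c\<^esub> B = A <#> B"
  by (simp_all add: gr_component_def carrier_FactGroup)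

lemma rcos_mult_lower_central:
  "\<lbrakk>a \<in> carrier G; b \<in> carrier G\<rbrakk> \<Longrightarrow>
    (\<gamma> c #> a) <#> (\<gamma> c #> b) = \<gamma> c #> (a \<otimes> b)"
  by (rule normal.rcos_sum[OF normal_lower_central])

lemma comm_group_gr_component:
  assumes "1 \<le> c" shows "comm_group (gr_component G c)"
proof -
  have "group (gr_component G c)"
    unfolding gr_component_def by (rule normal.factorgroup_is_group[OF normal_lower_central_Suc])
  then show ?thesis
  proof (rule group.group_comm_groupI)
    fix A B assume "A \<in> carrier (gr_component G c)" "B \<in> carrier (gr_component G c)"
    then obtain a b where ab: "a \<in> \<gamma> c" "b \<in> \<gamma> c"
      "A = \<gamma> (Suc c) #> a" "B = \<gamma> (Suc c) #> b"
      by (auto simp: gr_component_simps)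
    have "\<gamma> (Suc c) #> (a \<otimes> b) = \<gamma> (Suc c) #> (b \<otimes> a)"
      using rcos_lower_central_conj[OF assms, of "b \<otimes> a" b] ab
        lower_central_mult
      by (simp add: m_assoc inv_mult_cancel)
    then show "A \<otimes>\<^bsub>gr_component G c\<^esub> B = B \<otimes>\<^bsub>gr_component G c\<^esub> A"
      using ab by (simp add: gr_component_simps rcos_mult_lower_central)
  qed
qed

lemma group_gr_component: "1 \<le> c \<Longrightarrow> group (gr_component G c)"
  using comm_group_gr_component comm_group.axioms(2) by blast

lemma carrier_gr:
  "carrier (gr G) = {f \<in> \<Pi>\<^sub>E c\<in>{1..}. carrier (gr_component G c).
     finite {c \<in> {1..}. f c \<noteq> \<gamma> (Suc c)}}"
  using carrier_sum_group[of "{1..}" "gr_component G"] group_gr_component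
  by (simp add: gr_def gr_component_simps(2))

lemma add_gr: "f \<oplus>\<^sub>g g = (\<lambda>c\<in>{1..}. f c <#> g c)"
  by (simp add: gr_def gr_component_simps)

lemma zero_gr: "\<zero>\<^sub>g = (\<lambda>c\<in>{1..}. \<gamma> (Suc c))"
  by (simp add: gr_def gr_component_simps)

lemma mult_gr: "f \<otimes>\<^sub>g g = (\<lambda>c\<in>{1..}. finprod (gr_component G c)
    (\<lambda>i. gr_bracket G i (c - i) (f i) (g (c - i))) {1..<c})"
  by (simp add: gr_def)

lemma abelian_group_gr: "abelian_group (gr G)"
proof -
  have eq: "add_monoid (gr G) = sum_group {1..} (gr_component G)"
    by (rule monoid.equality) (simp_all add: gr_def)
  interpret S: group "sum_group {1..} (gr_component G)"
    by (rule sum_group) (use group_gr_component in auto)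
  have "comm_group (sum_group {1..} (gr_component G))"
  proof (rule S.group_comm_groupI)
    fix f g assume fg: "f \<in> carrier (sum_group {1..} (gr_component G))"
      "g \<in> carrier (sum_group {1..} (gr_component G))"
    have "f c \<otimes>\<^bsub>gr_component G c\<^esub> g c = g c \<otimes>\<^bsub>gr_component G c\<^esub> f c" if c: "c \<in> {1..}" for c
    proof -
      have "f c \<in> carrier (gr_component G c)" "g c \<in> carrier (gr_component G c)"
        using fg c carrier_sum_group[of "{1..}" "gr_component G"] group_gr_component by auto
      then show ?thesis
        using c by (intro comm_groupE(4)[OF comm_group_gr_component]) auto
    qed
    then show "f \<otimes>\<^bsub>sum_group {1..} (gr_component G)\<^esub> g = g \<otimes>\<^bsub>sum_group {1..} (gr_component G)\<^esub> f"
      unfolding mult_sum_group by (intro restrict_ext)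
  qed
  then have "comm_group (add_monoid (gr G))" using eq by simp
  then show ?thesis by (rule comm_group_abelian_groupI)
qed

lemma gr_elem_closed:
  assumes "a \<in> \<gamma> c"
  shows "gr_elem G c a \<in> carrier (gr G)"
proof -
  have "finite {d \<in> {1..}. gr_elem G c a d \<noteq> \<gamma> (Suc d)}"
    by (rule finite_subset[of _ "{c}"]) (auto simp: gr_elem_def)
  moreover have "\<gamma> (Suc d) \<in> carrier (gr_component G d)" if "1 \<le> d" for d
    using group.is_monoid[OF group_gr_component[OF that]] monoid.one_closed
    by (metis gr_component_simps(2))
  ultimately show ?thesis
    unfolding carrier_gr using assms by (auto simp: gr_elem_def gr_component_simps(1))
qed

lemma gr_elem_mult:
  assumes "a \<in> \<gamma> c" "b \<in> \<gamma> c"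
  shows "gr_elem G c (a \<otimes> b) = gr_elem G c a \<oplus>\<^sub>g gr_elem G c b"
proof -
  have "\<gamma> d <#> \<gamma> d = \<gamma> d" for d
    by (rule subgroup_mult_id[OF normal_imp_subgroup[OF normal_lower_central]])
  then show ?thesis
    unfolding add_gr gr_elem_def using assms
    by (intro restrict_ext) (auto simp: rcos_mult_lower_central)
qed

lemma gr_elem_eq_zero_iff:
  assumes "a \<in> \<gamma> c" "1 \<le> c"
  shows "gr_elem G c a = \<zero>\<^sub>g \<longleftrightarrow> a \<in> \<gamma> (Suc c)"
proof
  assume "gr_elem G c a = \<zero>\<^sub>g"
  then have "gr_elem G c a c = \<zero>\<^sub>g c" by simp
  then have "\<gamma> (Suc c) #> a = \<gamma> (Suc c)"
    using assms by (simp add: gr_elem_def zero_gr)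
  then show "a \<in> \<gamma> (Suc c)"
    using coset_join1 assms normal_imp_subgroup[OF normal_lower_central] lower_central_carrier by blast
next
  assume "a \<in> \<gamma> (Suc c)"
  then have "\<gamma> (Suc c) #> a = \<gamma> (Suc c)"
    by (rule rcos_one[OF normal_lower_central])
  then show "gr_elem G c a = \<zero>\<^sub>g"
    unfolding gr_elem_def zero_gr by (intro restrict_ext) auto
qed

lemma gr_elem_inv:
  assumes "a \<in> \<gamma> c" "1 \<le> c"
  shows "gr_elem G c (inv a) = \<ominus>\<^sub>g gr_elem G c a"
proof -
  interpret R: abelian_group "gr G" by (rule abelian_group_gr)
  interpret N: subgroup "\<gamma> c" G by (rule normal_imp_subgroup[OF normal_lower_central])
  have "gr_elem G c (inv a) \<oplus>\<^sub>g gr_elem G c a = gr_elem G c \<one>"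
    using assms by (simp add: gr_elem_mult[symmetric])
  also have "\<dots> = \<zero>\<^sub>g"
    using gr_elem_eq_zero_iff[of \<one> c] assms
      lower_central_one by simp
  finally show ?thesis using assms by (simp add: R.minus_equality gr_elem_closed)
qed

text \<open>Supports are finite, so every element is a finite sum of homogeneous ones; the induction
  strips one degree at a time. Additive statements then need to be checked on \<open>gr_elem\<close>
  only.\<close>

lemma gr_induct [consumes 1, case_names zero add]:
  assumes "f \<in> carrier (gr G)" "P \<zero>\<^sub>g"
    and step: "\<And>c a f. \<lbrakk>1 \<le> c; a \<in> \<gamma> c; f \<in> carrier (gr G); P f\<rbrakk> \<Longrightarrow>
      P (gr_elem G c a \<oplus>\<^sub>g f)"
  shows "P f"
proof -
  define supp where "supp = (\<lambda>f. {c \<in> {1..}. f c \<noteq> \<gamma> (Suc c)})"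
  have "finite S \<Longrightarrow> f \<in> carrier (gr G) \<Longrightarrow> supp f = S \<Longrightarrow> P f" for S f
  proof (induction S arbitrary: f rule: finite_induct)
    case empty
    then have "f = \<zero>\<^sub>g"
      unfolding zero_gr by (intro ext) (auto simp: carrier_gr supp_def PiE_def extensional_def)
    then show ?case using assms(2) by simp
  next
    case (insert c S)
    then have c: "1 \<le> c" by (auto simp: supp_def)
    have "f c \<in> carrier (gr_component G c)" using insert.prems(1) c by (auto simp: carrier_gr)
    then obtain a where a: "a \<in> \<gamma> c" "f c = \<gamma> (Suc c) #> a"
      by (auto simp: gr_component_simps)
    define g where "g = f(c := \<gamma> (Suc c))"
    have one: "\<gamma> (Suc d) \<in> carrier (gr_component G d)" if "1 \<le> d" for d
      using group.is_monoid[OF group_gr_component[OF that]] monoid.one_closed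
      by (metis gr_component_simps(2))
    have supp_g: "supp g = S" using insert.prems(2) insert.hyps(2) by (auto simp: supp_def g_def)
    then have "finite {c \<in> {1..}. g c \<noteq> \<gamma> (Suc c)}"
      using insert.hyps(1) by (simp add: supp_def)
    moreover have "g \<in> (\<Pi>\<^sub>E c\<in>{1..}. carrier (gr_component G c))"
      using insert.prems(1) c one by (auto simp: g_def carrier_gr PiE_def extensional_def)
    ultimately have g: "g \<in> carrier (gr G)" unfolding carrier_gr by blast
    have "f d = gr_elem G c a d <#> g d" if d: "1 \<le> d" for d
    proof -
      interpret D: group "gr_component G d" by (rule group_gr_component[OF d])
      have "f d \<in> carrier (gr_component G d)" using insert.prems(1) d by (auto simp: carrier_gr)
      then have "f d <#> \<gamma> (Suc d) = f d" "\<gamma> (Suc d) <#> f d = f d"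
        using D.l_one D.r_one by (simp_all add: gr_component_simps(2,3))
      then show ?thesis using d a by (auto simp: gr_elem_def g_def)
    qed
    then have "f = gr_elem G c a \<oplus>\<^sub>g g"
      using insert.prems(1) unfolding add_gr
      by (intro ext) (auto simp: carrier_gr PiE_def extensional_def)
    then show ?case using step[OF c a(1) g insert.IH[OF g supp_g]] by simp
  qed
  then show ?thesis using assms(1) by (auto simp: carrier_gr supp_def)
qed

end

section \<open>The bracket of the graded ring\<close>

context group
begin

lemma gr_nth:
  assumes "f \<in> carrier (gr G)" "1 \<le> c"
  obtains a where "a \<in> \<gamma> c" "f c = \<gamma> (Suc c) #> a"
proof -
  have "f c \<in> carrier (gr_component G c)" using assms by (auto simp: carrier_gr)
  then show thesis using that by (auto simp: gr_component_simps(1))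
qed

lemma rcos_in_gr_component:
  "a \<in> \<gamma> c \<Longrightarrow> \<gamma> (Suc c) #> a \<in> carrier (gr_component G c)"
  by (simp add: gr_component_simps(1))

lemma gr_bracket_closed:
  assumes "f \<in> carrier (gr G)" "g \<in> carrier (gr G)" "i \<in> {1..<c}"
  shows "gr_bracket G i (c - i) (f i) (g (c - i)) \<in> carrier (gr_component G c)"
proof -
  have i: "1 \<le> i" "1 \<le> c - i" "i + (c - i) = c" using assms(3) by auto
  obtain a where a: "a \<in> \<gamma> i" "f i = \<gamma> (Suc i) #> a"
    using gr_nth assms(1) i(1) .
  obtain b where b: "b \<in> \<gamma> (c - i)" "g (c - i) = \<gamma> (Suc (c - i)) #> b"
    using gr_nth assms(2) i(2) .
  show ?thesis
    using gr_bracket_rcos[OF i(1,2) a(1) b(1)] lower_central_commutator[OF i(1,2) a(1) b(1)]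
    unfolding a(2) b(2) i(3) by (simp add: rcos_in_gr_component)
qed

lemma gr_bracket_add:
  assumes "f \<in> carrier (gr G)" "f' \<in> carrier (gr G)" "g \<in> carrier (gr G)" "i \<in> {1..<c}"
  shows "gr_bracket G i (c - i) (f i <#> f' i) (g (c - i)) =
      gr_bracket G i (c - i) (f i) (g (c - i)) <#> gr_bracket G i (c - i) (f' i) (g (c - i))"
    and "gr_bracket G (c - i) i (g (c - i)) (f i <#> f' i) =
      gr_bracket G (c - i) i (g (c - i)) (f i) <#> gr_bracket G (c - i) i (g (c - i)) (f' i)"
proof -
  have i: "1 \<le> i" "1 \<le> c - i" using assms(4) by auto
  obtain a where a: "a \<in> \<gamma> i" "f i = \<gamma> (Suc i) #> a"
    using gr_nth assms(1) i(1) .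
  obtain a' where a': "a' \<in> \<gamma> i" "f' i = \<gamma> (Suc i) #> a'"
    using gr_nth assms(2) i(1) .
  obtain b where b: "b \<in> \<gamma> (c - i)" "g (c - i) = \<gamma> (Suc (c - i)) #> b"
    using gr_nth assms(3) i(2) .
  have aa: "a \<otimes> a' \<in> \<gamma> i" "a' \<otimes> a \<in> \<gamma> i"
    using a a' lower_central_mult by auto
  have c: "a \<in> carrier G" "a' \<in> carrier G" "b \<in> carrier G" using a a' b by auto
  have sum: "f i <#> f' i = \<gamma> (Suc i) #> (a \<otimes> a')"
    using c by (simp add: a a' rcos_mult_lower_central)
  interpret C: comm_group "gr_component G i" by (rule comm_group_gr_component[OF i(1)])
  have "f i <#> f' i = f' i <#> f i"
    using C.m_comm[OF rcos_in_gr_component[OF a(1)] rcos_in_gr_component[OF a'(1)]]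
    by (simp add: gr_component_simps(3) a a')
  \<comment> \<open>The right-hand commutator rule reverses the factors, so the same sum is also
    written with the representatives in the other order.\<close>
  then have sum': "f i <#> f' i = \<gamma> (Suc i) #> (a' \<otimes> a)"
    using c by (simp add: a a' rcos_mult_lower_central)
  show "gr_bracket G i (c - i) (f i <#> f' i) (g (c - i)) =
      gr_bracket G i (c - i) (f i) (g (c - i)) <#> gr_bracket G i (c - i) (f' i) (g (c - i))"
    unfolding sum using c rcos_lower_central_commutator_left[OF i a(1) a'(1) b(1)]
    by (simp add: a(2) a'(2) b(2) gr_bracket_rcos[OF i] a(1) a'(1) b(1) aa rcos_mult_lower_central)
  show "gr_bracket G (c - i) i (g (c - i)) (f i <#> f' i) =
      gr_bracket G (c - i) i (g (c - i)) (f i) <#> gr_bracket G (c - i) i (g (c - i)) (f' i)"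
    unfolding sum' using c rcos_lower_central_commutator_right[OF i(2,1) b(1) a'(1) a(1)]
    by (simp add: a(2) a'(2) b(2) gr_bracket_rcos[OF i(2,1)] a(1) a'(1) b(1) aa rcos_mult_lower_central)
qed

lemma gr_bracket_zero:
  assumes "1 \<le> i" "1 \<le> j"
  shows "b \<in> \<gamma> j \<Longrightarrow> gr_bracket G i j (\<gamma> (Suc i)) (\<gamma> (Suc j) #> b)
      = \<gamma> (Suc (i + j))"
    and "a \<in> \<gamma> i \<Longrightarrow> gr_bracket G i j (\<gamma> (Suc i) #> a) (\<gamma> (Suc j))
      = \<gamma> (Suc (i + j))"
proof -
  have one: "\<one> \<in> \<gamma> k" "\<gamma> k #> \<one> = \<gamma> k" for k
    using lower_central_one
      rcos_one[OF normal_lower_central] by auto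
  show "b \<in> \<gamma> j \<Longrightarrow> gr_bracket G i j (\<gamma> (Suc i)) (\<gamma> (Suc j) #> b)
      = \<gamma> (Suc (i + j))"
    using gr_bracket_rcos[OF assms one(1), of b] by (simp add: one(2))
  show "a \<in> \<gamma> i \<Longrightarrow> gr_bracket G i j (\<gamma> (Suc i) #> a) (\<gamma> (Suc j))
      = \<gamma> (Suc (i + j))"
    using gr_bracket_rcos[OF assms _ one(1), of a] by (simp add: one(2))
qed

lemma gr_mult_closed:
  assumes f: "f \<in> carrier (gr G)" and g: "g \<in> carrier (gr G)"
  shows "f \<otimes>\<^sub>g g \<in> carrier (gr G)"
proof -
  have fin: "finite {c \<in> {1..}. f c \<noteq> \<gamma> (Suc c)}"
      "finite {c \<in> {1..}. g c \<noteq> \<gamma> (Suc c)}"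
    using f g by (simp_all add: carrier_gr)
  obtain M where "\<forall>c\<in>{c \<in> {1..}. f c \<noteq> \<gamma> (Suc c)}. c \<le> M"
    using finite_nat_set_iff_bounded_le[THEN iffD1, OF fin(1)] by blast
  then have M: "f c = \<gamma> (Suc c)" if "M < c" "1 \<le> c" for c
    using that by (metis (mono_tags, lifting) atLeast_iff mem_Collect_eq not_le)
  obtain M' where "\<forall>c\<in>{c \<in> {1..}. g c \<noteq> \<gamma> (Suc c)}. c \<le> M'"
    using finite_nat_set_iff_bounded_le[THEN iffD1, OF fin(2)] by blast
  then have M': "g c = \<gamma> (Suc c)" if "M' < c" "1 \<le> c" for c
    using that by (metis (mono_tags, lifting) atLeast_iff mem_Collect_eq not_le)
  \<comment> \<open>Beyond \<open>M + M'\<close> one of the two degrees in each summand is outside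
    the support of its factor.\<close>
  have "(f \<otimes>\<^sub>g g) c = \<gamma> (Suc c)" if c: "M + M' < c" "1 \<le> c" for c
  proof -
    interpret C: comm_group "gr_component G c" by (rule comm_group_gr_component[OF c(2)])
    have "gr_bracket G i (c - i) (f i) (g (c - i)) = \<one>\<^bsub>gr_component G c\<^esub>" if "i \<in> {1..<c}" for i
    proof -
      have i: "1 \<le> i" "1 \<le> c - i" "i + (c - i) = c" using that by auto
      consider "M < i" | "M' < c - i" using c by linarith
      then show ?thesis
      proof cases
        case 1
        then show ?thesis
          using gr_nth[OF g i(2)] M[OF _ i(1)] gr_bracket_zero(1)[OF i(1,2)] i(3)
          by (metis gr_component_simps(2))
      next
        case 2
        then show ?thesis
          using gr_nth[OF f i(1)] M'[OF _ i(2)] gr_bracket_zero(2)[OF i(1,2)] i(3)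
          by (metis gr_component_simps(2))
      qed
    qed
    then have "finprod (gr_component G c) (\<lambda>i. gr_bracket G i (c - i) (f i) (g (c - i))) {1..<c} =
        \<one>\<^bsub>gr_component G c\<^esub>"
      by (rule C.finprod_one_eqI)
    then show ?thesis using c(2) by (simp add: mult_gr gr_component_simps(2))
  qed
  then have "{c \<in> {1..}. (f \<otimes>\<^sub>g g) c \<noteq> \<gamma> (Suc c)} \<subseteq> {..M + M'}"
    by (auto simp: not_less[symmetric])
  then have "finite {c \<in> {1..}. (f \<otimes>\<^sub>g g) c \<noteq> \<gamma> (Suc c)}"
    by (rule finite_subset) simp
  moreover have "(f \<otimes>\<^sub>g g) c \<in> carrier (gr_component G c)" if "1 \<le> c" for c
  proof -
    interpret C: comm_group "gr_component G c" by (rule comm_group_gr_component[OF that])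
    show ?thesis using that gr_bracket_closed[OF f g] by (auto simp: mult_gr intro!: C.finprod_closed)
  qed
  moreover have "f \<otimes>\<^sub>g g \<in> extensional {1..}" by (simp add: mult_gr)
  ultimately show ?thesis by (auto simp: carrier_gr PiE_def)
qed

lemma gr_add_mult:
  assumes f: "f \<in> carrier (gr G)" and f': "f' \<in> carrier (gr G)" and g: "g \<in> carrier (gr G)"
  shows "(f \<oplus>\<^sub>g f') \<otimes>\<^sub>g g = f \<otimes>\<^sub>g g \<oplus>\<^sub>g f' \<otimes>\<^sub>g g"
    and "g \<otimes>\<^sub>g (f \<oplus>\<^sub>g f') = g \<otimes>\<^sub>g f \<oplus>\<^sub>g g \<otimes>\<^sub>g f'"
proof -
  let ?S = "\<lambda>c h k. finprod (gr_component G c) (\<lambda>i. gr_bracket G i (c - i) (h i) (k (c - i))) {1..<c}"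
  have "?S c (f \<oplus>\<^sub>g f') g = ?S c f g <#> ?S c f' g"
    and "?S c g (f \<oplus>\<^sub>g f') = ?S c g f <#> ?S c g f'"
    if c: "1 \<le> c" for c
  proof -
    interpret C: comm_group "gr_component G c" by (rule comm_group_gr_component[OF c])
    have closed: "(\<lambda>i. gr_bracket G i (c - i) (h i) (k (c - i))) \<in> {1..<c} \<rightarrow> carrier (gr_component G c)"
      if "h \<in> carrier (gr G)" "k \<in> carrier (gr G)" for h k
      using gr_bracket_closed[OF that] by auto
    have "?S c (f \<oplus>\<^sub>g f') g =
      finprod (gr_component G c) (\<lambda>i. gr_bracket G i (c - i) (f i) (g (c - i)) \<otimes>\<^bsub>gr_component G c\<^esub>
        gr_bracket G i (c - i) (f' i) (g (c - i))) {1..<c}"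
      using closed[OF f g] closed[OF f' g] gr_bracket_add(1)[OF f f' g]
      by (intro C.finprod_cong') (auto simp: add_gr gr_component_simps(3)[symmetric])
    then show "?S c (f \<oplus>\<^sub>g f') g = ?S c f g <#> ?S c f' g"
      using C.finprod_multf[OF closed[OF f g] closed[OF f' g]]
      by (simp add: gr_component_simps(3))
    have *: "gr_bracket G i (c - i) (g i) (f (c - i) <#> f' (c - i)) =
        gr_bracket G i (c - i) (g i) (f (c - i)) <#> gr_bracket G i (c - i) (g i) (f' (c - i))"
      if "i \<in> {1..<c}" for i
      using gr_bracket_add(2)[OF f f' g, of "c - i" c] that by force
    have "?S c g (f \<oplus>\<^sub>g f') =
      finprod (gr_component G c) (\<lambda>i. gr_bracket G i (c - i) (g i) (f (c - i)) \<otimes>\<^bsub>gr_component G c\<^esub>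
        gr_bracket G i (c - i) (g i) (f' (c - i))) {1..<c}"
      using closed[OF g f] closed[OF g f'] *
      by (intro C.finprod_cong') (auto simp: add_gr gr_component_simps(3)[symmetric])
    then show "?S c g (f \<oplus>\<^sub>g f') = ?S c g f <#> ?S c g f'"
      using C.finprod_multf[OF closed[OF g f] closed[OF g f']]
      by (simp add: gr_component_simps(3))
  qed
  then show "(f \<oplus>\<^sub>g f') \<otimes>\<^sub>g g = f \<otimes>\<^sub>g g \<oplus>\<^sub>g f' \<otimes>\<^sub>g g"
    "g \<otimes>\<^sub>g (f \<oplus>\<^sub>g f') = g \<otimes>\<^sub>g f \<oplus>\<^sub>g g \<otimes>\<^sub>g f'"
    unfolding mult_gr add_gr[of "restrict _ _"] by (auto intro!: restrict_ext)
qed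

text \<open>In degree \<open>i + j\<close> only the summand with index \<open>i\<close> survives;
  every other one has a neutral factor.\<close>

lemma gr_elem_bracket:
  assumes ij: "1 \<le> i" "1 \<le> j" and ab: "a \<in> \<gamma> i" "b \<in> \<gamma> j"
  shows "gr_elem G i a \<otimes>\<^sub>g gr_elem G j b = gr_elem G (i + j) (group_commutator G a b)"
  unfolding mult_gr gr_elem_def[of G "i + j"]
proof (rule restrict_ext)
  fix c :: nat assume "c \<in> {1..}"
  then have c: "1 \<le> c" by simp
  interpret C: comm_group "gr_component G c" by (rule comm_group_gr_component[OF c])
  let ?t = "\<lambda>k. gr_bracket G k (c - k) (gr_elem G i a k) (gr_elem G j b (c - k))"
  have closed: "?t \<in> {1..<c} \<rightarrow> carrier (gr_component G c)"
    using gr_bracket_closed[OF gr_elem_closed[OF ab(1)] gr_elem_closed[OF ab(2)]] by auto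
  have zero: "?t k = \<one>\<^bsub>gr_component G c\<^esub>" if k: "k \<in> {1..<c}" "k \<noteq> i \<or> c - k \<noteq> j" for k
  proof -
    have k1: "1 \<le> k" "1 \<le> c - k" "k + (c - k) = c" using k(1) by auto
    show ?thesis
    proof (cases "k = i")
      case True
      then have "gr_elem G j b (c - k) = \<gamma> (Suc (c - k))"
        using k k1 by (simp add: gr_elem_def)
      then show ?thesis
        using gr_nth[OF gr_elem_closed[OF ab(1)] k1(1)] gr_bracket_zero(2)[OF k1(1,2)] k1(3)
        by (metis gr_component_simps(2))
    next
      case False
      then have "gr_elem G i a k = \<gamma> (Suc k)"
        using k k1 by (simp add: gr_elem_def)
      then show ?thesis
        using gr_nth[OF gr_elem_closed[OF ab(2)] k1(2)] gr_bracket_zero(1)[OF k1(1,2)] k1(3)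
        by (metis gr_component_simps(2))
    qed
  qed
  show "finprod (gr_component G c) ?t {1..<c} = (if c = i + j
      then \<gamma> (Suc (i + j)) #> group_commutator G a b else \<gamma> (Suc c))"
  proof (cases "c = i + j")
    case True
    have "finprod (gr_component G c) ?t {1..<c} =
        finprod (gr_component G c) (\<lambda>k. if i = k then ?t k else \<one>\<^bsub>gr_component G c\<^esub>) {1..<c}"
      using zero closed by (intro C.finprod_cong') auto
    also have "\<dots> = ?t i"
      using True ij by (intro C.finprod_singleton closed) auto
    also have "\<dots> = \<gamma> (Suc (i + j)) #> group_commutator G a b"
      using True ij gr_bracket_rcos[OF ij ab] by (simp add: gr_elem_def)
    finally show ?thesis using True by simp
  next
    case False
    have "?t k = \<one>\<^bsub>gr_component G c\<^esub>" if "k \<in> {1..<c}" for k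
      by (rule zero[OF that]) (use that False in auto)
    then have "finprod (gr_component G c) ?t {1..<c} = \<one>\<^bsub>gr_component G c\<^esub>"
      by (rule C.finprod_one_eqI)
    then show ?thesis using False by (simp add: gr_component_simps(2))
  qed
qed

lemma gr_elem_conj:
  "\<lbrakk>1 \<le> c; x \<in> \<gamma> c; g \<in> carrier G\<rbrakk> \<Longrightarrow> gr_elem G c (inv g \<otimes> x \<otimes> g) = gr_elem G c x"
  unfolding gr_elem_def by (intro restrict_ext) (simp add: rcos_lower_central_conj del: One_nat_def)

theorem lie_ring_gr: "lie_ring (gr G)"
proof -
  interpret R: abelian_group "gr G" by (rule abelian_group_gr)
  note cl = gr_mult_closed gr_elem_closed
  have mult_zero: "f \<otimes>\<^sub>g \<zero>\<^sub>g = \<zero>\<^sub>g" "\<zero>\<^sub>g \<otimes>\<^sub>g f = \<zero>\<^sub>g"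
    if "f \<in> carrier (gr G)" for f
    using gr_add_mult[of "\<zero>\<^sub>g" "\<zero>\<^sub>g" f] that cl R.add.l_cancel_one
    by simp_all
  have minus_zero: "\<ominus>\<^sub>g \<zero>\<^sub>g = \<zero>\<^sub>g" by (rule R.minus_equality) simp_all
  have minus_mult: "(\<ominus>\<^sub>g f) \<otimes>\<^sub>g g = \<ominus>\<^sub>g (f \<otimes>\<^sub>g g)"
    if "f \<in> carrier (gr G)" "g \<in> carrier (gr G)" for f g
    using gr_add_mult(1)[of "\<ominus>\<^sub>g f" f g] that cl mult_zero
    by (simp add: R.l_neg R.minus_equality)
  have mult_minus: "f \<otimes>\<^sub>g (\<ominus>\<^sub>g g) = \<ominus>\<^sub>g (f \<otimes>\<^sub>g g)"
    if "f \<in> carrier (gr G)" "g \<in> carrier (gr G)" for f g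
    using gr_add_mult(2)[of "\<ominus>\<^sub>g g" g f] that cl mult_zero
    by (simp add: R.l_neg R.minus_equality)
  have elem_anti: "gr_elem G i a \<otimes>\<^sub>g gr_elem G j b = \<ominus>\<^sub>g (gr_elem G j b \<otimes>\<^sub>g gr_elem G i a)"
    if "1 \<le> i" "1 \<le> j" "a \<in> \<gamma> i" "b \<in> \<gamma> j" for i j a b
    using that gr_elem_inv[OF lower_central_commutator[of j i b a]]
    by (simp add: gr_elem_bracket inv_group_commutator add.commute)
  have anti1: "gr_elem G i a \<otimes>\<^sub>g g = \<ominus>\<^sub>g (g \<otimes>\<^sub>g gr_elem G i a)"
    if ia: "1 \<le> i" "a \<in> \<gamma> i" and "g \<in> carrier (gr G)" for i a g
    using that(3)
  proof (induction rule: gr_induct)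
    case zero
    then show ?case using ia by (simp add: mult_zero minus_zero cl)
  next
    case (add c b g)
    then show ?case using ia elem_anti[of i c a b]
      by (simp add: gr_add_mult cl R.minus_add)
  qed
  have anti: "f \<otimes>\<^sub>g g = \<ominus>\<^sub>g (g \<otimes>\<^sub>g f)"
    if "f \<in> carrier (gr G)" and g: "g \<in> carrier (gr G)" for f g
    using that(1)
  proof (induction rule: gr_induct)
    case zero
    then show ?case using g by (simp add: mult_zero minus_zero)
  next
    case (add c a f)
    then show ?case using g anti1[of c a g] by (simp add: gr_add_mult cl R.minus_add)
  qed
  \<comment> \<open>This is more than antisymmetry, which only makes twice the square vanish. The
    square of a homogeneous element is zero because \<open>[a,a] = 1\<close>, and the cross terms
    cancel by antisymmetry.\<close>
  have self: "f \<otimes>\<^sub>g f = \<zero>\<^sub>g" if "f \<in> carrier (gr G)" for f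
    using that
  proof (induction rule: gr_induct)
    case zero
    then show ?case by (simp add: mult_zero)
  next
    case (add c a f)
    have "gr_elem G c a \<otimes>\<^sub>g gr_elem G c a = gr_elem G (c + c) \<one>"
      using add by (simp add: gr_elem_bracket)
    also have "\<dots> = \<zero>\<^sub>g"
      using gr_elem_eq_zero_iff[of \<one> "c + c"] add(1)
        lower_central_one by simp
    finally show ?case
      using add anti[of f "gr_elem G c a"] by (simp add: gr_add_mult cl R.l_neg R.r_neg)
  qed
  \<comment> \<open>The sum is cyclically symmetric, so it is enough to extend additively in the
    first argument and to rotate until all three arguments are arbitrary.\<close>
  define Jac where "Jac = (\<lambda>x y z. x \<otimes>\<^sub>g (y \<otimes>\<^sub>g z) \<oplus>\<^sub>g y \<otimes>\<^sub>g (z \<otimes>\<^sub>g x)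
    \<oplus>\<^sub>g z \<otimes>\<^sub>g (x \<otimes>\<^sub>g y))"
  have Jac_cyc: "Jac x y z = Jac y z x"
    if "x \<in> carrier (gr G)" "y \<in> carrier (gr G)" "z \<in> carrier (gr G)" for x y z
    using that by (simp add: Jac_def cl R.a_ac)
  have Jac_zero: "Jac \<zero>\<^sub>g y z = \<zero>\<^sub>g"
    if "y \<in> carrier (gr G)" "z \<in> carrier (gr G)" for y z
    using that by (simp add: Jac_def cl mult_zero)
  have Jac_add: "Jac (x \<oplus>\<^sub>g x') y z = Jac x y z \<oplus>\<^sub>g Jac x' y z"
    if "x \<in> carrier (gr G)" "x' \<in> carrier (gr G)" "y \<in> carrier (gr G)" "z \<in> carrier (gr G)" for x x' y z
    using that by (simp add: Jac_def cl gr_add_mult R.a_ac)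
  have Jac_elem: "Jac (gr_elem G i a) (gr_elem G j b) (gr_elem G k c) = \<zero>\<^sub>g"
    if 1: "1 \<le> i" "1 \<le> j" "1 \<le> k" and abc: "a \<in> \<gamma> i" "b \<in> \<gamma> j"
      "c \<in> \<gamma> k" for i j k a b c
  proof -
    have car: "a \<in> carrier G" "b \<in> carrier G" "c \<in> carrier G" using abc by auto
    note inv = lower_central_inv
    \<comment> \<open>Conjugation is invisible in the graded ring. The inverse in the inner
      commutator contributes one sign and the exchange of the outer factors another, so the class of
      each Hall-Witt factor is a summand of the Jacobi identity.\<close>
    have HW_term: "gr_elem G (p + q + r) (inv y \<otimes> group_commutator G (group_commutator G x (inv y)) z \<otimes> y)
          = gr_elem G r z \<otimes>\<^sub>g (gr_elem G p x \<otimes>\<^sub>g gr_elem G q y)"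
        and in_lc: "inv y \<otimes> group_commutator G (group_commutator G x (inv y)) z \<otimes> y \<in> \<gamma> (p + q + r)"
      if "1 \<le> p" "1 \<le> q" "1 \<le> r" and xyz: "x \<in> \<gamma> p" "y \<in> \<gamma> q"
        "z \<in> \<gamma> r" for p q r x y z
    proof -
      have in1: "group_commutator G x (inv y) \<in> \<gamma> (p + q)"
        using that inv by (intro lower_central_commutator)
      have in2: "group_commutator G (group_commutator G x (inv y)) z \<in> \<gamma> (p + q + r)"
        using that by (intro lower_central_commutator[OF _ _ in1]) auto
      show "inv y \<otimes> group_commutator G (group_commutator G x (inv y)) z \<otimes> y \<in> \<gamma> (p + q + r)"
        using in2 xyz normal.inv_op_closed1[OF normal_lower_central] by simp
      have "gr_elem G (p + q + r) (inv y \<otimes> group_commutator G (group_commutator G x (inv y)) z \<otimes> y)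
          = gr_elem G (p + q) (group_commutator G x (inv y)) \<otimes>\<^sub>g gr_elem G r z"
        using that in1 in2 by (simp add: gr_elem_conj gr_elem_bracket)
      also have "gr_elem G (p + q) (group_commutator G x (inv y)) =
          \<ominus>\<^sub>g (gr_elem G p x \<otimes>\<^sub>g gr_elem G q y)"
        using that by (simp add: gr_elem_bracket[symmetric] inv gr_elem_inv mult_minus cl)
      also have "\<dots> \<otimes>\<^sub>g gr_elem G r z = gr_elem G r z \<otimes>\<^sub>g (gr_elem G p x \<otimes>\<^sub>g gr_elem G q y)"
        using xyz anti[of "gr_elem G r z" "gr_elem G p x \<otimes>\<^sub>g gr_elem G q y"]
        by (simp add: minus_mult cl)
      finally show "gr_elem G (p + q + r) (inv y \<otimes> group_commutator G (group_commutator G x (inv y)) z \<otimes> y)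
          = gr_elem G r z \<otimes>\<^sub>g (gr_elem G p x \<otimes>\<^sub>g gr_elem G q y)" .
    qed
    let ?s = "i + j + k"
    define A where "A = inv b \<otimes> group_commutator G (group_commutator G a (inv b)) c \<otimes> b"
    define B where "B = inv c \<otimes> group_commutator G (group_commutator G b (inv c)) a \<otimes> c"
    define C where "C = inv a \<otimes> group_commutator G (group_commutator G c (inv a)) b \<otimes> a"
    have perm: "j + k + i = ?s" "k + i + j = ?s" by simp_all
    have mem: "A \<in> \<gamma> ?s" "B \<in> \<gamma> ?s" "C \<in> \<gamma> ?s"
      using in_lc[OF 1(1,2,3) abc(1,2,3)] in_lc[OF 1(2,3,1) abc(2,3,1)] in_lc[OF 1(3,1,2) abc(3,1,2)]
      unfolding A_def B_def C_def perm .
    have eq: "gr_elem G ?s A = gr_elem G k c \<otimes>\<^sub>g (gr_elem G i a \<otimes>\<^sub>g gr_elem G j b)"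
      "gr_elem G ?s B = gr_elem G i a \<otimes>\<^sub>g (gr_elem G j b \<otimes>\<^sub>g gr_elem G k c)"
      "gr_elem G ?s C = gr_elem G j b \<otimes>\<^sub>g (gr_elem G k c \<otimes>\<^sub>g gr_elem G i a)"
      using HW_term[OF 1(1,2,3) abc(1,2,3)] HW_term[OF 1(2,3,1) abc(2,3,1)] HW_term[OF 1(3,1,2) abc(3,1,2)]
      unfolding A_def B_def C_def perm .
    have "A \<otimes> B \<otimes> C = \<one>" unfolding A_def B_def C_def by (rule Hall_Witt[OF car])
    moreover have "A \<otimes> B \<in> \<gamma> ?s"
      using mem lower_central_mult by auto
    moreover have "gr_elem G ?s \<one> = \<zero>\<^sub>g"
      using gr_elem_eq_zero_iff[of \<one> ?s] 1
        lower_central_one by simp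
    ultimately have "gr_elem G ?s A \<oplus>\<^sub>g gr_elem G ?s B \<oplus>\<^sub>g gr_elem G ?s C = \<zero>\<^sub>g"
      using mem by (simp add: gr_elem_mult[symmetric])
    then show ?thesis unfolding Jac_def eq using abc by (simp add: cl R.a_ac)
  qed
  have Jac1: "Jac x (gr_elem G j b) (gr_elem G k c) = \<zero>\<^sub>g"
    if "x \<in> carrier (gr G)" and *: "1 \<le> j" "1 \<le> k" "b \<in> \<gamma> j" "c \<in> \<gamma> k" for x j k b c
    using that(1) by (induction rule: gr_induct) (use * in \<open>simp_all add: Jac_zero Jac_add cl Jac_elem\<close>)
  have Jac2: "Jac x y (gr_elem G k c) = \<zero>\<^sub>g"
    if "y \<in> carrier (gr G)" and *: "x \<in> carrier (gr G)" "1 \<le> k" "c \<in> \<gamma> k" for x y k c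
  proof -
    have "Jac y (gr_elem G k c) x = \<zero>\<^sub>g"
      using that(1)
    proof (induction rule: gr_induct)
      case (add i b y)
      have "Jac (gr_elem G i b) (gr_elem G k c) x = Jac x (gr_elem G i b) (gr_elem G k c)"
        using Jac_cyc[of x "gr_elem G i b" "gr_elem G k c"] add * by (simp add: cl)
      then show ?case using add * Jac1 by (simp add: Jac_add cl)
    qed (use * in \<open>simp add: Jac_zero cl\<close>)
    then show ?thesis using Jac_cyc[of x y "gr_elem G k c"] that by (simp add: cl)
  qed
  have Jac3: "Jac x y z = \<zero>\<^sub>g"
    if "z \<in> carrier (gr G)" and *: "x \<in> carrier (gr G)" "y \<in> carrier (gr G)" for x y z
  proof -
    have "Jac z x y = \<zero>\<^sub>g"
      using that(1)
    proof (induction rule: gr_induct)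
      case (add i b z)
      have "Jac (gr_elem G i b) x y = Jac x y (gr_elem G i b)"
        using Jac_cyc[of "gr_elem G i b" x y] add * by (simp add: cl)
      then show ?case using add * Jac2 by (simp add: Jac_add cl)
    qed (use * in \<open>simp add: Jac_zero cl\<close>)
    then show ?thesis using Jac_cyc[of z x y] that by simp
  qed
  show ?thesis
    by unfold_locales (use cl gr_add_mult self Jac3 in \<open>simp_all add: Jac_def\<close>)
qed

end

section \<open>The Magnus expansion\<close>

text \<open>The second clause is the geometric series \<open>1 - X + X^2 - ...\<close>, the inverse
  of \<open>1 + X\<close>.\<close>

fun magnus_letter :: "'a \<times> bool \<Rightarrow> 'a ncs" where
  "magnus_letter (x, True) = 1 + ncs_var x"
| "magnus_letter (x, False) = Ncs (\<lambda>w. if set w \<subseteq> {x} then (- 1) ^ length w else 0)"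

definition magnus :: "('a \<times> bool) list \<Rightarrow> 'a ncs" where
  "magnus w = foldr (\<lambda>a s. magnus_letter a * s) w 1"

lemma magnus_letter_inverse: "magnus_letter a * magnus_letter (inv_letter a) = 1"
proof -
  obtain x e where a: "a = (x, e)" by (cases a)
  let ?p = "magnus_letter (x, True)" and ?q = "magnus_letter (x, False)"
  have q: "coeff ?q w = (if set w \<subseteq> {x} then (- 1) ^ length w else 0)" for w
    by (simp add: Ncs_inverse)
  have "?p * ?q = ?q + ncs_var x * ?q" "?q * ?p = ?q + ?q * ncs_var x"
    by (simp_all add: algebra_simps)
  moreover have "coeff (?q + ncs_var x * ?q) w = coeff 1 w" for w
    by (cases w) (auto simp: coeff_simps(1-5) coeff_var_mult q simp del: magnus_letter.simps)
  moreover have "coeff (?q + ?q * ncs_var x) w = coeff 1 w" for w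
    by (cases w rule: rev_cases) (auto simp: coeff_simps(1-5) coeff_mult_var q simp del: magnus_letter.simps)
  ultimately have "?p * ?q = 1" "?q * ?p = 1" by (auto intro: ncs_eqI)
  then show ?thesis using a by (cases e) auto
qed

lemma magnus_prepend: "magnus (prepend a w) = magnus_letter a * magnus w"
proof (cases w)
  case (Cons b v)
  then show ?thesis
    using magnus_letter_inverse[of a] by (auto simp: magnus_def mult.assoc[symmetric])
qed (simp add: magnus_def)

lemma magnus_mult: "magnus (u \<otimes>\<^bsub>free_group X\<^esub> v) = magnus u * magnus v"
proof -
  have "magnus (foldr prepend u v) = magnus u * magnus v"
    by (induction u) (auto simp: magnus_prepend, auto simp: magnus_def mult.assoc)
  then show ?thesis by (simp add: free_group_def)
qed

lemma magnus_one: "magnus \<one>\<^bsub>free_group X\<^esub> = 1"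
  by (simp add: free_group_def magnus_def)

lemma magnus_gen: "magnus (free_gen x) = 1 + ncs_var x"
  by (simp add: free_gen_def magnus_def)

lemma magnus_inv:
  assumes "w \<in> carrier (free_group X)"
  shows "magnus (inv\<^bsub>free_group X\<^esub> w) * magnus w = 1" "magnus w * magnus (inv\<^bsub>free_group X\<^esub> w) = 1"
proof -
  interpret group "free_group X" by (rule group_free_group)
  show "magnus (inv\<^bsub>free_group X\<^esub> w) * magnus w = 1" "magnus w * magnus (inv\<^bsub>free_group X\<^esub> w) = 1"
    using assms by (simp_all add: magnus_mult[where X = X, symmetric] magnus_one)
qed

lemma ord_ge_magnus: "ord_ge (Suc 0) (magnus w - 1)"
proof (induction w)
  case (Cons a w)
  obtain x e where a: "a = (x, e)" by (cases a)
  have "ord_ge (Suc 0) (magnus_letter a - 1)"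
    by (cases e) (auto simp: a ord_ge_def coeff_simps(1-5) coeff_var Ncs_inverse)
  then have "ord_ge (Suc 0) ((magnus_letter a - 1) * magnus w + (magnus w - 1))"
    using Cons by (intro ord_ge_add ord_ge_mult[of "Suc 0" _ 0]) auto
  then show ?case by (simp add: magnus_def algebra_simps)
qed (simp add: magnus_def)

text \<open>The commutator is the inverse of \<open>b a\<close> followed by \<open>a b\<close>, so
  subtracting 1 leaves \<open>a b - b a\<close> with a unit in front, and the constant terms drop
  out of this difference.\<close>

lemma magnus_commutator:
  assumes "a \<in> carrier (free_group X)" "b \<in> carrier (free_group X)"
  shows "magnus (group_commutator (free_group X) a b) - 1 =
    magnus (inv\<^bsub>free_group X\<^esub> a \<otimes>\<^bsub>free_group X\<^esub> inv\<^bsub>free_group X\<^esub> b) *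
      ((magnus a - 1) * (magnus b - 1) - (magnus b - 1) * (magnus a - 1))"
proof -
  let ?a = "magnus (inv\<^bsub>free_group X\<^esub> a)" and ?b = "magnus (inv\<^bsub>free_group X\<^esub> b)"
  have "?a * ?b * (magnus b * magnus a) = ?a * (?b * magnus b) * magnus a"
    by (simp only: mult.assoc)
  also have "\<dots> = 1" using magnus_inv[OF assms(1)] magnus_inv[OF assms(2)] by simp
  finally have "?a * ?b * (magnus b * magnus a) = 1" .
  moreover have "(magnus a - 1) * (magnus b - 1) - (magnus b - 1) * (magnus a - 1) =
      magnus a * magnus b - magnus b * magnus a"
    by (simp add: algebra_simps)
  ultimately show ?thesis
    by (simp add: group_commutator_def magnus_mult right_diff_distrib mult.assoc)
qed

text \<open>The elementary half of Magnus's description of the lower central series: by the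
  commutator formula every further commutator brings in a factor of order at least 1.\<close>

lemma ord_ge_magnus_lower_central:
  assumes "a \<in> lower_central (free_group X) c"
  shows "ord_ge c (magnus a - 1)"
  using assms
proof (induction c arbitrary: a)
  case (Suc c)
  interpret group "free_group X" by (rule group_free_group)
  show ?case
  proof (cases c)
    case 0
    then show ?thesis using ord_ge_magnus by simp
  next
    case c: (Suc d)
    let ?S = "{group_commutator (free_group X) a b |a b.
      a \<in> lower_central (free_group X) c \<and> b \<in> carrier (free_group X)}"
    have comm: "h \<in> carrier (free_group X)" "ord_ge (Suc c) (magnus h - 1)" if hS: "h \<in> ?S" for h
    proof -
      obtain a b where ab: "a \<in> lower_central (free_group X) c" "b \<in> carrier (free_group X)"
        and h: "h = group_commutator (free_group X) a b" using hS by blast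
      then show "h \<in> carrier (free_group X)" by simp
      have "ord_ge (Suc c) ((magnus a - 1) * (magnus b - 1) - (magnus b - 1) * (magnus a - 1))"
        by (rule ord_ge_diff[OF ord_ge_mult[OF Suc.IH[OF ab(1)] ord_ge_magnus]
              ord_ge_mult[OF ord_ge_magnus Suc.IH[OF ab(1)]]]) simp_all
      then show "ord_ge (Suc c) (magnus h - 1)"
        using ab unfolding h by (auto simp: magnus_commutator intro: ord_ge_mult[of 0])
    qed
    have "a \<in> generate (free_group X) ?S" using Suc.prems unfolding c lower_central.simps .
    then show ?thesis
    proof (induction rule: generate.induct)
      case one
      then show ?case by (simp add: magnus_one)
    next
      case (incl h)
      then show ?case by (rule comm)
    next
      case (inv h)
      have "magnus (inv\<^bsub>free_group X\<^esub> h) - 1 = - (magnus (inv\<^bsub>free_group X\<^esub> h) * (magnus h - 1))"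
        using magnus_inv(1)[OF comm(1)[OF inv]] by (simp add: algebra_simps)
      then show ?case
        using ord_ge_uminus[OF ord_ge_mult[OF ord_ge_0(1) comm(2)[OF inv], of "Suc c"]] by simp
    next
      case (eng g h)
      have eq: "magnus (g \<otimes>\<^bsub>free_group X\<^esub> h) - 1 = (magnus g - 1) * magnus h + (magnus h - 1)"
        by (simp add: magnus_mult algebra_simps)
      show ?case unfolding eq
        by (rule ord_ge_add[OF ord_ge_mult[OF eng.IH(1) ord_ge_0(1)] eng.IH(2)]) simp
    qed
  qed
qed simp

text \<open>\<open>P\<close> and \<open>Q\<close> stand for the leading parts of \<open>a\<close>
  and \<open>b\<close>, possibly zero. Replacing both factors by their leading parts, and the unit
  in front by 1, costs only terms of order at least \<open>c + d + 1\<close>.\<close>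

lemma magnus_commutator_leading:
  assumes ab: "a \<in> carrier (free_group X)" "b \<in> carrier (free_group X)"
    and P: "ord_ge c P" "ord_ge (Suc c) (magnus a - 1 - P)"
    and Q: "ord_ge d Q" "ord_ge (Suc d) (magnus b - 1 - Q)"
  shows "ord_ge (Suc (c + d)) (magnus (group_commutator (free_group X) a b) - 1 - (P * Q - Q * P))"
proof -
  let ?A = "magnus a - 1" and ?B = "magnus b - 1"
  let ?D = "?A * ?B - ?B * ?A"
  let ?U = "magnus (inv\<^bsub>free_group X\<^esub> a \<otimes>\<^bsub>free_group X\<^esub> inv\<^bsub>free_group X\<^esub> b)"
  have A: "ord_ge c ?A" using ord_ge_add[OF P(1) ord_ge_mono[OF P(2)]] by simp
  have B: "ord_ge d ?B" using ord_ge_add[OF Q(1) ord_ge_mono[OF Q(2)]] by simp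
  have "?D - (P * Q - Q * P) = ((?A - P) * ?B + P * (?B - Q)) - ((?B - Q) * ?A + Q * (?A - P))"
    by (simp add: algebra_simps)
  also have "ord_ge (Suc (c + d)) \<dots>"
    using A B P Q
    by (intro ord_ge_diff ord_ge_add) (auto intro: ord_ge_mult[of "Suc c" _ d] ord_ge_mult[of c _ "Suc d"]
      ord_ge_mult[of d _ "Suc c"] ord_ge_mult[of "Suc d" _ c])
  finally have 1: "ord_ge (Suc (c + d)) (?D - (P * Q - Q * P))" .
  have "ord_ge (c + d) ?D"
    using A B by (intro ord_ge_diff) (auto intro: ord_ge_mult[of c _ d] ord_ge_mult[of d _ c])
  then have 2: "ord_ge (Suc (c + d)) ((?U - 1) * ?D)"
    by (rule ord_ge_mult[OF ord_ge_magnus]) simp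
  have "magnus (group_commutator (free_group X) a b) - 1 = ?U * ?D"
    by (rule magnus_commutator[OF ab])
  then have "magnus (group_commutator (free_group X) a b) - 1 - (P * Q - Q * P) =
      (?U - 1) * ?D + (?D - (P * Q - Q * P))"
    by (simp only: left_diff_distrib mult_1) simp
  then show ?thesis using ord_ge_add[OF 2 1] by (simp only:)
qed

lemma free_group_generate: "carrier (free_group X) = generate (free_group X) (free_gen ` X)"
proof
  interpret group "free_group X" by (rule group_free_group)
  show "generate (free_group X) (free_gen ` X) \<subseteq> carrier (free_group X)"
    using generate_in_carrier[of "free_gen ` X"] free_gen_in_carrier by fastforce
  show "carrier (free_group X) \<subseteq> generate (free_group X) (free_gen ` X)"
  proof
    fix w assume "w \<in> carrier (free_group X)"
    then show "w \<in> generate (free_group X) (free_gen ` X)"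
    proof (induction w)
      case Nil
      then show ?case using generate.one[of "free_group X" "free_gen ` X"] by (simp add: free_group_def)
    next
      case (Cons a w)
      obtain x e where a: "a = (x, e)" by (cases a)
      have x: "x \<in> X" and w: "w \<in> carrier (free_group X)" and
        aw: "a # w = [a] \<otimes>\<^bsub>free_group X\<^esub> w"
        using Cons.prems a by (cases w; auto simp: free_group_def)+
      have "[(x, False)] = inv\<^bsub>free_group X\<^esub> free_gen x"
        by (rule inv_equality[symmetric])
          (use x in \<open>auto simp: free_group_def free_gen_def\<close>)
      then have "[a] \<in> generate (free_group X) (free_gen ` X)"
        using x a generate.incl[of "free_gen x" "free_gen ` X" "free_group X"]
          generate.inv[of "free_gen x" "free_gen ` X" "free_group X"]
        by (cases e) (auto simp: free_gen_def)
      then show ?case unfolding aw using Cons.IH[OF w] by (rule generate.eng)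
    qed
  qed
qed

section \<open>The Andreadakis filtration\<close>

lemma hom_group_commutator:
  assumes "group_hom G H h" "a \<in> carrier G" "b \<in> carrier G"
  shows "h (group_commutator G a b) = group_commutator H (h a) (h b)"
proof -
  interpret group_hom G H h by fact
  show ?thesis using assms(2,3) by (simp add: group_commutator_def)
qed

lemma hom_lower_central:
  assumes "group_hom G H h" "x \<in> lower_central G c"
  shows "h x \<in> lower_central H c"
  using assms(2)
proof (induction c arbitrary: x)
  case 0
  then show ?case using group_hom.hom_closed[OF assms(1)] by simp
next
  case (Suc c)
  interpret group_hom G H h by fact
  show ?case
  proof (cases c)
    case 0
    then show ?thesis using Suc.prems by simp
  next
    case c: (Suc d)
    interpret N: subgroup "lower_central H (Suc c)" H
      by (rule normal_imp_subgroup[OF H.normal_lower_central])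
    have comm: "h y \<in> lower_central H (Suc c)" "y \<in> carrier G"
      if yS: "y \<in> {group_commutator G a b |a b. a \<in> lower_central G c \<and> b \<in> carrier G}" for y
    proof -
      obtain a b where ab: "a \<in> lower_central G c" "b \<in> carrier G" "y = group_commutator G a b"
        using yS by blast
      then show "y \<in> carrier G" by simp
      show "h y \<in> lower_central H (Suc c)"
        using H.lower_central_commutator_Suc[OF Suc.IH[OF ab(1)], of "h b"] ab c
          hom_group_commutator[OF assms(1), of a b]
        by (simp del: lower_central.simps)
    qed
    have "x \<in> generate G {group_commutator G a b |a b. a \<in> lower_central G c \<and> b \<in> carrier G}"
      using Suc.prems unfolding c lower_central.simps .
    then show ?thesis
    proof (induction rule: generate.induct)
      case (eng y z)
      have "{group_commutator G a b |a b. a \<in> lower_central G c \<and> b \<in> carrier G} \<subseteq> carrier G"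
        using comm(2) by (rule subsetI)
      then have "y \<in> carrier G" "z \<in> carrier G"
        using G.generate_in_carrier eng.hyps by simp_all
      then show ?case using eng.IH by (simp only: hom_mult N.m_closed)
    next
      case one
      show ?case by (simp only: hom_one N.one_closed)
    next
      case (incl y)
      then show ?case by (rule comm(1))
    next
      case (inv y)
      then show ?case by (simp only: hom_inv[OF comm(2)] N.m_inv_closed[OF comm(1)])
    qed
  qed
qed

context group
begin

lemma AutoGroup_simps:
  assumes "a \<in> carrier (AutoGroup G)"
  shows "group_hom G G a" "w \<in> carrier G \<Longrightarrow> a w \<in> carrier G"
    "b \<in> carrier (AutoGroup G) \<Longrightarrow> w \<in> carrier G \<Longrightarrow> (a \<otimes>\<^bsub>AutoGroup G\<^esub> b) w = a (b w)"
    "w \<in> carrier G \<Longrightarrow> (inv\<^bsub>AutoGroup G\<^esub> a) (a w) = w"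
    "w \<in> carrier G \<Longrightarrow> a ((inv\<^bsub>AutoGroup G\<^esub> a) w) = w"
    "w \<in> carrier G \<Longrightarrow> \<one>\<^bsub>AutoGroup G\<^esub> w = w"
proof -
  interpret A: group "AutoGroup G" by (rule AutoGroup)
  have hom: "group_hom G G c" if "c \<in> carrier (AutoGroup G)" for c
    using that by (intro group_hom.intro group_hom_axioms.intro is_group)
      (auto simp: AutoGroup_def auto_def)
  have mult: "(b \<otimes>\<^bsub>AutoGroup G\<^esub> c) w = b (c w)"
    if "b \<in> carrier (AutoGroup G)" "c \<in> carrier (AutoGroup G)" "w \<in> carrier G" for b c w
    using that by (simp add: AutoGroup_def BijGroup_def auto_def compose_def)
  have one: "\<one>\<^bsub>AutoGroup G\<^esub> w = w" if "w \<in> carrier G" for w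
    using that by (simp add: AutoGroup_def BijGroup_def)
  show "group_hom G G a" using hom assms .
  show "w \<in> carrier G \<Longrightarrow> a w \<in> carrier G" using group_hom.hom_closed[OF hom[OF assms]] .
  show "b \<in> carrier (AutoGroup G) \<Longrightarrow> w \<in> carrier G \<Longrightarrow> (a \<otimes>\<^bsub>AutoGroup G\<^esub> b) w = a (b w)"
    using mult assms by blast
  show "w \<in> carrier G \<Longrightarrow> (inv\<^bsub>AutoGroup G\<^esub> a) (a w) = w"
    using mult[of "inv\<^bsub>AutoGroup G\<^esub> a" a w] assms by (simp add: one)
  show "w \<in> carrier G \<Longrightarrow> a ((inv\<^bsub>AutoGroup G\<^esub> a) w) = w"
    using mult[of a "inv\<^bsub>AutoGroup G\<^esub> a" w] assms by (simp add: one)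
  show "w \<in> carrier G \<Longrightarrow> \<one>\<^bsub>AutoGroup G\<^esub> w = w" by (rule one)
qed

text \<open>The classical condition asks for trivial action on the quotient by one lower central
  term, which is the case \<open>k = 1\<close>. Requiring a shift by \<open>c\<close> on every term
  turns products, inverses and commutators into direct computations with displacements.\<close>

definition andreadakis :: "nat \<Rightarrow> ('a \<Rightarrow> 'a) set" where
  "andreadakis c = {a \<in> carrier (AutoGroup G).
     \<forall>k\<ge>1. \<forall>w\<in>\<gamma> k. a w \<otimes> inv w \<in> \<gamma> (k + c)}"

lemma andreadakisE:
  assumes "a \<in> andreadakis c" "w \<in> \<gamma> k" "1 \<le> k"
  obtains u where "u \<in> \<gamma> (k + c)" "a w = u \<otimes> w"
proof (rule that)
  have w: "w \<in> carrier G" "a w \<in> carrier G"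
    using assms AutoGroup_simps(2) by (auto simp: andreadakis_def)
  show "a w \<otimes> inv w \<in> \<gamma> (k + c)" using assms by (auto simp: andreadakis_def)
  show "a w = a w \<otimes> inv w \<otimes> w" using w by (simp add: m_assoc)
qed

lemma subgroup_andreadakis: "subgroup (andreadakis c) (AutoGroup G)"
proof -
  interpret A: group "AutoGroup G" by (rule AutoGroup)
  note sub = normal_imp_subgroup[OF normal_lower_central]
  show ?thesis
  proof (rule A.subgroupI)
    show "andreadakis c \<subseteq> carrier (AutoGroup G)" by (auto simp: andreadakis_def)
    have "\<one>\<^bsub>AutoGroup G\<^esub> \<in> andreadakis c"
      using subgroup.one_closed[OF sub] by (auto simp: andreadakis_def AutoGroup_simps(6)[OF A.one_closed])
    then show "andreadakis c \<noteq> {}" by blast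
  next
    fix a assume a: "a \<in> andreadakis c"
    then have ac: "a \<in> carrier (AutoGroup G)" by (auto simp: andreadakis_def)
    have "(inv\<^bsub>AutoGroup G\<^esub> a) w \<otimes> inv w \<in> \<gamma> (k + c)"
      if k: "1 \<le> k" and w: "w \<in> \<gamma> k" for k w
    proof -
      define v where "v = (inv\<^bsub>AutoGroup G\<^esub> a) w"
      have v: "v \<in> \<gamma> k" unfolding v_def
        using hom_lower_central[OF AutoGroup_simps(1) w] ac by simp
      have av: "a v = w" unfolding v_def using AutoGroup_simps(5)[OF ac] w by simp
      obtain u where u: "u \<in> \<gamma> (k + c)" "w = u \<otimes> v"
        using andreadakisE[OF a v k] av by metis
      have "v \<otimes> inv w = inv u" using u v by (simp add: inv_mult_group m_assoc[symmetric])
      then show ?thesis using subgroup.m_inv_closed[OF sub u(1)] by (simp add: v_def)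
    qed
    then show "inv\<^bsub>AutoGroup G\<^esub> a \<in> andreadakis c" using ac by (simp add: andreadakis_def)
  next
    fix a b assume ab: "a \<in> andreadakis c" "b \<in> andreadakis c"
    then have ac: "a \<in> carrier (AutoGroup G)" "b \<in> carrier (AutoGroup G)" by (auto simp: andreadakis_def)
    interpret a: group_hom G G a by (rule AutoGroup_simps(1)[OF ac(1)])
    have "(a \<otimes>\<^bsub>AutoGroup G\<^esub> b) w \<otimes> inv w \<in> \<gamma> (k + c)"
      if k: "1 \<le> k" and w: "w \<in> \<gamma> k" for k w
    proof -
      obtain v where v: "v \<in> \<gamma> (k + c)" "b w = v \<otimes> w" using andreadakisE[OF ab(2) w k] .
      obtain u where u: "u \<in> \<gamma> (k + c)" "a w = u \<otimes> w" using andreadakisE[OF ab(1) w k] .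
      have c: "u \<in> carrier G" "v \<in> carrier G" "w \<in> carrier G" using u v w by auto
      have "(a \<otimes>\<^bsub>AutoGroup G\<^esub> b) w \<otimes> inv w = a v \<otimes> u"
        using c ac u(2) v(2) by (simp add: AutoGroup_simps(3) m_assoc)
      then show ?thesis
        using subgroup.m_closed[OF sub hom_lower_central[OF a.group_hom_axioms v(1)] u(1)] by simp
    qed
    then show "a \<otimes>\<^bsub>AutoGroup G\<^esub> b \<in> andreadakis c" using ac by (simp add: andreadakis_def)
  qed
qed

text \<open>If \<open>a w = u w\<close> and \<open>b w = v w\<close>, then \<open>a (b w)\<close>
  and \<open>b (a w)\<close> are \<open>v u w\<close> and \<open>u v w\<close> up to factors of the
  required depth, and \<open>v u\<close> and \<open>u v\<close> differ by a commutator of that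
  depth. The inverse of \<open>b a\<close> preserves lower central terms and turns this comparison
  into the displacement of \<open>w\<close> under the commutator.\<close>

lemma andreadakis_commutator:
  assumes a: "a \<in> andreadakis c" and b: "b \<in> andreadakis (Suc 0)"
  shows "group_commutator (AutoGroup G) a b \<in> andreadakis (Suc c)"
proof -
  interpret A: group "AutoGroup G" by (rule AutoGroup)
  have ac: "a \<in> carrier (AutoGroup G)" "b \<in> carrier (AutoGroup G)"
    using a b by (auto simp: andreadakis_def)
  let ?z = "group_commutator (AutoGroup G) a b"
  have z: "?z \<in> carrier (AutoGroup G)" using ac by simp
  have ba: "b \<otimes>\<^bsub>AutoGroup G\<^esub> a \<in> carrier (AutoGroup G)" using ac by simp
  define i where "i = inv\<^bsub>AutoGroup G\<^esub> (b \<otimes>\<^bsub>AutoGroup G\<^esub> a)"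
  have ic: "i \<in> carrier (AutoGroup G)" using ba by (simp add: i_def)
  have ziab: "?z = i \<otimes>\<^bsub>AutoGroup G\<^esub> (a \<otimes>\<^bsub>AutoGroup G\<^esub> b)"
    using ac by (simp add: i_def A.group_word_simps)
  interpret a: group_hom G G a by (rule AutoGroup_simps(1)[OF ac(1)])
  interpret b: group_hom G G b by (rule AutoGroup_simps(1)[OF ac(2)])
  interpret i: group_hom G G i by (rule AutoGroup_simps(1)[OF ic])
  have "?z w \<otimes> inv w \<in> \<gamma> (k + Suc c)"
    if k: "1 \<le> k" and w: "w \<in> \<gamma> k" for k w
  proof -
    define N where "N = \<gamma> (k + Suc c)"
    interpret N: normal N G unfolding N_def by (rule normal_lower_central)
    obtain u where u: "u \<in> \<gamma> (k + c)" "a w = u \<otimes> w" using andreadakisE[OF a w k] .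
    obtain v where v: "v \<in> \<gamma> (k + 1)" "b w = v \<otimes> w" using andreadakisE[OF b w k] by auto
    obtain u' where u': "u' \<in> N" "b u = u' \<otimes> u"
      using andreadakisE[OF b u(1)] k unfolding N_def by auto
    obtain v' where v': "v' \<in> \<gamma> (k + 1 + c)" "a v = v' \<otimes> v"
      using andreadakisE[OF a v(1)] k by auto
    have v'N: "v' \<in> N" using v'(1) by (simp add: N_def)
    have car: "u \<in> carrier G" "v \<in> carrier G" "w \<in> carrier G" "u' \<in> carrier G" "v' \<in> carrier G"
      using u v w u' v' N.mem_carrier by auto
    have comm: "group_commutator G u v \<in> N"
      using lower_central_commutator_Suc[OF u(1) car(2)] k by (simp add: N_def)
    have uv: "group_commutator G (inv v) (inv u) \<in> N"
    proof -
      have "u \<otimes> v \<otimes> inv (group_commutator G u v) \<otimes> inv (u \<otimes> v) \<in> N"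
        using car by (intro N.inv_op_closed2 N.m_inv_closed comm) simp
      moreover have "u \<otimes> v \<otimes> inv (group_commutator G u v) \<otimes> inv (u \<otimes> v) = v \<otimes> u \<otimes> inv v \<otimes> inv u"
        using car by (simp add: group_word_simps)
      moreover have "group_commutator G (inv v) (inv u) = v \<otimes> u \<otimes> inv v \<otimes> inv u"
        using car by (simp add: group_word_simps)
      ultimately show ?thesis by simp
    qed
    have "a (b w) = v' \<otimes> v \<otimes> u \<otimes> w" "b (a w) = u' \<otimes> u \<otimes> v \<otimes> w"
      using car u v u' v' by (simp_all add: m_assoc)
    then have eq: "a (b w) \<otimes> inv (b (a w)) = v' \<otimes> group_commutator G (inv v) (inv u) \<otimes> inv u'"
      using car by (simp add: group_word_simps)
    have "a (b w) \<otimes> inv (b (a w)) \<in> N"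
      unfolding eq using v'N uv u'(1) by simp
    then have "i (a (b w) \<otimes> inv (b (a w))) \<in> N"
      unfolding N_def by (rule hom_lower_central[OF i.group_hom_axioms])
    also have "i (a (b w) \<otimes> inv (b (a w))) = ?z w \<otimes> inv w"
    proof -
      have "i (b (a w)) = w"
        using AutoGroup_simps(4)[OF ba, of w] ac car by (simp add: i_def AutoGroup_simps(3))
      moreover have "?z w = i (a (b w))"
        unfolding ziab using AutoGroup_simps(3) ac ic car by simp
      ultimately show ?thesis using car by simp
    qed
    finally show ?thesis by (simp add: N_def)
  qed
  then show ?thesis using z by (simp add: andreadakis_def)
qed

lemma gr_elem_eq_iff:
  assumes "a \<in> \<gamma> c" "b \<in> \<gamma> c" "1 \<le> c"
  shows "gr_elem G c a = gr_elem G c b \<longleftrightarrow> a \<otimes> inv b \<in> \<gamma> (Suc c)"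
proof -
  have "gr_elem G c a = gr_elem G c b \<longleftrightarrow> \<gamma> (Suc c) #> a = \<gamma> (Suc c) #> b"
    using assms(3) by (auto simp: gr_elem_def fun_eq_iff dest: spec[of _ c])
  then show ?thesis using assms by (simp add: rcos_eq_iff normal_lower_central)
qed

text \<open>The graded ring is generated in degree 1: the class of \<open>[u,v]\<close> is the
  bracket of the classes of \<open>u\<close> and \<open>v\<close>, so an automorphism that fixes all
  classes of degree 1 fixes the classes of every degree.\<close>

lemma andreadakis_1I:
  assumes a: "a \<in> carrier (AutoGroup G)"
    and ab: "\<And>w. w \<in> carrier G \<Longrightarrow> a w \<otimes> inv w \<in> \<gamma> 2"
  shows "a \<in> andreadakis (Suc 0)"
proof -
  interpret a: group_hom G G a by (rule AutoGroup_simps(1)[OF a])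
  have pres: "a w \<in> \<gamma> k" if "w \<in> \<gamma> k" for w k
    using hom_lower_central[OF a.group_hom_axioms that] .
  have "gr_elem G k (a w) = gr_elem G k w" if "1 \<le> k" "w \<in> \<gamma> k" for k w
    using that
  proof (induction k arbitrary: w rule: nat_induct_at_least)
    case base
    then show ?case using ab[of w] by (simp add: gr_elem_eq_iff numeral_2_eq_2)
  next
    case (Suc k)
    then obtain d where k: "k = Suc d" by (cases k) auto
    let ?S = "{group_commutator G a b |a b. a \<in> \<gamma> k \<and> b \<in> carrier G}"
    have S: "?S \<subseteq> \<gamma> (Suc k)"
      using Suc.hyps by (auto intro!: lower_central_commutator_Suc)
    have comm: "gr_elem G (Suc k) (a w) = gr_elem G (Suc k) w" if wS: "w \<in> ?S" for w
    proof -
      obtain u v where uv: "u \<in> \<gamma> k" "v \<in> carrier G" "w = group_commutator G u v"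
        using wS by blast
      have v: "v \<in> \<gamma> (Suc 0)" using uv by simp
      have "gr_elem G (Suc k) (a w) = gr_elem G k (a u) \<otimes>\<^sub>g gr_elem G (Suc 0) (a v)"
        using uv Suc.hyps v by (simp add: hom_group_commutator[OF a.group_hom_axioms] gr_elem_bracket pres
          del: lower_central.simps)
      also have "\<dots> = gr_elem G k u \<otimes>\<^sub>g gr_elem G (Suc 0) v"
      proof -
        have "gr_elem G (Suc 0) (a v) = gr_elem G (Suc 0) v"
          using gr_elem_eq_iff[OF pres[OF v] v] ab[OF uv(2)]
          by (simp add: numeral_2_eq_2 del: lower_central.simps)
        then show ?thesis using Suc.IH[OF uv(1)] by simp
      qed
      also have "\<dots> = gr_elem G (Suc k) w"
        using uv Suc.hyps v by (simp add: gr_elem_bracket del: lower_central.simps)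
      finally show ?thesis .
    qed
    have gen: "\<gamma> (Suc k) = generate G ?S" unfolding k lower_central.simps ..
    have "w \<in> generate G ?S" using Suc.prems gen by simp
    then show ?case
    proof (induction rule: generate.induct)
      case (inv h)
      then have "h \<in> \<gamma> (Suc k)" using S by blast
      then show ?case using comm[OF inv] pres[of h] gr_elem_inv[of _ "Suc k"]
        by (simp del: lower_central.simps)
    next
      case (eng g h)
      then have "g \<in> \<gamma> (Suc k)" "h \<in> \<gamma> (Suc k)" using gen by auto
      then show ?case using eng.IH pres by (simp add: gr_elem_mult del: lower_central.simps)
    next
      case one
      show ?case by simp
    next
      case (incl h)
      then show ?case by (rule comm)
    qed
  qed
  then have "a w \<otimes> inv w \<in> \<gamma> (k + Suc 0)" if "1 \<le> k" "w \<in> \<gamma> k" for k w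
    using that pres by (simp add: gr_elem_eq_iff[symmetric])
  then show ?thesis using a by (simp add: andreadakis_def)
qed

text \<open>A commutator with a member of degree 1 raises the Andreadakis degree by one, which is
  how the lower central series grows. Inverses and commutators of the generated subgroup are
  identified with those of the full automorphism group.\<close>

lemma lower_central_le_andreadakis:
  assumes S: "S \<subseteq> andreadakis (Suc 0)" and "1 \<le> c"
  shows "lower_central (subgroup_generated (AutoGroup G) S) c \<subseteq> andreadakis c"
  using assms(2)
proof (induction c rule: nat_induct_at_least)
  case base
  interpret A: group "AutoGroup G" by (rule AutoGroup)
  show ?case
    using A.generate_subgroup_incl[OF _ subgroup_andreadakis, of "carrier (AutoGroup G) \<inter> S" "Suc 0"] S
    by (auto simp: carrier_subgroup_generated)
next
  case (Suc c)
  interpret A: group "AutoGroup G" by (rule AutoGroup)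
  let ?K = "subgroup_generated (AutoGroup G) S"
  obtain d where c: "c = Suc d" using Suc.hyps by (cases c) auto
  interpret K: group ?K by simp
  have K1: "carrier ?K \<subseteq> andreadakis (Suc 0)"
    using A.generate_subgroup_incl[OF _ subgroup_andreadakis, of "carrier (AutoGroup G) \<inter> S" "Suc 0"] S
    by (auto simp: carrier_subgroup_generated)
  have eq: "group_commutator ?K a b = group_commutator (AutoGroup G) a b"
    if "a \<in> carrier ?K" "b \<in> carrier ?K" for a b
    using that by (simp add: group_commutator_def A.inv_subgroup_generated)
  have sub: "{group_commutator ?K a b |a b. a \<in> lower_central ?K c \<and> b \<in> carrier ?K}
      \<subseteq> andreadakis (Suc c)"
    using Suc.IH K1 andreadakis_commutator eq K.lower_central_carrier by fastforce
  have "generate ?K T \<subseteq> andreadakis (Suc c)"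
    if T: "T \<subseteq> andreadakis (Suc c)" "T \<subseteq> carrier ?K" for T
  proof
    fix x assume "x \<in> generate ?K T"
    then show "x \<in> andreadakis (Suc c)"
    proof (induction rule: generate.induct)
      case (inv h)
      then have "inv\<^bsub>?K\<^esub> h = inv\<^bsub>AutoGroup G\<^esub> h" using T by (intro A.inv_subgroup_generated) auto
      then show ?case using inv T subgroup.m_inv_closed[OF subgroup_andreadakis] by auto
    next
      case one
      show ?case using subgroup.one_closed[OF subgroup_andreadakis] by simp
    next
      case (incl h)
      then show ?case using T by blast
    next
      case (eng g h)
      then show ?case using subgroup.m_closed[OF subgroup_andreadakis] by simp
    qed
  qed
  moreover have "{group_commutator ?K a b |a b. a \<in> lower_central ?K c \<and> b \<in> carrier ?K} \<subseteq> carrier ?K"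
    using K.lower_central_carrier by auto
  ultimately show ?case using sub unfolding c lower_central.simps by blast
qed

end

declare One_nat_def [simp del]

section \<open>Johnson coefficients\<close>

text \<open>The Johnson homomorphism in Magnus coordinates. For an automorphism of degree
  \<open>c\<close> the first coefficients that can survive have length \<open>c + 1\<close>, since
  \<open>x_k\<close> itself has degree 1. Multiplying the displacement by \<open>x_k\<close> on the
  right leaves these coefficients unchanged, so a plain difference of expansions can be
  used.\<close>

definition johnson :: "(('x \<times> bool) list \<Rightarrow> ('x \<times> bool) list) \<Rightarrow> 'x \<Rightarrow> 'x list \<Rightarrow> int" where
  "johnson a k w = coeff (magnus (a (free_gen k)) - magnus (free_gen k)) w"

lemma free_gen_lower_central: "k \<in> X \<Longrightarrow> free_gen k \<in> lower_central (free_group X) (Suc 0)"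
  using free_gen_in_carrier by simp

lemma ord_ge_johnson:
  assumes "a \<in> group.andreadakis (free_group X) c" "k \<in> X"
  shows "ord_ge (Suc c) (magnus (a (free_gen k)) - magnus (free_gen k))"
proof -
  interpret group "free_group X" by (rule group_free_group)
  obtain u where u: "u \<in> lower_central (free_group X) (Suc 0 + c)"
    "a (free_gen k) = u \<otimes>\<^bsub>free_group X\<^esub> free_gen k"
    using andreadakisE[OF assms(1) free_gen_lower_central[OF assms(2)]] by auto
  have "magnus (a (free_gen k)) - magnus (free_gen k) = (magnus u - 1) * magnus (free_gen k)"
    by (simp add: u magnus_mult left_diff_distrib)
  then show ?thesis
    using ord_ge_mult[OF ord_ge_magnus_lower_central[OF u(1)] ord_ge_0(1)] by simp
qed

lemma johnson_zero:
  assumes "a \<in> group.andreadakis (free_group X) c" "k \<in> X" "length w \<le> c"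
  shows "johnson a k w = 0"
  using ord_ge_johnson[OF assms(1,2)] assms(3) by (simp add: johnson_def ord_ge_def)

text \<open>The product sends \<open>x\<close> to \<open>z v u x\<close>, where \<open>u\<close> and
  \<open>v\<close> are the displacements of \<open>x\<close> under \<open>a\<close> and
  \<open>b\<close>, and \<open>z\<close> is that of \<open>v\<close> under \<open>a\<close>. After
  subtracting 1 the series of \<open>z\<close> has order at least \<open>2 c + 1\<close>, and the
  product of those of \<open>v\<close> and \<open>u\<close> at least \<open>2 c + 2\<close>; as
  \<open>c >= 1\<close>, both lie beyond \<open>c + 1\<close>.\<close>

lemma johnson_mult:
  assumes ab: "a \<in> group.andreadakis (free_group X) c" "b \<in> group.andreadakis (free_group X) c"
    and "1 \<le> c" "k \<in> X" "length w = Suc c"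
  shows "johnson (a \<otimes>\<^bsub>AutoGroup (free_group X)\<^esub> b) k w = johnson a k w + johnson b k w"
proof -
  interpret group "free_group X" by (rule group_free_group)
  let ?x = "free_gen k"
  have ac: "a \<in> carrier (AutoGroup (free_group X))" "b \<in> carrier (AutoGroup (free_group X))"
    using ab by (auto simp: andreadakis_def)
  interpret a: group_hom "free_group X" "free_group X" a by (rule AutoGroup_simps(1)[OF ac(1)])
  note x = free_gen_lower_central[OF assms(4)]
  obtain u where u: "u \<in> lower_central (free_group X) (Suc c)" "a ?x = u \<otimes>\<^bsub>free_group X\<^esub> ?x"
    using andreadakisE[OF ab(1) x] by auto
  obtain v where v: "v \<in> lower_central (free_group X) (Suc c)" "b ?x = v \<otimes>\<^bsub>free_group X\<^esub> ?x"
    using andreadakisE[OF ab(2) x] by auto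
  obtain z where z: "z \<in> lower_central (free_group X) (Suc c + c)" "a v = z \<otimes>\<^bsub>free_group X\<^esub> v"
    using andreadakisE[OF ab(1) v(1)] by auto
  have car: "v \<in> carrier (free_group X)" "?x \<in> carrier (free_group X)"
    using v(1) x lower_central_carrier by auto
  have "(a \<otimes>\<^bsub>AutoGroup (free_group X)\<^esub> b) ?x = a v \<otimes>\<^bsub>free_group X\<^esub> a ?x"
    using car ac v(2) by (simp add: AutoGroup_simps(3))
  then have ab_eq: "magnus ((a \<otimes>\<^bsub>AutoGroup (free_group X)\<^esub> b) ?x) =
      magnus z * magnus v * (magnus u * magnus ?x)"
    by (simp add: u z magnus_mult)
  define E where "E = (magnus z - 1) * (magnus v * magnus u * magnus ?x) +
    (magnus v - 1) * (magnus u - 1) * magnus ?x"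
  have eq: "magnus ((a \<otimes>\<^bsub>AutoGroup (free_group X)\<^esub> b) ?x) - magnus ?x =
      (magnus (a ?x) - magnus ?x) + (magnus (b ?x) - magnus ?x) + E"
    by (simp add: ab_eq u v magnus_mult E_def algebra_simps)
  have "ord_ge (Suc (Suc c)) E"
    unfolding E_def
  proof (rule ord_ge_add)
    show "ord_ge (Suc (Suc c)) ((magnus z - 1) * (magnus v * magnus u * magnus ?x))"
      by (rule ord_ge_mult[OF ord_ge_magnus_lower_central[OF z(1)] ord_ge_0(1)]) (use assms(3) in simp)
    have "ord_ge (Suc (Suc c)) ((magnus v - 1) * (magnus u - 1))"
      by (rule ord_ge_mult[OF ord_ge_magnus_lower_central[OF v(1)] ord_ge_magnus_lower_central[OF u(1)]])
        simp
    then show "ord_ge (Suc (Suc c)) ((magnus v - 1) * (magnus u - 1) * magnus ?x)"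
      by (rule ord_ge_mult[OF _ ord_ge_0(1)]) simp
  qed
  then have "coeff E w = 0" using assms(5) by (simp add: ord_ge_def)
  then show ?thesis unfolding johnson_def eq by (simp only: coeff_simps(3))
qed

section \<open>Partial conjugations\<close>

lemma group_I_group: "group (I_group n)"
  using group.group_subgroup_generated[OF group.AutoGroup[OF group_free_group]]
  by (simp add: I_group_def)

lemma carrier_I_group: "carrier (I_group n) \<subseteq> carrier (AutoGroup (F n))"
  unfolding I_group_def
  by (rule group.carrier_subgroup_generated_subset[OF group.AutoGroup[OF group_free_group]])

lemma mult_I_group: "a \<otimes>\<^bsub>I_group n\<^esub> b = a \<otimes>\<^bsub>AutoGroup (F n)\<^esub> b"
  by (simp add: I_group_def)

lemma y_aut_in_I_group: "\<lbrakk>2 \<le> m; m \<le> n; 1 \<le> i; i \<le> m\<rbrakk> \<Longrightarrow> y_aut n m i \<in> carrier (I_group n)"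
  unfolding I_group_def carrier_subgroup_generated
  by (intro generate.incl) (use y_aut_in_AutoGroup[of i m n] in auto)

lemma I_group_simps:
  assumes "a \<in> carrier (I_group n)"
  shows "group_hom (F n) (F n) a" "w \<in> carrier (F n) \<Longrightarrow> a w \<in> carrier (F n)"
    "b \<in> carrier (I_group n) \<Longrightarrow> w \<in> carrier (F n) \<Longrightarrow> (a \<otimes>\<^bsub>I_group n\<^esub> b) w = a (b w)"
    "w \<in> carrier (F n) \<Longrightarrow> (inv\<^bsub>I_group n\<^esub> a) (a w) = w"
    "w \<in> carrier (F n) \<Longrightarrow> a ((inv\<^bsub>I_group n\<^esub> a) w) = w"
    "w \<in> carrier (F n) \<Longrightarrow> \<one>\<^bsub>I_group n\<^esub> w = w"
proof -
  interpret F: group "F n" by (rule group_free_group)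
  have inv: "inv\<^bsub>I_group n\<^esub> a = inv\<^bsub>AutoGroup (F n)\<^esub> a"
    using assms unfolding I_group_def by (rule group.inv_subgroup_generated[OF F.AutoGroup])
  have one: "\<one>\<^bsub>I_group n\<^esub> = \<one>\<^bsub>AutoGroup (F n)\<^esub>" by (simp add: I_group_def)
  have ac: "a \<in> carrier (AutoGroup (F n))" using assms carrier_I_group by blast
  note s = F.AutoGroup_simps[OF ac]
  show "group_hom (F n) (F n) a" by (rule s(1))
  show "w \<in> carrier (F n) \<Longrightarrow> a w \<in> carrier (F n)" by (rule s(2))
  show "b \<in> carrier (I_group n) \<Longrightarrow> w \<in> carrier (F n) \<Longrightarrow> (a \<otimes>\<^bsub>I_group n\<^esub> b) w = a (b w)"
    unfolding mult_I_group by (rule s(3)[OF subsetD[OF carrier_I_group]])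
  show "w \<in> carrier (F n) \<Longrightarrow> (inv\<^bsub>I_group n\<^esub> a) (a w) = w" unfolding inv by (rule s(4))
  show "w \<in> carrier (F n) \<Longrightarrow> a ((inv\<^bsub>I_group n\<^esub> a) w) = w" unfolding inv by (rule s(5))
  show "w \<in> carrier (F n) \<Longrightarrow> \<one>\<^bsub>I_group n\<^esub> w = w" unfolding one by (rule s(6))
qed

lemma I_group_eqI:
  assumes ab: "a \<in> carrier (I_group n)" "b \<in> carrier (I_group n)"
    and gen: "\<And>k. k \<in> {1..n} \<Longrightarrow> a (free_gen k) = b (free_gen k)"
  shows "a = b"
proof
  interpret F: group "F n" by (rule group_free_group)
  fix w
  show "a w = b w"
  proof (cases "w \<in> carrier (F n)")
    case True
    have "a \<in> hom (F n) (F n)" "b \<in> hom (F n) (F n)"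
      using I_group_simps(1) ab group_hom.homh by blast+
    then show ?thesis
      using F.free_group_ext_unique[OF _ True, of a "\<lambda>k. b (free_gen k)"]
        F.free_group_ext_unique[OF _ True, of b "\<lambda>k. b (free_gen k)"] gen by simp
  next
    case False
    have ext: "c \<in> extensional (carrier (F n))" if "c \<in> carrier (I_group n)" for c
      using subsetD[OF carrier_I_group that] by (simp add: AutoGroup_def auto_def Bij_def)
    show ?thesis
      using extensional_arb[OF ext[OF ab(1)] False] extensional_arb[OF ext[OF ab(2)] False] by simp
  qed
qed

section \<open>Automorphisms that act on a block by conjugation\<close>

definition y_inv :: "nat \<Rightarrow> nat \<Rightarrow> nat \<Rightarrow> (nat \<times> bool) list \<Rightarrow> (nat \<times> bool) list" where
  "y_inv n m i = inv\<^bsub>I_group n\<^esub> y_aut n m i"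

definition F_block :: "nat \<Rightarrow> nat \<Rightarrow> (nat \<times> bool) list set" where
  "F_block n m = generate (F n) (free_gen ` {1..m})"

lemma F_block_gens: "m \<le> n \<Longrightarrow> free_gen ` {1..m} \<subseteq> carrier (F n)"
  by (rule image_subsetI, rule free_gen_in_carrier) simp

lemma subgroup_F_block: "m \<le> n \<Longrightarrow> subgroup (F_block n m) (F n)"
  unfolding F_block_def by (rule group.generate_is_subgroup[OF group_free_group F_block_gens])

lemma F_block_gen: "1 \<le> k \<Longrightarrow> k \<le> m \<Longrightarrow> free_gen k \<in> F_block n m"
  unfolding F_block_def by (intro generate.incl) simp

lemma hom_F_block_cong:
  assumes "m \<le> n" "group_hom (F n) (F n) f" "group_hom (F n) (F n) g" "w \<in> F_block n m"
    and "\<And>k. \<lbrakk>1 \<le> k; k \<le> m\<rbrakk> \<Longrightarrow> f (free_gen k) = g (free_gen k)"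
  shows "f w = g w"
proof -
  interpret f: group_hom "F n" "F n" f by fact
  interpret g: group_hom "F n" "F n" g by fact
  note sub = F_block_gens[OF assms(1)]
  show ?thesis
    using assms(4) unfolding F_block_def
  proof (induction rule: generate.induct)
    case (eng u v)
    then have "u \<in> carrier (F n)" "v \<in> carrier (F n)"
      using f.G.generate_in_carrier[OF sub] by auto
    then show ?case using eng.IH by simp
  next
    case (inv h)
    then have "h \<in> carrier (F n)" using sub by blast
    then show ?case using inv assms(5) by auto
  next
    case one
    show ?case by simp
  next
    case (incl h)
    then show ?case using assms(5) by auto
  qed
qed

lemma hom_F_block_image:
  assumes "m \<le> n" "group_hom (F n) (F n) f" "w \<in> F_block n m"
    and gen: "\<And>k. \<lbrakk>1 \<le> k; k \<le> m\<rbrakk> \<Longrightarrow> f (free_gen k) \<in> F_block n m"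
  shows "f w \<in> F_block n m"
proof -
  interpret f: group_hom "F n" "F n" f by fact
  interpret S: subgroup "F_block n m" "F n" by (rule subgroup_F_block[OF assms(1)])
  note sub = F_block_gens[OF assms(1)]
  show ?thesis
    using assms(3) unfolding F_block_def[of n m]
  proof (induction rule: generate.induct)
    case (eng u v)
    then have "u \<in> carrier (F n)" "v \<in> carrier (F n)"
      using f.G.generate_in_carrier[OF sub] by auto
    then show ?case using eng.IH S.m_closed by (simp add: F_block_def)
  next
    case (inv h)
    then have "h \<in> carrier (F n)" "f h \<in> F_block n m" using sub gen by auto
    then show ?case using S.m_inv_closed by (simp add: F_block_def)
  next
    case one
    show ?case using S.one_closed by (simp add: F_block_def)
  next
    case (incl h)
    then show ?case using gen by (auto simp: F_block_def)
  qed
qed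

text \<open>For the composition of functions, \<open>a\<close> depends homomorphically on \<open>g\<close> because \<open>a\<close> sends \<open>w\<close> to
  \<open>g w g\<^sup>-\<^sup>1\<close>, whereas \<open>y\<^bsub>mi\<^esub>\<close> sends it to \<open>x\<^bsub>i\<^esub>\<^sup>-\<^sup>1 w x\<^bsub>i\<^esub>\<close>. Hence the inverses of the
  \<open>y\<^bsub>mi\<^esub>\<close> take their role.\<close>

definition block_conj :: "nat \<Rightarrow> nat \<Rightarrow> (nat \<times> bool) list \<Rightarrow>
    ((nat \<times> bool) list \<Rightarrow> (nat \<times> bool) list) \<Rightarrow> bool" where
  "block_conj n m g a \<longleftrightarrow> m \<le> n \<and> a \<in> carrier (I_group n) \<and> g \<in> F_block n m \<and>
     (\<forall>w\<in>F_block n m. a w = g \<otimes>\<^bsub>F n\<^esub> w \<otimes>\<^bsub>F n\<^esub> inv\<^bsub>F n\<^esub> g) \<and>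
     (\<forall>k\<in>{m<..n}. a (free_gen k) = free_gen k)"

lemma block_conjD:
  assumes "block_conj n m g a"
  shows "m \<le> n" "a \<in> carrier (I_group n)" "g \<in> F_block n m" "g \<in> carrier (F n)"
    "w \<in> F_block n m \<Longrightarrow> a w = g \<otimes>\<^bsub>F n\<^esub> w \<otimes>\<^bsub>F n\<^esub> inv\<^bsub>F n\<^esub> g"
    "m < k \<Longrightarrow> k \<le> n \<Longrightarrow> a (free_gen k) = free_gen k"
  using assms subgroup.subset[OF subgroup_F_block] by (auto simp: block_conj_def)

lemma block_conj_mult:
  assumes "block_conj n m g a" "block_conj n m h b"
  shows "block_conj n m (g \<otimes>\<^bsub>F n\<^esub> h) (a \<otimes>\<^bsub>I_group n\<^esub> b)"
proof -
  note a = block_conjD[OF assms(1)] and b = block_conjD[OF assms(2)]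
  interpret F: group "F n" by (rule group_free_group)
  interpret I: group "I_group n" by (rule group_I_group)
  interpret S: subgroup "F_block n m" "F n" by (rule subgroup_F_block[OF a(1)])
  have "(a \<otimes>\<^bsub>I_group n\<^esub> b) w = g \<otimes>\<^bsub>F n\<^esub> h \<otimes>\<^bsub>F n\<^esub> w \<otimes>\<^bsub>F n\<^esub> inv\<^bsub>F n\<^esub> (g \<otimes>\<^bsub>F n\<^esub> h)"
    if w: "w \<in> F_block n m" for w
  proof -
    have "h \<otimes>\<^bsub>F n\<^esub> w \<otimes>\<^bsub>F n\<^esub> inv\<^bsub>F n\<^esub> h \<in> F_block n m" using w b(3) by simp
    then have "(a \<otimes>\<^bsub>I_group n\<^esub> b) w = g \<otimes>\<^bsub>F n\<^esub> (h \<otimes>\<^bsub>F n\<^esub> w \<otimes>\<^bsub>F n\<^esub> inv\<^bsub>F n\<^esub> h) \<otimes>\<^bsub>F n\<^esub> inv\<^bsub>F n\<^esub> g"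
      using a(2,5) b(2,5) w by (simp add: I_group_simps(3))
    then show ?thesis using a(4) b(4) w S.mem_carrier by (simp add: F.m_assoc F.inv_mult_group)
  qed
  moreover have "(a \<otimes>\<^bsub>I_group n\<^esub> b) (free_gen k) = free_gen k" if "k \<in> {m<..n}" for k
    using that a(2,6) b(2,6) free_gen_in_carrier[of k "{1..n}"] by (simp add: I_group_simps(3))
  ultimately show ?thesis using a b by (simp add: block_conj_def)
qed

lemma block_conj_inv:
  assumes "block_conj n m g a"
  shows "block_conj n m (inv\<^bsub>F n\<^esub> g) (inv\<^bsub>I_group n\<^esub> a)"
proof -
  note a = block_conjD[OF assms(1)]
  interpret F: group "F n" by (rule group_free_group)
  interpret I: group "I_group n" by (rule group_I_group)
  interpret S: subgroup "F_block n m" "F n" by (rule subgroup_F_block[OF a(1)])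
  have "(inv\<^bsub>I_group n\<^esub> a) w = inv\<^bsub>F n\<^esub> g \<otimes>\<^bsub>F n\<^esub> w \<otimes>\<^bsub>F n\<^esub> inv\<^bsub>F n\<^esub> (inv\<^bsub>F n\<^esub> g)"
    if w: "w \<in> F_block n m" for w
  proof -
    let ?v = "inv\<^bsub>F n\<^esub> g \<otimes>\<^bsub>F n\<^esub> w \<otimes>\<^bsub>F n\<^esub> g"
    have v: "?v \<in> F_block n m" "?v \<in> carrier (F n)" "w \<in> carrier (F n)" using w a(3,4) by auto
    have "a ?v = w" using a(5)[OF v(1)] v a(4) by (simp add: F.m_assoc F.inv_mult_cancel)
    then have "(inv\<^bsub>I_group n\<^esub> a) w = ?v" using I_group_simps(4)[OF a(2) v(2)] by simp
    then show ?thesis using a(4) by simp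
  qed
  moreover have "(inv\<^bsub>I_group n\<^esub> a) (free_gen k) = free_gen k" if "k \<in> {m<..n}" for k
    using I_group_simps(4)[OF a(2), of "free_gen k"] that a(6) free_gen_in_carrier[of k "{1..n}"] by simp
  ultimately show ?thesis using a by (simp add: block_conj_def)
qed

lemma block_conj_commutator:
  assumes "block_conj n m g a" "block_conj n m h b"
  shows "block_conj n m (group_commutator (F n) g h) (group_commutator (I_group n) a b)"
  unfolding group_commutator_def by (intro block_conj_mult block_conj_inv assms)

lemma block_conj_unique:
  assumes "block_conj n m g a" "block_conj n m g b"
  shows "a = b"
proof (rule I_group_eqI)
  note a = block_conjD[OF assms(1)] and b = block_conjD[OF assms(2)]
  show "a \<in> carrier (I_group n)" "b \<in> carrier (I_group n)" by fact+
  fix k assume "k \<in> {1..n}"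
  then show "a (free_gen k) = b (free_gen k)"
    using a(5)[OF F_block_gen, of k] b(5)[OF F_block_gen, of k] a(6)[of k] b(6)[of k]
    by (cases "k \<le> m") auto
qed

lemma group_hom_conj:
  assumes "group G" "g \<in> carrier G"
  shows "group_hom G G (\<lambda>w. g \<otimes>\<^bsub>G\<^esub> w \<otimes>\<^bsub>G\<^esub> inv\<^bsub>G\<^esub> g)"
proof -
  interpret group G by fact
  show ?thesis
    using assms(2) by unfold_locales (auto simp: hom_def m_assoc inv_mult_cancel)
qed

lemma block_conj_y:
  assumes "2 \<le> m" "m \<le> n" "1 \<le> i" "i \<le> m"
  shows "block_conj n m (free_gen i) (y_inv n m i)"
proof -
  interpret F: group "F n" by (rule group_free_group)
  let ?x = "free_gen i :: (nat \<times> bool) list"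
  have x: "?x \<in> carrier (F n)" using assms by (intro free_gen_in_carrier) simp
  have yI: "y_aut n m i \<in> carrier (I_group n)" using assms by (rule y_aut_in_I_group)
  have "y_aut n m i w = inv\<^bsub>F n\<^esub> ?x \<otimes>\<^bsub>F n\<^esub> w \<otimes>\<^bsub>F n\<^esub> inv\<^bsub>F n\<^esub> (inv\<^bsub>F n\<^esub> ?x)" if "w \<in> F_block n m" for w
    by (rule hom_F_block_cong[OF assms(2) I_group_simps(1)[OF yI] group_hom_conj[OF group_free_group] that])
      (use x assms in \<open>auto simp: y_aut_gen\<close>)
  moreover have "inv\<^bsub>F n\<^esub> ?x \<in> F_block n m"
    using assms F_block_gen subgroup.m_inv_closed[OF subgroup_F_block] by simp
  moreover have "y_aut n m i (free_gen k) = free_gen k" if "k \<in> {m<..n}" for k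
    using that assms by (simp add: y_aut_gen)
  ultimately have "block_conj n m (inv\<^bsub>F n\<^esub> ?x) (y_aut n m i)"
    using yI assms(2) by (simp add: block_conj_def)
  from block_conj_inv[OF this] show ?thesis using x by (simp add: y_inv_def)
qed

lemma block_conj_preserves_block:
  assumes "block_conj n r h b" "r \<le> m" "m \<le> n" "w \<in> F_block n m"
  shows "b w \<in> F_block n m"
proof (rule hom_F_block_image[OF assms(3) I_group_simps(1)[OF block_conjD(2)[OF assms(1)]] assms(4)])
  note b = block_conjD[OF assms(1)]
  interpret S: subgroup "F_block n m" "F n" by (rule subgroup_F_block[OF assms(3)])
  fix k assume k: "1 \<le> k" "k \<le> m"
  have "F_block n r \<subseteq> F_block n m"
    unfolding F_block_def using assms(2) by (intro group.mono_generate group_free_group) auto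
  then have "h \<in> F_block n m" using b(3) by blast
  then show "b (free_gen k) \<in> F_block n m"
    using k b(5)[OF F_block_gen, of k] b(6)[of k] F_block_gen[OF k] assms(3)
    by (cases "k \<le> r") auto
qed

text \<open>Conjugating the conjugation by \<open>g\<close> with an automorphism gives the
  conjugation by the image of \<open>g\<close>, and \<open>r \<le> m\<close> keeps that image in the
  block. The relators thus reduce to the action of the lower generators on single letters.\<close>

lemma block_conj_conj:
  assumes a: "block_conj n m g a" and b: "block_conj n r h b" and "r \<le> m"
  shows "block_conj n m ((inv\<^bsub>I_group n\<^esub> b) g) (inv\<^bsub>I_group n\<^esub> b \<otimes>\<^bsub>I_group n\<^esub> a \<otimes>\<^bsub>I_group n\<^esub> b)"
proof -
  interpret F: group "F n" by (rule group_free_group)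
  interpret I: group "I_group n" by (rule group_I_group)
  note a' = block_conjD[OF a] and b' = block_conjD[OF b] and i' = block_conjD[OF block_conj_inv[OF b]]
  let ?i = "inv\<^bsub>I_group n\<^esub> b"
  interpret i: group_hom "F n" "F n" ?i by (rule I_group_simps(1)[OF i'(2)])
  interpret S: subgroup "F_block n m" "F n" by (rule subgroup_F_block[OF a'(1)])
  have app: "(?i \<otimes>\<^bsub>I_group n\<^esub> a \<otimes>\<^bsub>I_group n\<^esub> b) w = ?i (a (b w))" if "w \<in> carrier (F n)" for w
    using that a'(2) b'(2) i'(2) by (simp add: I_group_simps)
  have "(?i \<otimes>\<^bsub>I_group n\<^esub> a \<otimes>\<^bsub>I_group n\<^esub> b) w = ?i g \<otimes>\<^bsub>F n\<^esub> w \<otimes>\<^bsub>F n\<^esub> inv\<^bsub>F n\<^esub> ?i g"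
    if w: "w \<in> F_block n m" for w
  proof -
    have wc: "w \<in> carrier (F n)" "b w \<in> carrier (F n)" using w I_group_simps(2)[OF b'(2)] by auto
    have "a (b w) = g \<otimes>\<^bsub>F n\<^esub> b w \<otimes>\<^bsub>F n\<^esub> inv\<^bsub>F n\<^esub> g"
      using a'(5) block_conj_preserves_block[OF b assms(3) a'(1) w] by simp
    then show ?thesis
      using app wc a'(4) I_group_simps(4)[OF b'(2) wc(1)] by simp
  qed
  moreover have "?i g \<in> F_block n m"
    by (rule block_conj_preserves_block[OF block_conj_inv[OF b] assms(3) a'(1,3)])
  moreover have "(?i \<otimes>\<^bsub>I_group n\<^esub> a \<otimes>\<^bsub>I_group n\<^esub> b) (free_gen k) = free_gen k" if "k \<in> {m<..n}" for k
    using that app[of "free_gen k"] free_gen_in_carrier[of k "{1..n}"] a'(6)[of k] b'(6)[of k] i'(6)[of k]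
      assms(3) by simp
  ultimately show ?thesis using a'(1,2) b'(2) by (simp add: block_conj_def)
qed

text \<open>With \<open>G\<close> for the series of \<open>g\<close> and \<open>G'\<close> for its
  inverse, \<open>G (1 + X) G' - (1 + X)\<close> equals \<open>((G - 1) X - X (G - 1)) G'\<close>,
  and in degree \<open>c + 1\<close> only the leading part \<open>P\<close> of \<open>G - 1\<close>
  is seen.\<close>

lemma johnson_block_conj:
  assumes a: "block_conj n m g a" and P: "ord_ge c P" "ord_ge (Suc c) (magnus g - 1 - P)"
    and k: "1 \<le> k" "k \<le> n" and w: "length w = Suc c"
  shows "johnson a k w = (if k \<le> m then coeff (P * ncs_var k - ncs_var k * P) w else 0)"
proof (cases "k \<le> m")
  case True
  note a = block_conjD[OF a]
  let ?X = "ncs_var k" and ?G = "magnus g" and ?G' = "magnus (inv\<^bsub>F n\<^esub> g)"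
  let ?D = "(?G - 1) * ?X - ?X * (?G - 1)"
  have inv: "?G * ?G' = 1" using magnus_inv(2)[OF a(4)] .
  have "magnus (a (free_gen k)) - magnus (free_gen k) = ?G * (1 + ?X) * ?G' - (1 + ?X)"
    using a(5)[OF F_block_gen[OF k(1) True]] by (simp add: magnus_mult magnus_gen)
  also have "\<dots> = ?G * (1 + ?X) * ?G' - (1 + ?X) * (?G * ?G')" by (simp add: inv)
  also have "\<dots> = ?D * ?G'" by (simp add: algebra_simps)
  also have "\<dots> = (P * ?X - ?X * P) +
      (((?G - 1 - P) * ?X - ?X * (?G - 1 - P)) + ?D * (?G' - 1))"
    by (simp add: algebra_simps)
  finally have eq: "magnus (a (free_gen k)) - magnus (free_gen k) = (P * ?X - ?X * P) +
      (((?G - 1 - P) * ?X - ?X * (?G - 1 - P)) + ?D * (?G' - 1))" .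
  have G1: "ord_ge c (?G - 1)" using ord_ge_add[OF P(1) ord_ge_mono[OF P(2)]] by simp
  have "ord_ge (Suc c) ?D"
    by (rule ord_ge_diff[OF ord_ge_mult[OF G1 ord_ge_var] ord_ge_mult[OF ord_ge_var G1]]) simp_all
  then have 1: "ord_ge (Suc (Suc c)) (?D * (?G' - 1))"
    by (rule ord_ge_mult[OF _ ord_ge_magnus]) simp
  have 2: "ord_ge (Suc (Suc c)) ((?G - 1 - P) * ?X - ?X * (?G - 1 - P))"
    by (rule ord_ge_diff[OF ord_ge_mult[OF P(2) ord_ge_var] ord_ge_mult[OF ord_ge_var P(2)]]) simp_all
  have "coeff (((?G - 1 - P) * ?X - ?X * (?G - 1 - P)) + ?D * (?G' - 1)) w = 0"
    using ord_ge_add[OF 2 1] w by (simp add: ord_ge_def)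
  then show ?thesis using True unfolding johnson_def eq by (simp add: coeff_simps(3))
next
  case False
  then show ?thesis using block_conjD(6)[OF a] k by (simp add: johnson_def coeff_simps(1))
qed

text \<open>\<open>R k\<close> collects the blocks from \<open>k\<close> on, \<open>Q k\<close>
  block \<open>k\<close> alone. The hypothesis says that \<open>R k\<close> commutes with
  \<open>X_k\<close>, so \<open>cyclic_support\<close> confines it to powers of \<open>X_k\<close>.
  Once \<open>R k = 0\<close>, the next sum \<open>R (Suc k)\<close> is minus \<open>Q k\<close>,
  hence a series in the letters up to \<open>k\<close>, and must vanish too. So every
  \<open>Q m\<close> vanishes, and \<open>lie_poly_independent\<close> applies inside block
  \<open>m\<close>.\<close>

lemma block_independent:
  fixes c :: "nat \<times> nat lie_term \<Rightarrow> int"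
  assumes "finite K" and K: "\<And>m t. (m, t) \<in> K \<Longrightarrow> 2 \<le> m \<and> m \<le> n \<and> hall {1..m} t"
    and zero: "\<And>k w. \<lbrakk>1 \<le> k; k \<le> n\<rbrakk> \<Longrightarrow> (\<Sum>p\<in>K. c p * (if k \<le> fst p
      then coeff (lie_poly (snd p) * ncs_var k - ncs_var k * lie_poly (snd p)) w else 0)) = 0"
    and "p \<in> K"
  shows "c p = 0"
proof -
  define R where "R = (\<lambda>k w. \<Sum>p\<in>K. c p * (if k \<le> fst p then coeff (lie_poly (snd p)) w else 0))"
  define Q where "Q = (\<lambda>k w. \<Sum>p\<in>K. c p * (if k = fst p then coeff (lie_poly (snd p)) w else 0))"
  \<comment> \<open>The empty word is a power of every letter, so comparing supports cannot exclude
    it.\<close>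
  have R_Nil: "R k [] = 0" for k
  proof -
    have "coeff (lie_poly (snd p)) [] = 0" if "p \<in> K" for p
      using K[of "fst p" "snd p"] that ord_ge_lie_poly[of _ "snd p"]
      by (auto simp: ord_ge_def)
    then show ?thesis unfolding R_def by (intro sum.neutral) auto
  qed
  have supp: "set w \<subseteq> {k}" if k: "1 \<le> k" "k \<le> n" and "R k w \<noteq> 0" for k w
  proof (rule cyclic_support[of k "R k" w, OF _ that(3)])
    fix w :: "nat list"
    define A where "A = (\<lambda>p :: nat \<times> nat lie_term.
      if w \<noteq> [] \<and> last w = k then coeff (lie_poly (snd p)) (butlast w) else 0)"
    define B where "B = (\<lambda>p :: nat \<times> nat lie_term.
      case w of [] \<Rightarrow> 0 | y # v \<Rightarrow> if y = k then coeff (lie_poly (snd p)) v else 0)"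
    have "(if w \<noteq> [] \<and> last w = k then R k (butlast w) else 0) =
        (\<Sum>p\<in>K. c p * (if k \<le> fst p then A p else 0))"
    proof (cases "w \<noteq> [] \<and> last w = k")
      case True
      show ?thesis unfolding R_def A_def if_P[OF True] ..
    next
      case False
      have A0: "A = (\<lambda>p. 0)" unfolding A_def if_not_P[OF False] ..
      show ?thesis unfolding if_not_P[OF False] A0 by simp
    qed
    moreover have "(case w of [] \<Rightarrow> 0 | y # v \<Rightarrow> if y = k then R k v else 0) =
        (\<Sum>p\<in>K. c p * (if k \<le> fst p then B p else 0))"
    proof (cases "\<exists>v. w = k # v")
      case True
      then obtain v where v: "w = k # v" ..
      then have B': "B = (\<lambda>p. coeff (lie_poly (snd p)) v)" unfolding B_def by simp
      show ?thesis unfolding R_def B' v by simp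
    next
      case False
      then have B0: "B = (\<lambda>p. 0)" unfolding B_def by (auto split: list.split)
      show ?thesis using False unfolding B0 by (auto split: list.split)
    qed
    moreover have "(\<Sum>p\<in>K. c p * (if k \<le> fst p then A p else 0)) -
        (\<Sum>p\<in>K. c p * (if k \<le> fst p then B p else 0)) = 0"
    proof -
      have "(\<Sum>p\<in>K. c p * (if k \<le> fst p then A p - B p else 0)) = 0"
        using zero[OF k, of w] unfolding coeff_simps(4) coeff_mult_var coeff_var_mult A_def B_def .
      moreover have "c p * (if k \<le> fst p then A p else 0) - c p * (if k \<le> fst p then B p else 0) =
          c p * (if k \<le> fst p then A p - B p else 0)" for p
        by (simp add: right_diff_distrib)
      ultimately show ?thesis unfolding sum_subtractf[symmetric] by simp
    qed
    ultimately show "(if w \<noteq> [] \<and> last w = k then R k (butlast w) else 0) =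
        (case w of [] \<Rightarrow> 0 | y # v \<Rightarrow> if y = k then R k v else 0)" by simp
  qed
  have Q_supp: "w \<noteq> [] \<and> set w \<subseteq> {1..k}" if Q: "Q k w \<noteq> 0" for k w
  proof -
    obtain p where p: "p \<in> K" "c p * (if k = fst p then coeff (lie_poly (snd p)) w else 0) \<noteq> 0"
      using sum.not_neutral_contains_not_neutral[OF Q[unfolded Q_def]] by blast
    then have k: "k = fst p" and nz: "coeff (lie_poly (snd p)) w \<noteq> 0" by (auto split: if_splits)
    have h: "hall {1..k} (snd p)" using K[of "fst p" "snd p"] p(1) k by simp
    then show ?thesis
      using lie_poly_support(1,3)[OF h nz] foliage_neq_Nil[OF h] by force
  qed
  have split: "R k w = Q k w + R (Suc k) w" for k w
    unfolding R_def Q_def sum.distrib[symmetric] by (rule sum.cong) auto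
  \<comment> \<open>The range reaches \<open>Suc n\<close> so that \<open>Q n\<close>, too, is a
    difference of two vanishing sums.\<close>
  have R_zero: "R k w = 0" if "2 \<le> k" "k \<le> Suc n" for k w
    using that
  proof (induction k arbitrary: w rule: nat_induct_at_least)
    case base
    show ?case
    proof (rule ccontr)
      assume R2: "R 2 w \<noteq> 0"
      \<comment> \<open>There is no block 1, so the letters 1 and 2 both bound the support of the
        same function.\<close>
      have "R 1 w = R 2 w" unfolding R_def
      proof (rule sum.cong[OF HOL.refl])
        fix p assume "p \<in> K"
        then show "c p * (if 1 \<le> fst p then coeff (lie_poly (snd p)) w else 0) =
            c p * (if 2 \<le> fst p then coeff (lie_poly (snd p)) w else 0)"
          using K[of "fst p" "snd p"] by auto
      qed
      moreover have "2 \<le> n" using K[of "fst p" "snd p"] assms(4) by auto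
      ultimately have "set w \<subseteq> {1}" "set w \<subseteq> {2}" using supp[of 1 w] supp[of 2 w] R2 by simp_all
      then have "w = []" by (cases w) auto
      then show False using R2 R_Nil by simp
    qed
  next
    case (Suc k)
    show ?case
    proof (rule ccontr)
      assume R: "R (Suc k) w \<noteq> 0"
      have "Suc k \<le> n"
      proof (rule ccontr)
        assume "\<not> Suc k \<le> n"
        then have "R (Suc k) w = 0" unfolding R_def
          using K by (intro sum.neutral) fastforce
        then show False using R by simp
      qed
      then have "set w \<subseteq> {Suc k}" using supp[OF _ _ R] by simp
      moreover have "Q k w \<noteq> 0" using split[of k w] Suc.IH[of w] Suc.prems R by simp
      then have "w \<noteq> []" "set w \<subseteq> {1..k}" using Q_supp by auto
      ultimately show False by (cases w) auto
    qed
  qed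
  obtain m t where p: "p = (m, t)" by (cases p)
  have m: "2 \<le> m" "m \<le> n" using K assms(4) p by auto
  define T where "T = {t. (m, t) \<in> K}"
  have finT: "finite T"
    unfolding T_def using finite_imageI[OF assms(1), of snd] by (rule rev_finite_subset) force
  have "(\<Sum>t\<in>T. c (m, t) * coeff (lie_poly t) w) = 0" for w
  proof -
    have "0 = Q m w" using split[of m w] R_zero[of m w] R_zero[of "Suc m" w] m by simp
    also have "\<dots> = (\<Sum>p\<in>Pair m ` T. c p * (if m = fst p then coeff (lie_poly (snd p)) w else 0))"
      unfolding Q_def by (rule sum.mono_neutral_right[OF assms(1)]) (auto simp: T_def)
    also have "\<dots> = (\<Sum>t\<in>T. c (m, t) * coeff (lie_poly t) w)"
      by (subst sum.reindex) (auto simp: inj_on_def)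
    finally show ?thesis by simp
  qed
  then show ?thesis
    using lie_poly_independent[OF finT, of "{1..m}" "\<lambda>t. c (m, t)" t] K p assms(4)
    by (auto simp: T_def)
qed

section \<open>Partial conjugations in the Andreadakis filtration, and Johnson coefficients of
  graded elements\<close>

lemma (in group) andreadakis_1_gen:
  assumes a: "a \<in> carrier (AutoGroup G)" and S: "carrier G = generate G S"
    and gen: "\<And>s. s \<in> S \<Longrightarrow> a s \<otimes> inv s \<in> lower_central G 2"
  shows "a \<in> andreadakis (Suc 0)"
proof (rule andreadakis_1I[OF a])
  interpret a: group_hom G G a by (rule AutoGroup_simps(1)[OF a])
  interpret N: normal "lower_central G 2" G by (rule normal_lower_central)
  have sub: "S \<subseteq> carrier G" unfolding S by (auto intro: generate.incl)
  fix w assume "w \<in> carrier G"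
  then have "w \<in> generate G S" using S by simp
  then show "a w \<otimes> inv w \<in> lower_central G 2"
  proof (induction rule: generate.induct)
    case one
    show ?case using N.one_closed by simp
  next
    case (incl h)
    then show ?case by (rule gen)
  next
    case (inv h)
    have h: "h \<in> carrier G" "a h \<in> carrier G" using inv sub by auto
    have "inv h \<otimes> inv (a h \<otimes> inv h) \<otimes> h \<in> lower_central G 2"
      using N.inv_op_closed1[OF h(1) N.m_inv_closed[OF gen[OF inv]]] .
    also have "inv h \<otimes> inv (a h \<otimes> inv h) \<otimes> h = a (inv h) \<otimes> inv (inv h)"
      using h by (simp add: m_assoc inv_mult_group inv_mult_cancel)
    finally show ?case .
  next
    case (eng u v)
    have uv: "u \<in> carrier G" "v \<in> carrier G" using eng.hyps S by simp_all
    note c = uv a.hom_closed[OF uv(1)] a.hom_closed[OF uv(2)]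
    \<comment> \<open>The displacement of \<open>u \<otimes> v\<close> is that of \<open>v\<close>,
      conjugated by \<open>a u\<close>, followed by that of \<open>u\<close>.\<close>
    have "a u \<otimes> (a v \<otimes> inv v) \<otimes> inv (a u) \<otimes> (a u \<otimes> inv u) \<in> lower_central G 2"
      using N.m_closed[OF N.inv_op_closed2[OF c(3) eng.IH(2)] eng.IH(1)] .
    also have "a u \<otimes> (a v \<otimes> inv v) \<otimes> inv (a u) \<otimes> (a u \<otimes> inv u) = a (u \<otimes> v) \<otimes> inv (u \<otimes> v)"
      using c by (simp add: m_assoc inv_mult_group inv_mult_cancel)
    finally show ?case .
  qed
qed

lemma y_aut_andreadakis:
  assumes "1 \<le> i" "i \<le> m" "m \<le> n"
  shows "y_aut n m i \<in> group.andreadakis (F n) (Suc 0)"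
proof -
  interpret F: group "F n" by (rule group_free_group)
  show ?thesis
  proof (rule F.andreadakis_1_gen[OF y_aut_in_AutoGroup[OF assms] free_group_generate])
    fix s :: "(nat \<times> bool) list" assume "s \<in> free_gen ` {1..n}"
    then obtain k where k: "k \<in> {1..n}" "s = free_gen k" by blast
    have c: "free_gen k \<in> carrier (F n)" "free_gen i \<in> carrier (F n)"
      using k assms by (auto intro!: free_gen_in_carrier)
    show "y_aut n m i s \<otimes>\<^bsub>F n\<^esub> inv\<^bsub>F n\<^esub> s \<in> lower_central (F n) 2"
    proof (cases "k \<le> m")
      case True
      then have "y_aut n m i s \<otimes>\<^bsub>F n\<^esub> inv\<^bsub>F n\<^esub> s = group_commutator (F n) (free_gen i) (inv\<^bsub>F n\<^esub> free_gen k)"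
        using k assms by (simp add: y_aut_gen group_commutator_def F.inv_inv[OF c(1)])
      moreover have "group_commutator (F n) (free_gen i) (inv\<^bsub>F n\<^esub> free_gen k) \<in> lower_central (F n) (Suc 1)"
        using c by (intro F.lower_central_commutator_Suc) (simp_all add: lower_central.simps(2)[folded One_nat_def])
      ultimately show ?thesis by (simp only: Suc_1)
    next
      case False
      then show ?thesis
        using k assms c F.lower_central_one
        by (simp add: y_aut_gen)
    qed
  qed
qed

lemma I_group_le_andreadakis:
  assumes "1 \<le> c" shows "lower_central (I_group n) c \<subseteq> group.andreadakis (F n) c"
  unfolding I_group_def
  by (rule group.lower_central_le_andreadakis[OF group_free_group _ assms])
    (use y_aut_andreadakis in auto)

text \<open>A word \<open>w\<close> reads the component of degree \<open>length w - 1\<close>, the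
  one on which the coefficient at \<open>w\<close> is additive; words shorter than 2 belong to no
  component and get 0. The chosen representative does not matter, since two of them differ by a
  factor from the next lower central term, whose coefficient at \<open>w\<close> vanishes.\<close>

definition gr_johnson :: "nat \<Rightarrow> (nat \<Rightarrow> ((nat \<times> bool) list \<Rightarrow> (nat \<times> bool) list) set) \<Rightarrow>
    nat \<Rightarrow> nat list \<Rightarrow> int" where
  "gr_johnson n f k w = (if length w < 2 then 0 else
     johnson (SOME a. a \<in> lower_central (I_group n) (length w - 1) \<and>
       f (length w - 1) = lower_central (I_group n) (length w) #>\<^bsub>I_group n\<^esub> a) k w)"

lemma gr_johnson_eq:
  assumes c: "1 \<le> c" "length w = Suc c" and k: "k \<in> {1..n}"
    and a: "a \<in> lower_central (I_group n) c" "f c = lower_central (I_group n) (Suc c) #>\<^bsub>I_group n\<^esub> a"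
  shows "gr_johnson n f k w = johnson a k w"
proof -
  interpret I: group "I_group n" by (rule group_I_group)
  let ?P = "\<lambda>a. a \<in> lower_central (I_group n) c \<and>
    f c = lower_central (I_group n) (Suc c) #>\<^bsub>I_group n\<^esub> a"
  define b where "b = (SOME a. ?P a)"
  have b: "?P b" unfolding b_def by (rule someI[of ?P a]) (use a in simp)
  have car: "a \<in> carrier (I_group n)" "b \<in> carrier (I_group n)"
    using a b I.lower_central_carrier by auto
  let ?u = "b \<otimes>\<^bsub>I_group n\<^esub> inv\<^bsub>I_group n\<^esub> a"
  have u: "?u \<in> lower_central (I_group n) (Suc c)"
    using a b car I.rcos_eq_iff[OF I.normal_lower_central, of b a "Suc c"] by simp
  then have u': "?u \<in> group.andreadakis (F n) c" "?u \<in> group.andreadakis (F n) (Suc c)"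
    using I.lower_central_Suc_subset I_group_le_andreadakis[of c n] I_group_le_andreadakis[of "Suc c" n] c
    by auto
  have b_eq: "?u \<otimes>\<^bsub>AutoGroup (F n)\<^esub> a = b"
    using car by (simp add: mult_I_group[symmetric] I.m_assoc)
  have "johnson b k w = johnson ?u k w + johnson a k w"
    using johnson_mult[OF u'(1) subsetD[OF I_group_le_andreadakis[OF c(1)] a(1)] c(1) k c(2)]
    unfolding b_eq .
  also have "johnson ?u k w = 0" using johnson_zero[OF u'(2) k] c by simp
  finally show ?thesis using c by (simp add: gr_johnson_def b_def)
qed

lemma gr_johnson_add:
  assumes f: "f \<in> carrier (gr (I_group n))" and g: "g \<in> carrier (gr (I_group n))" and k: "k \<in> {1..n}"
  shows "gr_johnson n (f \<oplus>\<^bsub>gr (I_group n)\<^esub> g) k w = gr_johnson n f k w + gr_johnson n g k w"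
proof (cases "length w < 2")
  case False
  interpret I: group "I_group n" by (rule group_I_group)
  define c where "c = length w - 1"
  have c: "1 \<le> c" "length w = Suc c" using False by (auto simp: c_def)
  obtain a where a: "a \<in> lower_central (I_group n) c"
    "f c = lower_central (I_group n) (Suc c) #>\<^bsub>I_group n\<^esub> a"
    using I.gr_nth[OF f c(1)] .
  obtain b where b: "b \<in> lower_central (I_group n) c"
    "g c = lower_central (I_group n) (Suc c) #>\<^bsub>I_group n\<^esub> b"
    using I.gr_nth[OF g c(1)] .
  have car: "a \<in> carrier (I_group n)" "b \<in> carrier (I_group n)"
    using a b I.lower_central_carrier by auto
  have "(f \<oplus>\<^bsub>gr (I_group n)\<^esub> g) c = lower_central (I_group n) (Suc c) #>\<^bsub>I_group n\<^esub> (a \<otimes>\<^bsub>I_group n\<^esub> b)"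
    using c a b car by (simp add: I.add_gr I.rcos_mult_lower_central del: lower_central.simps)
  moreover have "a \<otimes>\<^bsub>I_group n\<^esub> b \<in> lower_central (I_group n) c"
    using a b I.lower_central_mult by blast
  ultimately have "gr_johnson n (f \<oplus>\<^bsub>gr (I_group n)\<^esub> g) k w = johnson (a \<otimes>\<^bsub>I_group n\<^esub> b) k w"
    by (intro gr_johnson_eq[OF c k])
  also have "\<dots> = johnson a k w + johnson b k w"
    unfolding mult_I_group
    by (rule johnson_mult[OF _ _ c(1) k c(2)]) (use a b I_group_le_andreadakis[OF c(1), of n] in auto)
  finally show ?thesis using gr_johnson_eq[OF c k] a b by simp
qed (simp add: gr_johnson_def)

lemma gr_johnson_elem:
  assumes c: "1 \<le> c" and k: "k \<in> {1..n}" and a: "a \<in> lower_central (I_group n) c"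
  shows "gr_johnson n (gr_elem (I_group n) c a) k w = (if length w = Suc c then johnson a k w else 0)"
proof (cases "length w < 2")
  case True
  then show ?thesis using c by (simp add: gr_johnson_def)
next
  case False
  interpret I: group "I_group n" by (rule group_I_group)
  interpret A: group "AutoGroup (F n)" by (rule group.AutoGroup[OF group_free_group])
  define d where "d = length w - 1"
  have d: "1 \<le> d" "length w = Suc d" using False by (auto simp: d_def)
  show ?thesis
  proof (cases "d = c")
    case True
    then show ?thesis
      using d gr_johnson_eq[OF d k, of a] a by (simp add: gr_elem_def del: lower_central.simps)
  next
    case False
    note one = I.lower_central_one
    have "gr_elem (I_group n) c a d = lower_central (I_group n) (Suc d) #>\<^bsub>I_group n\<^esub> \<one>\<^bsub>I_group n\<^esub>"
      using False d I.rcos_one[OF I.normal_lower_central one]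
      by (simp add: gr_elem_def del: lower_central.simps)
    then have "gr_johnson n (gr_elem (I_group n) c a) k w = johnson \<one>\<^bsub>I_group n\<^esub> k w"
      using one by (intro gr_johnson_eq[OF d k])
    also have "\<dots> = 0"
      using one[of "Suc d"] I_group_le_andreadakis[of "Suc d" n] d
      by (intro johnson_zero[OF _ k, of _ "Suc d"]) auto
    finally show ?thesis using False d by simp
  qed
qed

text \<open>The tree is evaluated as an iterated group commutator twice, in \<open>I_group n\<close>
  on the \<open>y_inv n m i\<close> and in the free group on the \<open>x_i\<close>. The first
  result \<open>a\<close> acts on block \<open>m\<close> as conjugation by the second,
  \<open>g\<close>. So \<open>a\<close> carries the class in the graded ring and \<open>g\<close>
  the Lie polynomial.\<close>

lemma hall_realization:
  assumes m: "2 \<le> m" "m \<le> n" and t: "hall {1..m} t"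
  shows "\<exists>a g. a \<in> lower_central (I_group n) (length (foliage t)) \<and> block_conj n m g a \<and>
    lie_eval (gr (I_group n)) (\<lambda>i. gr_elem (I_group n) 1 (y_inv n m i)) t =
      gr_elem (I_group n) (length (foliage t)) a \<and>
    ord_ge (Suc (length (foliage t))) (magnus g - 1 - lie_poly t)"
  using t
proof (induction rule: hall.induct)
  case (Gen i)
  have b: "block_conj n m (free_gen i) (y_inv n m i)" using Gen m by (intro block_conj_y) auto
  have "magnus (free_gen i) - 1 - lie_poly (Gen i) = 0" by (simp add: magnus_gen)
  then have "ord_ge (Suc (length (foliage (Gen i)))) (magnus (free_gen i) - 1 - lie_poly (Gen i))"
    by (simp only: ord_ge_0(2))
  then show ?case using b block_conjD(2)[OF b]
    by (intro exI[of _ "y_inv n m i"] exI[of _ "free_gen i"]) (simp add: One_nat_def)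
next
  case (Br s t)
  interpret I: group "I_group n" by (rule group_I_group)
  let ?s = "length (foliage s)" and ?t = "length (foliage t)"
  have pos: "1 \<le> ?s" "1 \<le> ?t" using Br(1,2) foliage_neq_Nil by (auto simp: Suc_le_eq One_nat_def)
  obtain a g where a: "a \<in> lower_central (I_group n) ?s" "block_conj n m g a"
    "lie_eval (gr (I_group n)) (\<lambda>i. gr_elem (I_group n) 1 (y_inv n m i)) s = gr_elem (I_group n) ?s a"
    "ord_ge (Suc ?s) (magnus g - 1 - lie_poly s)" using Br.IH(1) by blast
  obtain b h where b: "b \<in> lower_central (I_group n) ?t" "block_conj n m h b"
    "lie_eval (gr (I_group n)) (\<lambda>i. gr_elem (I_group n) 1 (y_inv n m i)) t = gr_elem (I_group n) ?t b"
    "ord_ge (Suc ?t) (magnus h - 1 - lie_poly t)" using Br.IH(2) by blast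
  have "group_commutator (I_group n) a b \<in> lower_central (I_group n) (?s + ?t)"
    using a(1) b(1) pos by (intro I.lower_central_commutator)
  moreover have "block_conj n m (group_commutator (F n) g h) (group_commutator (I_group n) a b)"
    using a(2) b(2) by (rule block_conj_commutator)
  moreover have "lie_eval (gr (I_group n)) (\<lambda>i. gr_elem (I_group n) 1 (y_inv n m i)) (Br s t) =
      gr_elem (I_group n) (?s + ?t) (group_commutator (I_group n) a b)"
    using a(1,3) b(1,3) pos by (simp add: I.gr_elem_bracket)
  moreover have "ord_ge (Suc (?s + ?t)) (magnus (group_commutator (F n) g h) - 1 -
      (lie_poly s * lie_poly t - lie_poly t * lie_poly s))"
    by (rule magnus_commutator_leading[OF block_conjD(4)[OF a(2)] block_conjD(4)[OF b(2)]
      ord_ge_lie_poly[OF Br(1)] a(4) ord_ge_lie_poly[OF Br(2)] b(4)])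
  ultimately show ?case
    by (intro exI[of _ "group_commutator (I_group n) a b"] exI[of _ "group_commutator (F n) g h"]) simp
qed

section \<open>The relators\<close>

lemma inv_y_inv:
  assumes "2 \<le> m" "m \<le> n" "1 \<le> i" "i \<le> m"
  shows "inv\<^bsub>I_group n\<^esub> y_inv n m i = y_aut n m i"
  unfolding y_inv_def by (rule group.inv_inv[OF group_I_group y_aut_in_I_group[OF assms]])

lemma y_inv_in_I_group: "\<lbrakk>2 \<le> m; m \<le> n; 1 \<le> i; i \<le> m\<rbrakk> \<Longrightarrow> y_inv n m i \<in> carrier (I_group n)"
  using block_conjD(2)[OF block_conj_y] .

text \<open>The automorphism \<open>y_aut n r j\<close> fixes \<open>x_i\<close>, either as a
  conjugation of \<open>x_j\<close> by itself or because \<open>i > r\<close> is outside its range.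
  Hence conjugating with it fixes the conjugation by \<open>x_i\<close>; the relation holds in the
  group itself.\<close>

lemma commutator_y_inv_trivial:
  assumes r: "2 \<le> r" "r < m" "m \<le> n" "1 \<le> i" "i \<le> m" "1 \<le> j" "j \<le> r" and "i = j \<or> r < i"
  shows "group_commutator (I_group n) (y_inv n m i) (y_inv n r j) = \<one>\<^bsub>I_group n\<^esub>"
proof -
  interpret F: group "F n" by (rule group_free_group)
  interpret I: group "I_group n" by (rule group_I_group)
  let ?a = "y_inv n m i" and ?b = "y_inv n r j"
  have a: "block_conj n m (free_gen i) ?a" and b: "block_conj n r (free_gen j) ?b"
    using r by (auto intro: block_conj_y)
  note ac = block_conjD(2)[OF a] block_conjD(2)[OF b]
  have "free_gen i \<in> carrier (F n)" using r by (intro free_gen_in_carrier) simp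
  then have "y_aut n r j (free_gen i) = free_gen i"
    using r assms(8) by (auto simp: y_aut_gen)
  then have "block_conj n m (free_gen i) (inv\<^bsub>I_group n\<^esub> ?b \<otimes>\<^bsub>I_group n\<^esub> ?a \<otimes>\<^bsub>I_group n\<^esub> ?b)"
    using block_conj_conj[OF a b] inv_y_inv[of r n j] r by simp
  then have "inv\<^bsub>I_group n\<^esub> ?b \<otimes>\<^bsub>I_group n\<^esub> ?a \<otimes>\<^bsub>I_group n\<^esub> ?b = ?a"
    using a by (rule block_conj_unique)
  then show ?thesis using ac by (simp add: group_commutator_def I.m_assoc)
qed

text \<open>For \<open>i \<le> r\<close> conjugation by \<open>x_j\<close> on the smaller block
  moves \<open>x_i\<close> in the same way as on the larger one, so both conjugates of
  \<open>y_inv n m i\<close> are conjugations of block \<open>m\<close> by the same element.\<close>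

lemma commutator_y_inv_lift:
  assumes r: "2 \<le> r" "r < m" "m \<le> n" "1 \<le> i" "i \<le> r" "1 \<le> j" "j \<le> r"
  shows "group_commutator (I_group n) (y_inv n m i) (y_inv n r j) =
    group_commutator (I_group n) (y_inv n m i) (y_inv n m j)"
proof -
  interpret I: group "I_group n" by (rule group_I_group)
  let ?a = "y_inv n m i" and ?b = "y_inv n r j" and ?c = "y_inv n m j"
  have a: "block_conj n m (free_gen i) ?a" and b: "block_conj n r (free_gen j) ?b"
    and c: "block_conj n m (free_gen j) ?c"
    using r by (auto intro: block_conj_y)
  note car = block_conjD(2)[OF a] block_conjD(2)[OF b] block_conjD(2)[OF c]
  have "y_aut n r j (free_gen i) = y_aut n m j (free_gen i)"
    using r by (simp add: y_aut_gen)
  then have "inv\<^bsub>I_group n\<^esub> ?b \<otimes>\<^bsub>I_group n\<^esub> ?a \<otimes>\<^bsub>I_group n\<^esub> ?b = inv\<^bsub>I_group n\<^esub> ?c \<otimes>\<^bsub>I_group n\<^esub> ?a \<otimes>\<^bsub>I_group n\<^esub> ?c"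
    using block_conj_conj[OF a b] block_conj_conj[OF a c] r inv_y_inv[of r n j] inv_y_inv[of m n j]
    by (intro block_conj_unique[of n m "y_aut n m j (free_gen i)"]) simp_all
  then show ?thesis using car by (simp add: group_commutator_def I.m_assoc)
qed

section \<open>Ideals and quotients of Lie rings\<close>

context lie_ring
begin

lemma lie_ideal_carrier: "lie_ideal (carrier L) L"
  unfolding lie_ideal_def
  using bracket_closed by (auto intro!: additive_subgroup.intro add.subgroup_self)

lemma gen_lie_ideal_incl: "S \<subseteq> gen_lie_ideal L S"
  by (auto simp: gen_lie_ideal_def)

lemma gen_lie_ideal_minimal: "lie_ideal I L \<Longrightarrow> S \<subseteq> I \<Longrightarrow> gen_lie_ideal L S \<subseteq> I"
  by (auto simp: gen_lie_ideal_def)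

lemma lie_ideal_gen:
  assumes "S \<subseteq> carrier L" shows "lie_ideal (gen_lie_ideal L S) L"
proof -
  let ?\<I> = "{I. lie_ideal I L \<and> S \<subseteq> I}"
  have ne: "carrier L \<in> ?\<I>" using lie_ideal_carrier assms by simp
  have sub: "subgroup I (add_monoid L)" if "I \<in> ?\<I>" for I
    using that by (simp add: lie_ideal_def additive_subgroup_def)
  have "subgroup (\<Inter>?\<I>) (add_monoid L)"
    by (rule add.subgroups_Inter[OF sub]) (use ne in blast)+
  then show ?thesis
    unfolding gen_lie_ideal_def by (auto simp: lie_ideal_def additive_subgroup_def)
qed

end

text \<open>The additive part is the first isomorphism theorem for groups. The product of two cosets
  in the quotient is a union over representatives; since a Lie ring is not an associative ring, that
  this union is a single coset is derived from bilinearity and the Lie ideal property.\<close>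

lemma lie_isomorphic_quotient:
  assumes R: "lie_ring R" and M: "lie_ring M" and I: "lie_ideal I R" and f: "f \<in> lie_hom R M"
    and surj: "f ` carrier R = carrier M"
    and ker: "\<And>x. x \<in> carrier R \<Longrightarrow> f x = \<zero>\<^bsub>M\<^esub> \<longleftrightarrow> x \<in> I"
  shows "lie_isomorphic (R Quot I) M"
proof -
  interpret R: lie_ring R by fact
  interpret M: lie_ring M by fact
  interpret f: group_hom "add_monoid R" "add_monoid M" f
    by (intro group_hom.intro group_hom_axioms.intro R.a_group M.a_group)
      (use f in \<open>simp add: lie_hom_def\<close>)
  have Isub: "I \<subseteq> carrier R" using I additive_subgroup.a_subset by (auto simp: lie_ideal_def)
  have K: "kernel (add_monoid R) (add_monoid M) f = I"
    using ker Isub by (auto simp: kernel_def)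
  define g where "g = (\<lambda>A. the_elem (f ` A))"
  have eq: "add_monoid (R Quot I) = add_monoid R Mod I"
    by (rule monoid.equality) (simp_all add: FactRing_def FactGroup_def A_RCOSETS_def' RCOSETS_def
      a_r_coset_def' r_coset_def set_add_def)
  have "g \<in> Group.iso (add_monoid R Mod I) (add_monoid M)"
    using f.FactGroup_iso_set surj unfolding K g_def by simp
  then have g: "g \<in> hom (add_monoid (R Quot I)) (add_monoid M)"
    "bij_betw g (carrier (R Quot I)) (carrier M)"
    unfolding eq[symmetric] by (simp_all add: Group.iso_def)
  interpret I: abelian_subgroup I R
    using I by (intro abelian_subgroupI3 R.abelian_group_axioms) (simp add: lie_ideal_def)
  have g_coset: "g (I +>\<^bsub>R\<^esub> x) = f x" if x: "x \<in> carrier R" for x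
  proof -
    have "f u = f x" if u: "u \<in> I +>\<^bsub>R\<^esub> x" for u
    proof -
      obtain i where i: "i \<in> I" "u = i \<oplus>\<^bsub>R\<^esub> x" using u by (auto simp: a_r_coset_def')
      then have "f u = f i \<oplus>\<^bsub>M\<^esub> f x" using f.hom_mult[of i x] Isub x by auto
      then show ?thesis using ker[of i] i Isub x f.hom_closed[of x] by auto
    qed
    moreover have "x \<in> I +>\<^bsub>R\<^esub> x" using I.a_rcos_self[OF x] .
    ultimately have "f ` (I +>\<^bsub>R\<^esub> x) = {f x}" by blast
    then show ?thesis by (simp add: g_def)
  qed
  have mult: "g (A \<otimes>\<^bsub>R Quot I\<^esub> B) = g A \<otimes>\<^bsub>M\<^esub> g B"
    if AB: "A \<in> carrier (R Quot I)" "B \<in> carrier (R Quot I)" for A B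
  proof -
    obtain x y where x: "x \<in> carrier R" "A = I +>\<^bsub>R\<^esub> x" and y: "y \<in> carrier R" "B = I +>\<^bsub>R\<^esub> y"
      using AB by (auto simp: FactRing_def A_RCOSETS_def' a_r_coset_def')
    have "I +>\<^bsub>R\<^esub> (u \<otimes>\<^bsub>R\<^esub> v) = I +>\<^bsub>R\<^esub> (x \<otimes>\<^bsub>R\<^esub> y)" if u: "u \<in> A" and v: "v \<in> B" for u v
    proof -
      obtain i where i: "i \<in> I" "u = i \<oplus>\<^bsub>R\<^esub> x" using u x by (auto simp: a_r_coset_def')
      obtain j where j: "j \<in> I" "v = j \<oplus>\<^bsub>R\<^esub> y" using v y by (auto simp: a_r_coset_def')
      have c: "i \<in> carrier R" "j \<in> carrier R" using i j Isub by auto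
      have "i \<otimes>\<^bsub>R\<^esub> v \<in> I" "x \<otimes>\<^bsub>R\<^esub> j \<in> I"
        using lie_idealD[OF I] i j c x y by simp_all
      then have "i \<otimes>\<^bsub>R\<^esub> v \<oplus>\<^bsub>R\<^esub> x \<otimes>\<^bsub>R\<^esub> j \<in> I" by (rule I.a_closed)
      moreover have "u \<otimes>\<^bsub>R\<^esub> v = (i \<otimes>\<^bsub>R\<^esub> v \<oplus>\<^bsub>R\<^esub> x \<otimes>\<^bsub>R\<^esub> j) \<oplus>\<^bsub>R\<^esub> x \<otimes>\<^bsub>R\<^esub> y"
        using i j c x y by (simp add: R.bracket_add_left R.bracket_add_right R.bracket_closed R.a_ac)
      ultimately have "u \<otimes>\<^bsub>R\<^esub> v \<in> I +>\<^bsub>R\<^esub> (x \<otimes>\<^bsub>R\<^esub> y)" by (auto simp: a_r_coset_def')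
      then show ?thesis using I.a_repr_independence' x y R.bracket_closed by metis
    qed
    then have coset: "(\<Union>u\<in>A. \<Union>v\<in>B. I +>\<^bsub>R\<^esub> (u \<otimes>\<^bsub>R\<^esub> v)) =
        (\<Union>u\<in>A. \<Union>v\<in>B. I +>\<^bsub>R\<^esub> (x \<otimes>\<^bsub>R\<^esub> y))"
      by (intro SUP_cong HOL.refl)
    have "x \<in> A" "y \<in> B" unfolding x(2) y(2) by (rule I.a_rcos_self[OF x(1)], rule I.a_rcos_self[OF y(1)])
    then have "A \<otimes>\<^bsub>R Quot I\<^esub> B = I +>\<^bsub>R\<^esub> (x \<otimes>\<^bsub>R\<^esub> y)"
      using coset by (simp add: FactRing_def rcoset_mult_def) blast
    then show ?thesis
      using x y f g_coset R.bracket_closed by (simp add: lie_hom_def)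
  qed
  show ?thesis unfolding lie_isomorphic_def lie_hom_def using g mult by blast
qed

section \<open>The presentation of the graded Lie ring\<close>

lemma y_gen_closed: "\<lbrakk>2 \<le> m; m \<le> n; 1 \<le> i; i \<le> m\<rbrakk> \<Longrightarrow> y_gen n m i \<in> carrier (L n)"
  by (simp add: y_gen_def carrier_free_lie_ring y_index_def)

lemma lie_eval_hom:
  assumes R: "lie_ring R" and M: "lie_ring M" and f: "f \<in> lie_hom R M"
    and h: "h \<in> X \<rightarrow> carrier R" and t: "hall X t"
  shows "f (lie_eval R h t) = lie_eval M (\<lambda>x. f (h x)) t"
  using t
proof (induction rule: hall.induct)
  case (Br s t)
  interpret R: lie_ring R by fact
  have "lie_eval R h s \<in> carrier R" "lie_eval R h t \<in> carrier R"
    using R.lie_eval_closed[OF h] hall_lie_terms Br by auto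
  then show ?case using f Br.IH by (simp add: lie_hom_def)
qed simp

text \<open>The map \<open>\<Phi>\<close> is a parameter because the universal property of the free
  Lie ring supplies it by existence only; the final theorem instantiates it.\<close>

locale I_group_presentation =
  fixes n :: nat and \<Phi>
  assumes hom: "\<Phi> \<in> lie_hom (L n) (gr (I_group n))"
    and gen: "\<And>m i. \<lbrakk>2 \<le> m; m \<le> n; 1 \<le> i; i \<le> m\<rbrakk> \<Longrightarrow>
      \<Phi> (y_gen n m i) = gr_elem (I_group n) 1 (y_inv n m i)"

sublocale I_group_presentation \<subseteq> L: lie_ring "L n"
  by (rule lie_ring_free_lie_ring)

sublocale I_group_presentation \<subseteq> I: group "I_group n"
  by (rule group_I_group)

sublocale I_group_presentation \<subseteq> M: lie_ring "gr (I_group n)"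
  by (rule group.lie_ring_gr[OF group_I_group])

context I_group_presentation
begin

lemma \<Phi>_closed: "x \<in> carrier (L n) \<Longrightarrow> \<Phi> x \<in> carrier (gr (I_group n))"
  using hom by (auto simp: lie_hom_def hom_def)

lemma \<Phi>_add: "\<lbrakk>x \<in> carrier (L n); y \<in> carrier (L n)\<rbrakk> \<Longrightarrow> \<Phi> (x \<oplus>\<^bsub>L n\<^esub> y) = \<Phi> x \<oplus>\<^bsub>gr (I_group n)\<^esub> \<Phi> y"
  using hom by (auto simp: lie_hom_def hom_def)

lemma \<Phi>_bracket: "\<lbrakk>x \<in> carrier (L n); y \<in> carrier (L n)\<rbrakk> \<Longrightarrow> \<Phi> (x \<otimes>\<^bsub>L n\<^esub> y) = \<Phi> x \<otimes>\<^bsub>gr (I_group n)\<^esub> \<Phi> y"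
  using hom by (auto simp: lie_hom_def)

lemma \<Phi>_group_hom: "group_hom (add_monoid (L n)) (add_monoid (gr (I_group n))) \<Phi>"
  by (intro group_hom.intro group_hom_axioms.intro L.a_group M.a_group)
    (use hom in \<open>simp add: lie_hom_def\<close>)

lemma \<Phi>_zero: "\<Phi> \<zero>\<^bsub>L n\<^esub> = \<zero>\<^bsub>gr (I_group n)\<^esub>"
  using group_hom.hom_one[OF \<Phi>_group_hom] by simp

lemma \<Phi>_minus: "x \<in> carrier (L n) \<Longrightarrow> \<Phi> (\<ominus>\<^bsub>L n\<^esub> x) = \<ominus>\<^bsub>gr (I_group n)\<^esub> \<Phi> x"
  using group_hom.hom_inv[OF \<Phi>_group_hom] by (simp add: a_inv_def)

lemma \<Phi>_gen_bracket:
  assumes "2 \<le> m" "m \<le> n" "1 \<le> i" "i \<le> m" "2 \<le> r" "r \<le> n" "1 \<le> j" "j \<le> r"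
  shows "\<Phi> (y_gen n m i \<otimes>\<^bsub>L n\<^esub> y_gen n r j) =
    gr_elem (I_group n) 2 (group_commutator (I_group n) (y_inv n m i) (y_inv n r j))"
proof -
  have "y_inv n m i \<in> lower_central (I_group n) 1" "y_inv n r j \<in> lower_central (I_group n) 1"
    using assms y_inv_in_I_group by (simp_all add: One_nat_def)
  then show ?thesis
    using assms I.gr_elem_bracket[of 1 1 "y_inv n m i" "y_inv n r j"]
    by (simp add: \<Phi>_bracket y_gen_closed gen)
qed

lemma lie_ideal_kernel: "lie_ideal {x \<in> carrier (L n). \<Phi> x = \<zero>\<^bsub>gr (I_group n)\<^esub>} (L n)"
proof -
  have "subgroup (kernel (add_monoid (L n)) (add_monoid (gr (I_group n))) \<Phi>) (add_monoid (L n))"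
    by (rule group_hom.subgroup_kernel[OF \<Phi>_group_hom])
  then show ?thesis
    unfolding lie_ideal_def additive_subgroup_def
    by (auto simp: kernel_def \<Phi>_bracket L.bracket_closed \<Phi>_closed)
qed

lemma J_relators_sub: "J_relators n \<subseteq> {x \<in> carrier (L n). \<Phi> x = \<zero>\<^bsub>gr (I_group n)\<^esub>}"
proof
  fix x assume "x \<in> J_relators n"
  then consider
      (1) m r i where "x = y_gen n m i \<otimes>\<^bsub>L n\<^esub> y_gen n r i" "2 \<le> r" "r < m" "m \<le> n" "1 \<le> i" "i \<le> r"
    | (2) m r i j where "x = y_gen n m i \<otimes>\<^bsub>L n\<^esub> y_gen n r j" "2 \<le> r" "r < i" "i \<le> m" "m \<le> n" "1 \<le> j" "j \<le> r"
    | (3) m r i j where "x = y_gen n m i \<otimes>\<^bsub>L n\<^esub> y_gen n r j \<ominus>\<^bsub>L n\<^esub> y_gen n m i \<otimes>\<^bsub>L n\<^esub> y_gen n m j"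
        "2 \<le> r" "r < m" "m \<le> n" "1 \<le> i" "i \<le> r" "1 \<le> j" "j \<le> r"
    unfolding J_relators_def by blast
  then show "x \<in> {x \<in> carrier (L n). \<Phi> x = \<zero>\<^bsub>gr (I_group n)\<^esub>}"
  proof cases
    case 1
    then show ?thesis
      using commutator_y_inv_trivial[of r m n i i] I.gr_elem_eq_zero_iff[of "\<one>\<^bsub>I_group n\<^esub>" 2]
        I.lower_central_one
      by (simp add: \<Phi>_gen_bracket L.bracket_closed y_gen_closed)
  next
    case 2
    then show ?thesis
      using commutator_y_inv_trivial[of r m n i j] I.gr_elem_eq_zero_iff[of "\<one>\<^bsub>I_group n\<^esub>" 2]
        I.lower_central_one
      by (simp add: \<Phi>_gen_bracket L.bracket_closed y_gen_closed)
  next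
    case 3
    have c: "y_gen n m i \<otimes>\<^bsub>L n\<^esub> y_gen n r j \<in> carrier (L n)" "y_gen n m i \<otimes>\<^bsub>L n\<^esub> y_gen n m j \<in> carrier (L n)"
      using 3 by (simp_all add: L.bracket_closed y_gen_closed)
    have "\<Phi> (y_gen n m i \<otimes>\<^bsub>L n\<^esub> y_gen n r j) = \<Phi> (y_gen n m i \<otimes>\<^bsub>L n\<^esub> y_gen n m j)"
      using 3 commutator_y_inv_lift[of r m n i j] by (simp add: \<Phi>_gen_bracket)
    then show ?thesis
      using 3(1) c by (simp add: a_minus_def \<Phi>_add \<Phi>_minus M.r_neg \<Phi>_closed)
  qed
qed

lemma lie_ideal_J: "lie_ideal (J n) (L n)"
  unfolding J_def using J_relators_sub by (intro L.lie_ideal_gen) blast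

lemma J_sub: "J n \<subseteq> {x \<in> carrier (L n). \<Phi> x = \<zero>\<^bsub>gr (I_group n)\<^esub>}"
  unfolding J_def by (rule L.gen_lie_ideal_minimal[OF lie_ideal_kernel J_relators_sub])

lemma J_relators_J: "x \<in> J_relators n \<Longrightarrow> x \<in> J n"
  unfolding J_def using L.gen_lie_ideal_incl by blast

end

text \<open>Relators of the first two kinds put the bracket into \<open>J n\<close>. In the
  remaining case \<open>i \<le> r\<close>, \<open>j \<noteq> i\<close> the third kind replaces
  \<open>y_gen n r j\<close> by \<open>y_gen n m j\<close>, and the bracket becomes one inside block
  \<open>m\<close>.\<close>

sublocale I_group_presentation \<subseteq> B: block_lie_ring "L n" "J n" n "y_gen n"
proof (unfold_locales)
  show "lie_ideal (J n) (L n)" by (rule lie_ideal_J)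
  show "y_gen n m i \<in> carrier (L n)" if "2 \<le> m" "m \<le> n" "1 \<le> i" "i \<le> m" for m i
    using that by (rule y_gen_closed)
  fix m r i j assume *: "2 \<le> r" "r < m" "m \<le> n" "1 \<le> i" "i \<le> m" "1 \<le> j" "j \<le> r"
  let ?H = "lie_eval (L n) (y_gen n m) ` {t. hall {1..m} t}"
  have h: "y_gen n m \<in> {1..m} \<rightarrow> carrier (L n)" using * y_gen_closed by auto
  have Hsub: "L.lspan ?H \<subseteq> L.lspan (?H \<union> J n)" by (rule L.lspan_mono) simp
  consider "i = j" | "r < i" | "i \<le> r" "j \<noteq> i" by linarith
  then show "y_gen n m i \<otimes>\<^bsub>L n\<^esub> y_gen n r j \<in> L.lspan (?H \<union> J n)"
  proof cases
    case 1
    then have "y_gen n m i \<otimes>\<^bsub>L n\<^esub> y_gen n r j \<in> J_relators n"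
      using * unfolding J_relators_def by blast
    then show ?thesis using J_relators_J by (intro L.lspan_incl) simp
  next
    case 2
    then have "y_gen n m i \<otimes>\<^bsub>L n\<^esub> y_gen n r j \<in> J_relators n"
      using * unfolding J_relators_def by blast
    then show ?thesis using J_relators_J by (intro L.lspan_incl) simp
  next
    case 3
    let ?a = "y_gen n m i \<otimes>\<^bsub>L n\<^esub> y_gen n r j" and ?b = "y_gen n m i \<otimes>\<^bsub>L n\<^esub> y_gen n m j"
    have "?a \<ominus>\<^bsub>L n\<^esub> ?b \<in> J_relators n"
      using * 3 unfolding J_relators_def by blast
    then have 1: "?a \<ominus>\<^bsub>L n\<^esub> ?b \<in> L.lspan (?H \<union> J n)"
      using J_relators_J by (intro L.lspan_incl) simp
    have in_H: "y_gen n m k \<in> L.lspan ?H" if "1 \<le> k" "k \<le> m" for k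
      by (rule L.lspan_incl, rule image_eqI[of _ _ "Gen k"]) (use that in \<open>auto intro: hall.Gen\<close>)
    have "?b \<in> L.lspan ?H"
      by (rule L.hall_lspan_bracket[OF _ h]) (use in_H * in auto)
    then have "(?a \<ominus>\<^bsub>L n\<^esub> ?b) \<oplus>\<^bsub>L n\<^esub> ?b \<in> L.lspan (?H \<union> J n)"
      using 1 Hsub by (intro L.lspan_add) auto
    moreover have "(?a \<ominus>\<^bsub>L n\<^esub> ?b) \<oplus>\<^bsub>L n\<^esub> ?b = ?a"
      using * y_gen_closed L.bracket_closed by (simp add: a_minus_def L.a_assoc L.l_neg)
    ultimately show ?thesis by simp
  qed
qed

context I_group_presentation
begin

text \<open>\<open>B.total\<close> is a subgroup closed under brackets and contains the generators,
  hence the class of every Lie expression.\<close>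

lemma carrier_L_eq_total: "carrier (L n) = B.total"
proof
  show "B.total \<subseteq> carrier (L n)"
    unfolding B.total_def using L.lspan_closed[OF B.total_sub] by blast
  have "lie_class (y_index n) t \<in> B.total" if "t \<in> lie_terms (y_index n)" for t
    using that
  proof (induction t)
    case (Gen p)
    then obtain m i where p: "p = (m, i)" "2 \<le> m" "m \<le> n" "1 \<le> i" "i \<le> m"
      by (auto simp: y_index_def)
    show ?case unfolding p(1) y_gen_def[symmetric] by (rule B.y_in_total[OF p(2-5)])
  next
    case Zero
    show ?case unfolding zero_free_lie_ring[symmetric] B.total_def by (rule L.lspan_zero)
  next
    case (Neg s)
    have "lie_class (y_index n) (Neg s) = \<ominus>\<^bsub>L n\<^esub> lie_class (y_index n) s"
      by (rule L.minus_equality[symmetric])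
        (use Neg in \<open>auto simp: add_free_lie_ring zero_free_lie_ring carrier_free_lie_ring
          lie_class_eq_iff intro: lie_cong.add_neg\<close>)
    then show ?case using Neg L.lspan_minus[OF B.total_sub] by (simp add: B.total_def)
  next
    case (Add s t)
    then show ?case
      using L.lspan_add by (simp add: B.total_def add_free_lie_ring[symmetric])
  next
    case (Br s t)
    then show ?case
      using B.total_bracket by (simp add: mult_free_lie_ring[symmetric])
  qed
  then show "carrier (L n) \<subseteq> B.total" by (auto simp: carrier_free_lie_ring)
qed

section \<open>Surjectivity\<close>

lemma gr_elem_1_in_image:
  assumes "a \<in> carrier (I_group n)"
  shows "gr_elem (I_group n) 1 a \<in> \<Phi> ` carrier (L n)"
proof -
  have lc: "x \<in> lower_central (I_group n) 1" if "x \<in> carrier (I_group n)" for x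
    using that by (simp add: One_nat_def)
  interpret A: group "AutoGroup (F n)" by (rule group.AutoGroup[OF group_free_group])
  have "a \<in> generate (AutoGroup (F n)) (carrier (AutoGroup (F n)) \<inter>
      {y_aut n m i | m i. 2 \<le> m \<and> m \<le> n \<and> 1 \<le> i \<and> i \<le> m})"
    using assms unfolding I_group_def carrier_subgroup_generated .
  then have "a \<in> carrier (I_group n) \<and> gr_elem (I_group n) 1 a \<in> \<Phi> ` carrier (L n)"
  proof (induction rule: generate.induct)
    case one
    have "gr_elem (I_group n) 1 \<one>\<^bsub>I_group n\<^esub> = \<zero>\<^bsub>gr (I_group n)\<^esub>"
      using I.gr_elem_eq_zero_iff[OF lc[OF I.one_closed]]
        I.lower_central_one by simp
    moreover have "\<one>\<^bsub>I_group n\<^esub> = \<one>\<^bsub>AutoGroup (F n)\<^esub>" by (simp add: I_group_def)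
    ultimately show ?case using \<Phi>_zero I.one_closed by (metis L.zero_closed image_eqI)
  next
    case (incl h)
    then obtain m i where h: "h = y_aut n m i" "2 \<le> m" "m \<le> n" "1 \<le> i" "i \<le> m" by blast
    note yi = y_inv_in_I_group[OF h(2-5)]
    \<comment> \<open>The group is generated by the \<open>y_aut n m i\<close>, whereas
      \<open>\<Phi>\<close> sends generators to the classes of their inverses; the sign accounts for
      it.\<close>
    have "gr_elem (I_group n) 1 h = \<Phi> (\<ominus>\<^bsub>L n\<^esub> y_gen n m i)"
      using h I.gr_elem_inv[OF lc[OF yi]] inv_y_inv[OF h(2-5)]
      by (simp add: \<Phi>_minus y_gen_closed gen)
    then show ?case using h y_gen_closed y_aut_in_I_group by simp
  next
    case (inv h)
    then obtain m i where h: "h = y_aut n m i" "2 \<le> m" "m \<le> n" "1 \<le> i" "i \<le> m" by blast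
    have "inv\<^bsub>AutoGroup (F n)\<^esub> h = inv\<^bsub>I_group n\<^esub> h"
      unfolding I_group_def
      by (rule A.inv_subgroup_generated[symmetric])
        (use y_aut_in_I_group h in \<open>simp add: I_group_def[symmetric]\<close>)
    then have "inv\<^bsub>AutoGroup (F n)\<^esub> h = y_inv n m i" using h by (simp add: y_inv_def)
    then show ?case
      using gen[OF h(2-5)] y_gen_closed[OF h(2-5)] y_inv_in_I_group[OF h(2-5)] by (metis image_eqI)
  next
    case (eng g h)
    then obtain x y where xy: "x \<in> carrier (L n)" "y \<in> carrier (L n)"
      "gr_elem (I_group n) 1 g = \<Phi> x" "gr_elem (I_group n) 1 h = \<Phi> y" by blast
    have "gr_elem (I_group n) 1 (g \<otimes>\<^bsub>I_group n\<^esub> h) = \<Phi> (x \<oplus>\<^bsub>L n\<^esub> y)"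
      using eng xy lc by (simp add: I.gr_elem_mult \<Phi>_add)
    then show ?case using eng xy by (simp add: mult_I_group[symmetric])
  qed
  then show ?thesis ..
qed

text \<open>Commutators with arbitrary group elements generate the next lower central term and
  become brackets with degree 1, so the image of \<open>\<Phi>\<close>, being closed under brackets,
  climbs from degree 1 to every degree.\<close>

lemma gr_elem_in_image:
  assumes "1 \<le> c" "a \<in> lower_central (I_group n) c"
  shows "gr_elem (I_group n) c a \<in> \<Phi> ` carrier (L n)"
  using assms
proof (induction c arbitrary: a rule: nat_induct_at_least)
  case base
  then show ?case by (intro gr_elem_1_in_image I.lower_central_carrier)
next
  case (Suc c)
  let ?S = "{group_commutator (I_group n) a b |a b. a \<in> lower_central (I_group n) c \<and> b \<in> carrier (I_group n)}"
  obtain d where c: "c = Suc d" using Suc.hyps by (cases c) (auto simp: One_nat_def)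
  have gen_eq: "lower_central (I_group n) (Suc c) = generate (I_group n) ?S"
    unfolding c lower_central.simps ..
  have comm: "h \<in> lower_central (I_group n) (Suc c)"
    "gr_elem (I_group n) (Suc c) h \<in> \<Phi> ` carrier (L n)" if hS: "h \<in> ?S" for h
  proof -
    show "h \<in> lower_central (I_group n) (Suc c)" unfolding gen_eq using hS by (rule generate.incl)
    obtain a b where ab: "a \<in> lower_central (I_group n) c" "b \<in> carrier (I_group n)"
      "h = group_commutator (I_group n) a b" using hS by blast
    have b1: "b \<in> lower_central (I_group n) 1" using ab by (simp add: One_nat_def)
    obtain x where x: "x \<in> carrier (L n)" "gr_elem (I_group n) c a = \<Phi> x"
      using Suc.IH[OF ab(1)] by auto
    obtain y where y: "y \<in> carrier (L n)" "gr_elem (I_group n) 1 b = \<Phi> y"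
      using gr_elem_1_in_image[OF ab(2)] by auto
    have "gr_elem (I_group n) (Suc c) h = \<Phi> (x \<otimes>\<^bsub>L n\<^esub> y)"
      using I.gr_elem_bracket[OF Suc.hyps _ ab(1) b1] x y ab(3) by (simp add: \<Phi>_bracket Suc_eq_plus1)
    then show "gr_elem (I_group n) (Suc c) h \<in> \<Phi> ` carrier (L n)"
      using L.bracket_closed[OF x(1) y(1)] by simp
  qed
  have "a \<in> generate (I_group n) ?S" using Suc.prems unfolding gen_eq .
  then show ?case
  proof (induction rule: generate.induct)
    case one
    note one = I.lower_central_one
    have "gr_elem (I_group n) (Suc c) \<one>\<^bsub>I_group n\<^esub> = \<Phi> \<zero>\<^bsub>L n\<^esub>"
      using I.gr_elem_eq_zero_iff[OF one, of "Suc c"] one[of "Suc (Suc c)"]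
      by (simp add: \<Phi>_zero del: lower_central.simps)
    then show ?case using L.zero_closed by simp
  next
    case (incl h)
    then show ?case by (rule comm)
  next
    case (inv h)
    obtain x where x: "x \<in> carrier (L n)" "gr_elem (I_group n) (Suc c) h = \<Phi> x"
      using comm(2)[OF inv] by auto
    then have "gr_elem (I_group n) (Suc c) (inv\<^bsub>I_group n\<^esub> h) = \<Phi> (\<ominus>\<^bsub>L n\<^esub> x)"
      using I.gr_elem_inv[OF comm(1)[OF inv]] by (simp add: \<Phi>_minus)
    then show ?case using x by simp
  next
    case (eng g h)
    obtain x where x: "x \<in> carrier (L n)" "gr_elem (I_group n) (Suc c) g = \<Phi> x"
      using eng.IH(1) by auto
    obtain y where y: "y \<in> carrier (L n)" "gr_elem (I_group n) (Suc c) h = \<Phi> y"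
      using eng.IH(2) by auto
    have "gr_elem (I_group n) (Suc c) (g \<otimes>\<^bsub>I_group n\<^esub> h) = \<Phi> (x \<oplus>\<^bsub>L n\<^esub> y)"
      using I.gr_elem_mult[OF eng.hyps[folded gen_eq]] x y by (simp add: \<Phi>_add)
    then show ?case using x y by simp
  qed
qed

lemma \<Phi>_surj: "\<Phi> ` carrier (L n) = carrier (gr (I_group n))"
proof
  show "\<Phi> ` carrier (L n) \<subseteq> carrier (gr (I_group n))" using \<Phi>_closed by blast
  show "carrier (gr (I_group n)) \<subseteq> \<Phi> ` carrier (L n)"
  proof
    fix f assume "f \<in> carrier (gr (I_group n))"
    then show "f \<in> \<Phi> ` carrier (L n)"
    proof (induction rule: I.gr_induct)
      case zero
      then show ?case using \<Phi>_zero by (metis L.zero_closed image_eqI)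
    next
      case (add c a f)
      obtain x where x: "x \<in> carrier (L n)" "gr_elem (I_group n) c a = \<Phi> x"
        using gr_elem_in_image[OF add(1,2)] by auto
      obtain y where y: "y \<in> carrier (L n)" "f = \<Phi> y" using add by auto
      show ?case unfolding x(2) y(2) \<Phi>_add[OF x(1) y(1), symmetric] using x y by simp
    qed
  qed
qed

section \<open>The kernel\<close>

lemma \<Phi>_johnson:
  assumes m: "2 \<le> m" "m \<le> n" and t: "hall {1..m} t" and k: "1 \<le> k" "k \<le> n"
  shows "gr_johnson n (\<Phi> (lie_eval (L n) (y_gen n m) t)) k w =
    (if k \<le> m then coeff (lie_poly t * ncs_var k - ncs_var k * lie_poly t) w else 0)"
proof -
  let ?d = "length (foliage t)"
  have d: "1 \<le> ?d" using foliage_neq_Nil[OF t] by (simp add: Suc_le_eq One_nat_def)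
  have h: "y_gen n m \<in> {1..m} \<rightarrow> carrier (L n)" using m y_gen_closed by auto
  obtain a g where a: "a \<in> lower_central (I_group n) ?d" "block_conj n m g a"
    "lie_eval (gr (I_group n)) (\<lambda>i. gr_elem (I_group n) 1 (y_inv n m i)) t = gr_elem (I_group n) ?d a"
    "ord_ge (Suc ?d) (magnus g - 1 - lie_poly t)"
    using hall_realization[OF m t] by blast
  have "\<Phi> (lie_eval (L n) (y_gen n m) t) = lie_eval (gr (I_group n)) (\<lambda>i. \<Phi> (y_gen n m i)) t"
    by (rule lie_eval_hom[OF L.lie_ring_axioms M.lie_ring_axioms hom h t])
  also have "\<dots> = lie_eval (gr (I_group n)) (\<lambda>i. gr_elem (I_group n) 1 (y_inv n m i)) t"
    using t by (induction rule: hall.induct) (use m gen in auto)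
  finally have eq: "\<Phi> (lie_eval (L n) (y_gen n m) t) = gr_elem (I_group n) ?d a" using a(3) by simp
  \<comment> \<open>\<open>lie_poly t\<close> is homogeneous, so the right-hand side vanishes at all
    word lengths but one, as the Johnson coefficients of a homogeneous class do.\<close>
  have hom_deg: "coeff (lie_poly t * ncs_var k - ncs_var k * lie_poly t) w = 0" if "length w \<noteq> Suc ?d"
  proof -
    have "coeff (lie_poly t) v = 0" if "length v \<noteq> ?d" for v
      using lie_poly_support(1)[OF t] that by blast
    then show ?thesis
      using that by (auto simp: coeff_simps(4) coeff_mult_var coeff_var_mult split: list.split)
  qed
  show ?thesis
    unfolding eq using gr_johnson_elem[OF d _ a(1), of k w]
      johnson_block_conj[OF a(2) ord_ge_lie_poly[OF t] a(4) k, of w] k hom_deg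
    by (cases "length w = Suc ?d") auto
qed

text \<open>Spanning writes \<open>x\<close> as a combination of Hall trees plus an element of
  \<open>J n\<close>. Applying \<open>\<Phi>\<close> to the combination gives zero, and its Johnson
  coefficients are the same combination of commutators with the letters, so
  \<open>block_independent\<close> makes every coefficient 0.\<close>

lemma kernel_sub_J:
  assumes x: "x \<in> carrier (L n)" and \<Phi>x: "\<Phi> x = \<zero>\<^bsub>gr (I_group n)\<^esub>"
  shows "x \<in> J n"
proof -
  define P where "P = {(m, t). 2 \<le> m \<and> m \<le> n \<and> hall {1..m} t}"
  define f where "f = (\<lambda>(m, t). lie_eval (L n) (y_gen n m) t)"
  interpret JJ: additive_subgroup "J n" "L n" using lie_ideal_J by (simp add: lie_ideal_def)
  have fP: "f ` P \<subseteq> carrier (L n)"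
    using B.H_sub unfolding P_def f_def B.H_def by fastforce
  then have "f ` P \<subseteq> carrier (add_monoid (L n))" by simp
  \<comment> \<open>Coefficients are attached to the pairs \<open>(m, t)\<close> in a free abelian
    group and not to their values in \<open>L n\<close>, because distinct pairs are not yet known to
    have distinct values.\<close>
  then obtain h where h: "h \<in> Group.hom (free_Abelian_group P) (add_monoid (L n))"
    and h_of: "\<And>p. p \<in> P \<Longrightarrow> h (frag_of p) = f p"
    using comm_group.free_Abelian_group_universal[OF L.a_comm_group] by metis
  interpret h: group_hom "free_Abelian_group P" "add_monoid (L n)" h
    using h by (intro group_hom.intro group_hom_axioms.intro L.a_group) simp_all
  have h_closed: "h c \<in> carrier (L n)" if "Poly_Mapping.keys c \<subseteq> P" for c
    using h.hom_closed[of c] that by simp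
  have h_add: "h (c + d) = h c \<oplus>\<^bsub>L n\<^esub> h d" if "Poly_Mapping.keys c \<subseteq> P" "Poly_Mapping.keys d \<subseteq> P" for c d
    using h.hom_mult[of c d] that by simp
  have h_minus: "h (- c) = \<ominus>\<^bsub>L n\<^esub> h c" if "Poly_Mapping.keys c \<subseteq> P" for c
    using h.hom_inv[of c] that by (simp add: a_inv_def)
  have h_zero: "h 0 = \<zero>\<^bsub>L n\<^esub>" using h.hom_one by simp
  have in_P: "\<exists>p\<in>P. u = f p" if u: "u \<in> (\<Union>m\<in>{2..n}. B.H m) \<union> J n" "u \<notin> J n" for u
  proof -
    obtain m where m: "m \<in> {2..n}" "u \<in> B.H m" using u by blast
    obtain t where t: "hall {1..m} t" "u = lie_eval (L n) (y_gen n m) t"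
      using m(2) unfolding B.H_def by blast
    show ?thesis by (rule bexI[of _ "(m, t)"]) (use m(1) t in \<open>simp_all add: P_def f_def\<close>)
  qed
  have in_J: "\<exists>c j. Poly_Mapping.keys c \<subseteq> P \<and> j \<in> J n \<and> u = h c \<oplus>\<^bsub>L n\<^esub> j" if "u \<in> J n" for u
  proof (intro exI conjI)
    show "Poly_Mapping.keys 0 \<subseteq> P" by simp
    show "u \<in> J n" by (rule that)
    show "u = h 0 \<oplus>\<^bsub>L n\<^esub> u" using JJ.a_subset that by (simp add: h_zero subsetD)
  qed
  have in_h: "\<exists>c j. Poly_Mapping.keys c \<subseteq> P \<and> j \<in> J n \<and> h d = h c \<oplus>\<^bsub>L n\<^esub> j"
    if d: "Poly_Mapping.keys d \<subseteq> P" for d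
  proof (intro exI conjI)
    show "Poly_Mapping.keys d \<subseteq> P" by (rule d)
    show "\<zero>\<^bsub>L n\<^esub> \<in> J n" by (rule JJ.zero_closed)
    show "h d = h d \<oplus>\<^bsub>L n\<^esub> \<zero>\<^bsub>L n\<^esub>" using h_closed[OF d] by simp
  qed
  have "x \<in> B.total" using equalityD1[OF carrier_L_eq_total] x by (rule subsetD)
  then have span: "\<exists>c j. Poly_Mapping.keys c \<subseteq> P \<and> j \<in> J n \<and> x = h c \<oplus>\<^bsub>L n\<^esub> j"
    unfolding B.total_def L.lspan_def
  proof (induction rule: generate.induct)
    case one
    show ?case using in_J[OF JJ.zero_closed] by simp
  next
    case (incl u)
    show ?case
    proof (cases "u \<in> J n")
      case False
      then obtain p where p: "p \<in> P" "u = f p" using in_P[OF incl] by blast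
      then show ?thesis using in_h[of "frag_of p"] by (simp add: h_of)
    qed (rule in_J)
  next
    case (inv u)
    show ?case
    proof (cases "u \<in> J n")
      case True
      then show ?thesis using in_J[OF JJ.a_inv_closed[OF True]] by (simp add: a_inv_def)
    next
      case False
      then obtain p where p: "p \<in> P" "u = f p" using in_P[OF inv] by blast
      then show ?thesis using in_h[of "- frag_of p"] h_minus[of "frag_of p"] by (simp add: h_of a_inv_def)
    qed
  next
    case (eng u v)
    obtain c i where c: "Poly_Mapping.keys c \<subseteq> P" "i \<in> J n" "u = h c \<oplus>\<^bsub>L n\<^esub> i" using eng.IH(1) by blast
    obtain d j where d: "Poly_Mapping.keys d \<subseteq> P" "j \<in> J n" "v = h d \<oplus>\<^bsub>L n\<^esub> j" using eng.IH(2) by blast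
    have "Poly_Mapping.keys (c + d) \<subseteq> P" using c(1) d(1) keys_add[of c d] by blast
    moreover have "i \<oplus>\<^bsub>L n\<^esub> j \<in> J n" using c(2) d(2) by simp
    moreover have "i \<in> carrier (L n)" "j \<in> carrier (L n)" using c(2) d(2) JJ.a_subset by auto
    then have "u \<oplus>\<^bsub>L n\<^esub> v = h (c + d) \<oplus>\<^bsub>L n\<^esub> (i \<oplus>\<^bsub>L n\<^esub> j)"
      using c d h_closed by (simp add: h_add L.a_ac)
    ultimately show ?case by auto
  qed
  then obtain c j where c: "Poly_Mapping.keys c \<subseteq> P" and j: "j \<in> J n" and xc: "x = h c \<oplus>\<^bsub>L n\<^esub> j" by blast
  have jc: "j \<in> carrier (L n)" "\<Phi> j = \<zero>\<^bsub>gr (I_group n)\<^esub>" using J_sub j by auto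
  have \<Phi>c: "\<Phi> (h c) = \<zero>\<^bsub>gr (I_group n)\<^esub>"
    using \<Phi>x jc h_closed[OF c] by (simp add: xc \<Phi>_add \<Phi>_closed)
  have zero_johnson: "gr_johnson n \<zero>\<^bsub>gr (I_group n)\<^esub> k w = 0" if "k \<in> {1..n}" for k w
    using gr_johnson_add[OF M.zero_closed M.zero_closed that, of w] by simp
  have minus_johnson: "gr_johnson n (\<ominus>\<^bsub>gr (I_group n)\<^esub> u) k w = - gr_johnson n u k w"
    if "u \<in> carrier (gr (I_group n))" "k \<in> {1..n}" for u k w
    using gr_johnson_add[OF that(1) M.a_inv_closed[OF that(1)] that(2), of w] that
    by (simp add: M.r_neg zero_johnson)
  have expand: "gr_johnson n (\<Phi> (h c)) k w =
      (\<Sum>p\<in>Poly_Mapping.keys c. poly_mapping.lookup c p * gr_johnson n (\<Phi> (f p)) k w)"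
    if k: "k \<in> {1..n}" and "Poly_Mapping.keys c \<subseteq> P" for k w c
  proof -
    let ?T = "\<lambda>c. gr_johnson n (\<Phi> (h c)) k w"
    let ?S = "\<lambda>K c. \<Sum>p\<in>K. poly_mapping.lookup c p * gr_johnson n (\<Phi> (f p)) k w"
    \<comment> \<open>Keys can cancel in a difference, so the sums are compared over a common finite
      set.\<close>
    have S: "?S (Poly_Mapping.keys c) c = ?S K c" if "finite K" "Poly_Mapping.keys c \<subseteq> K" for K c
      by (rule sum.mono_neutral_left[OF that]) (simp add: in_keys_iff)
    have "Poly_Mapping.keys c \<subseteq> P \<and> ?T c = ?S (Poly_Mapping.keys c) c"
      using that(2)
    proof (induction c rule: frag_induction)
      case zero
      then show ?case using k by (simp add: h_zero \<Phi>_zero zero_johnson)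
    next
      case (one p)
      then show ?case by (simp add: h_of)
    next
      case (diff a b)
      let ?K = "Poly_Mapping.keys a \<union> Poly_Mapping.keys b"
      have keys: "Poly_Mapping.keys (a - b) \<subseteq> ?K" by (rule keys_diff)
      have nb: "Poly_Mapping.keys (- b) \<subseteq> P" using diff by simp
      have ab: "h (a - b) = h a \<oplus>\<^bsub>L n\<^esub> (\<ominus>\<^bsub>L n\<^esub> h b)"
        using diff h_add[of a "- b"] nb h_minus[of b] by simp
      have "?T (a - b) = ?T a - ?T b"
        using diff k h_closed by (simp add: ab \<Phi>_add \<Phi>_minus gr_johnson_add \<Phi>_closed minus_johnson)
      also have "\<dots> = ?S ?K a - ?S ?K b" using diff S[of ?K a] S[of ?K b] by simp
      also have "\<dots> = ?S ?K (a - b)"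
        by (simp add: sum_subtractf[symmetric] lookup_minus left_diff_distrib)
      also have "\<dots> = ?S (Poly_Mapping.keys (a - b)) (a - b)"
        using S[of ?K "a - b"] keys by simp
      finally show ?case using keys diff by blast
    qed
    then show ?thesis ..
  qed
  have "poly_mapping.lookup c p = 0" if p: "p \<in> Poly_Mapping.keys c" for p
  proof (rule block_independent[of "Poly_Mapping.keys c" n "poly_mapping.lookup c" p])
    show "2 \<le> m \<and> m \<le> n \<and> hall {1..m} t" if "(m, t) \<in> Poly_Mapping.keys c" for m t
      using that c by (auto simp: P_def)
    show "(\<Sum>p\<in>Poly_Mapping.keys c. poly_mapping.lookup c p * (if k \<le> fst p
        then coeff (lie_poly (snd p) * ncs_var k - ncs_var k * lie_poly (snd p)) w else 0)) = 0"
      if k: "1 \<le> k" "k \<le> n" for k w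
    proof -
      have "(\<Sum>p\<in>Poly_Mapping.keys c. poly_mapping.lookup c p * (if k \<le> fst p
          then coeff (lie_poly (snd p) * ncs_var k - ncs_var k * lie_poly (snd p)) w else 0)) =
        (\<Sum>p\<in>Poly_Mapping.keys c. poly_mapping.lookup c p * gr_johnson n (\<Phi> (f p)) k w)"
      proof (rule sum.cong[OF HOL.refl])
        fix p assume "p \<in> Poly_Mapping.keys c"
        then have pP: "2 \<le> fst p" "fst p \<le> n" "hall {1..fst p} (snd p)" using c by (auto simp: P_def)
        have "f p = lie_eval (L n) (y_gen n (fst p)) (snd p)" by (simp add: f_def split_beta)
        then show "poly_mapping.lookup c p * (if k \<le> fst p
            then coeff (lie_poly (snd p) * ncs_var k - ncs_var k * lie_poly (snd p)) w else 0) =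
            poly_mapping.lookup c p * gr_johnson n (\<Phi> (f p)) k w"
          using \<Phi>_johnson[OF pP k, of w] by simp
      qed
      also have "\<dots> = 0" using expand[OF _ c, of k w] k zero_johnson[of k w] by (simp add: \<Phi>c)
      finally show ?thesis .
    qed
  qed (use p in simp_all)
  then have "poly_mapping.lookup c p = 0" for p by (cases "p \<in> Poly_Mapping.keys c") (simp_all add: in_keys_iff)
  then have "c = 0" by (intro poly_mapping_eqI) simp
  then show ?thesis using j jc by (simp add: xc h_zero)
qed

end

theorem theorem3:
  fixes n :: nat
  assumes "n \<ge> 3"
  shows "lie_isomorphic (L n Quot J n) (gr (I_group n))"
proof -
  interpret I: group "I_group n" by (rule group_I_group)
  have L: "lie_ring (L n)" by (rule lie_ring_free_lie_ring)
  have M: "lie_ring (gr (I_group n))" by (rule I.lie_ring_gr)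
  define h where "h = (\<lambda>(m, i). gr_elem (I_group n) 1 (y_inv n m i))"
  have "h \<in> y_index n \<rightarrow> carrier (gr (I_group n))"
    using y_inv_in_I_group unfolding h_def y_index_def
    by (auto intro!: I.gr_elem_closed simp: One_nat_def)
  then obtain \<Phi> where \<Phi>: "\<Phi> \<in> lie_hom (L n) (gr (I_group n))"
    "\<forall>p\<in>y_index n. \<Phi> (lie_class (y_index n) (Gen p)) = h p"
    using free_lie_ring_universal(1)[OF M] by blast
  interpret I_group_presentation n \<Phi>
    by unfold_locales (use \<Phi> in \<open>auto simp: y_gen_def y_index_def h_def\<close>)
  show ?thesis
    by (rule lie_isomorphic_quotient[OF L M lie_ideal_J \<Phi>(1) \<Phi>_surj])
      (use J_sub kernel_sub_J in blast)
qed

end
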